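(* Let $M=\Gamma\backslash\mathbb{H}^2$ be a compact or convex co-compact hyperbolic surface. Then for every $\lambda_0\in\mathbb{C}$ $$\mathrm{Ran}(\Pi^X_{\lambda_0})=\bigoplus_{0\le\ell\le|\mathrm{Re}(\lambda_0)|}U_+^\ell\Big(\mathrm{Ran}(\Pi^X_{\lambda_0+\ell})\cap\ker U_-\Big),$$ where $\ell$ runs over integers, and the map $U_+^\ell:\mathrm{Ran}(\Pi^X_{\lambda_0+\ell})\cap\ker U_-\to\mathrm{Ran}(\Pi^X_{\lambda_0})$ is injective unless $\lambda_0+\ell=0$.
   Context: Surface and frame. $\Gamma\subset G=\mathrm{PSL}_2(\mathbb{R})$ is a discrete subgroup whose non-trivial elements are hyperbolic, $\Lambda_\Gamma\subset\partial\mathbb{H}^2$ its limit set; $M=\Gamma\backslash\mathbb{H}^2$ is oriented. Either $M$ is compact, or $\Gamma$ (and $M$) is convex co-compact: $\Gamma$ is not co-compact and acts co-compactly on the convex hull of $\Lambda_\Gamma$ in $\mathbb{H}^2$. $G$ acts simply transitively on the unit tangent bundle $S\mathbb{H}^2$; identify $S\mathbb{H}^2\simeq G$ by $g\mapsto g\cdot v_0$, where in the upper half-plane model $v_0$ is the upward unit vector at $i$. Then $SM\simeq\Gamma\backslash G$, and left-invariant vector fields descend to $SM$. Let $X=\begin{pmatrix}1/2&0\\0&-1/2\end{pmatrix}$, $U_+=\begin{pmatrix}0&1\\0&0\end{pmatrix}$, $U_-=\begin{pmatrix}0&0\\1&0\end{pmatrix}$, viewed as vector fields on $SM$: $X$ generates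 the geodesic flow $\varphi_t$, $U_+$ spans the stable bundle, $U_-$ the unstable bundle, and $[X,U_\pm]=\pm U_\pm$. They act on $\mathcal{D}'(SM)$; $\ker U_-$ is the kernel in $\mathcal{D}'(SM)$. Ruelle resonances. For $\mathrm{Re}(\lambda)>0$ and $f\in C_c^\infty(SM)$ set $R_X(\lambda)f=-\int_0^\infty e^{-\lambda t}f\circ\varphi_{-t}\,dt=(-X-\lambda)^{-1}f$. It is known that $R_X(\lambda)$ extends meromorphically to $\mathbb{C}$ as a family of operators $C_c^\infty(SM)\to\mathcal{D}'(SM)$ with residues of finite rank; $\Pi^X_{\lambda_0}$ denotes the residue at $\lambda_0$ (zero if $\lambda_0$ is not a pole), and $\mathrm{Ran}(\Pi^X_{\lambda_0})$ is the space of generalized Ruelle resonant states. *)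

theory Defs
  imports "HOL-Complex_Analysis.Complex_Analysis" "HOL-Algebra.Group"
begin

no_notation fps_nth (infixl \<open>$\<close> 75)

section \<open>The group \<open>PSL(2,R)\<close>\<close>

type_synonym mat2 = "real^2^2"

definition psl2_rel :: "mat2 \<Rightarrow> mat2 \<Rightarrow> bool" where
  "psl2_rel A B \<longleftrightarrow> det A = 1 \<and> det B = 1 \<and> (A = B \<or> A = - B)"

lemma det_uminus_mat2: "det (- A) = det (A :: mat2)"
  by (simp add: det_2)

quotient_type psl2 = mat2 / partial: psl2_rel
  morphisms rep_psl2 abs_psl2
proof (rule part_equivpI)
  show "\<exists>A. psl2_rel A A"
    by (rule exI[of _ "mat 1"]) (simp add: psl2_rel_def)
  show "symp psl2_rel"
    by (auto simp: symp_def psl2_rel_def)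
  show "transp psl2_rel"
    by (auto simp: transp_def psl2_rel_def)
qed

lemma minus_matrix_mult_left: "(- A) ** B = - (A ** (B :: mat2))"
  by (simp add: matrix_matrix_mult_def vec_eq_iff sum_negf)

lemma minus_matrix_mult_right: "A ** (- B) = - (A ** (B :: mat2))"
  by (simp add: matrix_matrix_mult_def vec_eq_iff sum_negf)

instantiation psl2 :: monoid_mult
begin

lift_definition one_psl2 :: psl2 is "mat 1"
  by (simp add: psl2_rel_def)

lift_definition times_psl2 :: "psl2 \<Rightarrow> psl2 \<Rightarrow> psl2" is "(**)"
proof -
  fix A A' B B' :: mat2
  assume "psl2_rel A A'" "psl2_rel B B'"
  then show "psl2_rel (A ** B) (A' ** B')"
    unfolding psl2_rel_def
    by (elim conjE disjE) (simp_all add: det_mul det_uminus_mat2 minus_matrix_mult_left minus_matrix_mult_right)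
qed

instance
proof
  fix a b c :: psl2
  show "a * b * c = a * (b * c)"
  proof (induction a rule: psl2.abs_induct, induction b rule: psl2.abs_induct, induction c rule: psl2.abs_induct)
    fix A B C :: mat2
    assume *: "psl2_rel A A" "psl2_rel B B" "psl2_rel C C"
    then have "psl2_rel (A ** B) (A ** B)" "psl2_rel (B ** C) (B ** C)"
      by (simp_all add: psl2_rel_def det_mul)
    with * show "abs_psl2 A * abs_psl2 B * abs_psl2 C = abs_psl2 A * (abs_psl2 B * abs_psl2 C)"
      by (simp add: times_psl2.abs_eq matrix_mul_assoc)
  qed
  have one: "psl2_rel (mat 1) (mat 1)"
    by (simp add: psl2_rel_def)
  show "1 * a = a"
    by (induction a rule: psl2.abs_induct) (simp add: one_psl2_def times_psl2.abs_eq one)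
  show "a * 1 = a"
    by (induction a rule: psl2.abs_induct) (simp add: one_psl2_def times_psl2.abs_eq one)
qed

end

text \<open>The quotient topology of the topology that \<open>SL(2,R)\<close> inherits from the space of matrices.\<close>

instantiation psl2 :: topological_space
begin

definition open_psl2 :: "psl2 set \<Rightarrow> bool" where
  "open_psl2 U \<longleftrightarrow>
     openin (top_of_set {A :: mat2. det A = 1}) {A. det A = 1 \<and> abs_psl2 A \<in> U}"

instance
proof
  have "openin (top_of_set {A :: mat2. det A = 1}) {A. det A = 1}"
    by (rule openin_subtopology_self)
  then show "open (UNIV :: psl2 set)"
    unfolding open_psl2_def by simp
next
  fix S T :: "psl2 set"
  assume "open S" "open T"
  then have "openin (top_of_set {A :: mat2. det A = 1})
    ({A. det A = 1 \<and> abs_psl2 A \<in> S} \<inter> {A. det A = 1 \<and> abs_psl2 A \<in> T})"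
    unfolding open_psl2_def by (rule openin_Int)
  also have "{A :: mat2. det A = 1 \<and> abs_psl2 A \<in> S} \<inter> {A. det A = 1 \<and> abs_psl2 A \<in> T} =
    {A. det A = 1 \<and> abs_psl2 A \<in> S \<inter> T}"
    by blast
  finally show "open (S \<inter> T)"
    unfolding open_psl2_def .
next
  fix K :: "psl2 set set"
  assume *: "\<forall>S\<in>K. open S"
  have "openin (top_of_set {A :: mat2. det A = 1})
    (\<Union>((\<lambda>S. {A. det A = 1 \<and> abs_psl2 A \<in> S}) ` K))"
  proof (rule openin_Union)
    fix V assume "V \<in> (\<lambda>S. {A :: mat2. det A = 1 \<and> abs_psl2 A \<in> S}) ` K"
    then show "openin (top_of_set {A :: mat2. det A = 1}) V"
      using * unfolding open_psl2_def by blast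
  qed
  also have "\<Union>((\<lambda>S. {A :: mat2. det A = 1 \<and> abs_psl2 A \<in> S}) ` K) =
    {A. det A = 1 \<and> abs_psl2 A \<in> \<Union>K}"
    by blast
  finally show "open (\<Union>K)"
    unfolding open_psl2_def .
qed

end

definition PSL2R :: "psl2 monoid" where
  "PSL2R = \<lparr>carrier = UNIV, monoid.mult = (*), one = 1\<rparr>"

lemma group_PSL2R: "group PSL2R"
proof (rule groupI)
  fix x assume "x \<in> carrier PSL2R"
  have "\<exists>y :: psl2. y * x = 1"
  proof (induction x rule: psl2.abs_induct)
    case (1 A)
    then have "invertible A"
      by (simp add: psl2_rel_def invertible_det_nz)
    then obtain B where B: "B ** A = mat 1"
      by (auto simp: invertible_def)
    have "det B = 1"
      using arg_cong[OF B, of det] 1 by (simp add: det_mul psl2_rel_def)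
    then have "abs_psl2 B * abs_psl2 A = 1"
      using 1 B by (simp add: times_psl2.abs_eq psl2_rel_def one_psl2_def)
    then show ?case ..
  qed
  then show "\<exists>y\<in>carrier PSL2R. y \<otimes>\<^bsub>PSL2R\<^esub> x = \<one>\<^bsub>PSL2R\<^esub>"
    by (simp add: PSL2R_def)
qed (auto simp: PSL2R_def mult.assoc)

lift_definition hyperbolic :: "psl2 \<Rightarrow> bool" is "\<lambda>A. \<bar>trace A\<bar> > 2"
  by (auto simp: psl2_rel_def trace_def sum_2)


section \<open>One-parameter subgroups and the geodesic flow\<close>

definition mexp :: "mat2 \<Rightarrow> mat2" where
  "mexp A = (\<Sum>n. (1 / fact n) *\<^sub>R (((**) A ^^ n) (mat 1)))"

definition one_param :: "mat2 \<Rightarrow> real \<Rightarrow> psl2" where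
  "one_param V t = abs_psl2 (mexp (t *\<^sub>R V))"

definition X_mat :: mat2 where
  "X_mat = vector [vector [1/2, 0], vector [0, -1/2]]"

definition Uplus :: mat2 where
  "Uplus = vector [vector [0, 1], vector [0, 0]]"

definition Uminus :: mat2 where
  "Uminus = vector [vector [0, 0], vector [1, 0]]"

text \<open>Under \<open>g \<mapsto> g \<cdot> v\<^sub>0\<close> the unit tangent bundle of the hyperbolic plane is the group itself, and the
  geodesic flow is right multiplication by \<open>exp (t X)\<close>.\<close>

definition geodesic_flow :: "real \<Rightarrow> psl2 \<Rightarrow> psl2" where
  "geodesic_flow t g = g * one_param X_mat t"


section \<open>Compact and convex co-compact surfaces\<close>

definition upper_half :: "complex set" where
  "upper_half = {z. 0 < Im z}"

lift_definition moebius :: "psl2 \<Rightarrow> complex \<Rightarrow> complex" is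
  "\<lambda>A z. (of_real (A$1$1) * z + of_real (A$1$2)) / (of_real (A$2$1) * z + of_real (A$2$2))"
proof -
  fix A B :: mat2
  assume "psl2_rel A B"
  then consider "A = B" | "A = - B"
    by (auto simp: psl2_rel_def)
  then show "(\<lambda>z. (complex_of_real (A$1$1) * z + of_real (A$1$2)) /
                   (of_real (A$2$1) * z + of_real (A$2$2))) =
             (\<lambda>z. (of_real (B$1$1) * z + of_real (B$1$2)) /
                   (of_real (B$2$1) * z + of_real (B$2$2)))"
  proof cases
    case 2
    have "(- a * z + - b) / (- c * z + - d) = (a * z + b) / (c * z + d)" for a b c d z :: complex
    proof -
      have "- a * z + - b = - (a * z + b)" "- c * z + - d = - (c * z + d)"
        by simp_all
      then show ?thesis
        by (simp only: minus_divide_divide)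
    qed
    then show ?thesis
      using 2 by simp
  qed simp
qed

text \<open>The unit-speed geodesic of the upper half-plane with initial vector \<open>g \<cdot> v\<^sub>0\<close>.\<close>

definition geodesic :: "psl2 \<Rightarrow> real \<Rightarrow> complex" where
  "geodesic g t = moebius (geodesic_flow t g) \<i>"

text \<open>The Cayley transform maps the upper half-plane to the unit disc; the boundary at infinity of
  the hyperbolic plane is represented by the unit circle.\<close>

definition cayley :: "complex \<Rightarrow> complex" where
  "cayley z = (z - \<i>) / (z + \<i>)"

definition limit_set :: "psl2 set \<Rightarrow> complex set" where
  "limit_set \<Gamma> = {\<xi>. cmod \<xi> = 1 \<and> \<xi> islimpt ((\<lambda>\<gamma>. cayley (moebius \<gamma> \<i>)) ` \<Gamma>)}"

definition geodesically_convex :: "complex set \<Rightarrow> bool" where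
  "geodesically_convex C \<longleftrightarrow> C \<subseteq> upper_half \<and>
     (\<forall>g s t u. s \<le> t \<and> t \<le> u \<and> geodesic g s \<in> C \<and> geodesic g u \<in> C \<longrightarrow> geodesic g t \<in> C)"

text \<open>For a set \<open>\<Lambda>\<close> of points at infinity: the smallest convex set that contains all geodesics with
  both end points in \<open>\<Lambda>\<close>.\<close>

definition hyperbolic_hull :: "complex set \<Rightarrow> complex set" where
  "hyperbolic_hull \<Lambda> = \<Inter>{C. geodesically_convex C \<and>
     (\<forall>g. \<forall>\<xi>\<in>\<Lambda>. \<forall>\<eta>\<in>\<Lambda>.
        ((\<lambda>t. cayley (geodesic g t)) \<longlongrightarrow> \<xi>) at_bot \<and>
        ((\<lambda>t. cayley (geodesic g t)) \<longlongrightarrow> \<eta>) at_top \<longrightarrow> range (geodesic g) \<subseteq> C)}"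

definition acts_cocompactly :: "psl2 set \<Rightarrow> complex set \<Rightarrow> bool" where
  "acts_cocompactly \<Gamma> Y \<longleftrightarrow> (\<exists>K. compact K \<and> K \<subseteq> Y \<and> (\<Union>\<gamma>\<in>\<Gamma>. moebius \<gamma> ` K) = Y)"

text \<open>The groups \<open>\<Gamma>\<close> for which \<open>M = \<Gamma> \ H\<close> is a compact or convex co-compact hyperbolic surface.\<close>

definition surface_group :: "psl2 set \<Rightarrow> bool" where
  "surface_group \<Gamma> \<longleftrightarrow> subgroup \<Gamma> PSL2R \<and> discrete \<Gamma> \<and> (\<forall>\<gamma>\<in>\<Gamma>. \<gamma> \<noteq> 1 \<longrightarrow> hyperbolic \<gamma>)"

definition compact_surface :: "psl2 set \<Rightarrow> bool" where
  "compact_surface \<Gamma> \<longleftrightarrow> surface_group \<Gamma> \<and> acts_cocompactly \<Gamma> upper_half"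

definition convex_cocompact_surface :: "psl2 set \<Rightarrow> bool" where
  "convex_cocompact_surface \<Gamma> \<longleftrightarrow> surface_group \<Gamma> \<and> \<not> acts_cocompactly \<Gamma> upper_half \<and>
     acts_cocompactly \<Gamma> (hyperbolic_hull (limit_set \<Gamma>))"


section \<open>Test functions and distributions on \<open>SM = \<Gamma> \ G\<close>\<close>

text \<open>The left-invariant vector field of \<open>V\<close>, acting on functions on the group.\<close>

definition lie_deriv :: "mat2 \<Rightarrow> (psl2 \<Rightarrow> complex) \<Rightarrow> psl2 \<Rightarrow> complex" where
  "lie_deriv V f g = vector_derivative (\<lambda>t. f (g * one_param V t)) (at 0)"

definition lie_word :: "mat2 list \<Rightarrow> (psl2 \<Rightarrow> complex) \<Rightarrow> psl2 \<Rightarrow> complex" where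
  "lie_word Vs f = foldr lie_deriv Vs f"

definition frame :: "mat2 set" where
  "frame = {X_mat, Uplus, Uminus}"

text \<open>Smoothness in terms of the global frame: all iterated derivatives along the frame exist and are
  continuous.\<close>

definition smooth :: "(psl2 \<Rightarrow> complex) \<Rightarrow> bool" where
  "smooth f \<longleftrightarrow> (\<forall>Vs. set Vs \<subseteq> frame \<longrightarrow>
     continuous_on UNIV (lie_word Vs f) \<and>
     (\<forall>V\<in>frame. \<forall>g. (\<lambda>t. lie_word Vs f (g * one_param V t)) differentiable (at 0)))"

text \<open>Functions on \<open>SM\<close> are left \<open>\<Gamma>\<close>-invariant functions on the group; \<open>supported_in \<Gamma> K f\<close> says that
  the support of \<open>f\<close> lies in the image of \<open>K\<close> in \<open>SM\<close> (for compact \<open>K\<close>).\<close>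

definition supported_in :: "psl2 set \<Rightarrow> psl2 set \<Rightarrow> (psl2 \<Rightarrow> complex) \<Rightarrow> bool" where
  "supported_in \<Gamma> K f \<longleftrightarrow> (\<forall>g. f g \<noteq> 0 \<longrightarrow> (\<exists>\<gamma>\<in>\<Gamma>. \<gamma> * g \<in> K))"

definition test_fun :: "psl2 set \<Rightarrow> (psl2 \<Rightarrow> complex) set" where
  "test_fun \<Gamma> = {f. smooth f \<and> (\<forall>\<gamma>\<in>\<Gamma>. \<forall>g. f (\<gamma> * g) = f g) \<and> (\<exists>K. compact K \<and> supported_in \<Gamma> K f)}"

definition Ck_norm :: "nat \<Rightarrow> (psl2 \<Rightarrow> complex) \<Rightarrow> real" where
  "Ck_norm k f = (SUP (Vs, g) \<in> {Vs. set Vs \<subseteq> frame \<and> length Vs \<le> k} \<times> UNIV. cmod (lie_word Vs f g))"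

text \<open>Continuous linear functionals on \<open>test_fun \<Gamma>\<close>, made total by the value 0 outside of it, so that
  equality of distributions is equality of functions.\<close>

type_synonym functional = "(psl2 \<Rightarrow> complex) \<Rightarrow> complex"

definition distributions :: "psl2 set \<Rightarrow> functional set" where
  "distributions \<Gamma> = {u.
     (\<forall>\<psi>. \<psi> \<notin> test_fun \<Gamma> \<longrightarrow> u \<psi> = 0) \<and>
     (\<forall>\<phi>\<in>test_fun \<Gamma>. \<forall>\<psi>\<in>test_fun \<Gamma>. \<forall>a b. u (\<lambda>g. a * \<phi> g + b * \<psi> g) = a * u \<phi> + b * u \<psi>) \<and>
     (\<forall>K. compact K \<longrightarrow> (\<exists>C k. \<forall>\<psi>\<in>test_fun \<Gamma>. supported_in \<Gamma> K \<psi> \<longrightarrow> cmod (u \<psi>) \<le> C * Ck_norm k \<psi>))}"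

text \<open>The group is unimodular, so left-invariant vector fields are antisymmetric for the invariant
  measure, and they act on distributions by duality as follows.\<close>

definition dist_deriv :: "psl2 set \<Rightarrow> mat2 \<Rightarrow> functional \<Rightarrow> functional" where
  "dist_deriv \<Gamma> V u = (\<lambda>\<psi>. if \<psi> \<in> test_fun \<Gamma> then - u (lie_deriv V \<psi>) else 0)"

definition ker_dist :: "psl2 set \<Rightarrow> mat2 \<Rightarrow> functional set" where
  "ker_dist \<Gamma> V = {u \<in> distributions \<Gamma>. dist_deriv \<Gamma> V u = (\<lambda>\<psi>. 0)}"


section \<open>The invariant measure, and functions as distributions\<close>

text \<open>Lebesgue measure on matrices is invariant under left and right multiplication by \<open>SL(2,R)\<close>. The
  measure of a set \<open>E\<close> below is the Lebesgue measure of the cone \<open>{r A | 0 < r \<le> 1, [A] \<in> E}\<close>; this is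
  a Haar measure. Its normalization plays no role.\<close>

definition haar :: "psl2 measure" where
  "haar = distr (restrict_space lborel {A :: mat2. 0 < det A \<and> det A \<le> 1}) borel
            (\<lambda>A. abs_psl2 ((1 / sqrt (det A)) *\<^sub>R A))"

definition fundamental_domain :: "psl2 set \<Rightarrow> psl2 set \<Rightarrow> bool" where
  "fundamental_domain \<Gamma> D \<longleftrightarrow> D \<in> sets borel \<and> (\<forall>g. \<exists>!\<gamma>. \<gamma> \<in> \<Gamma> \<and> \<gamma> * g \<in> D)"

text \<open>The integral over \<open>SM\<close> of a \<open>\<Gamma>\<close>-invariant function does not depend on the fundamental domain.\<close>

definition SM_integral :: "psl2 set \<Rightarrow> (psl2 \<Rightarrow> complex) \<Rightarrow> complex" where
  "SM_integral \<Gamma> F = (LINT g:(SOME D. fundamental_domain \<Gamma> D)|haar. F g)"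

definition fun_dist :: "psl2 set \<Rightarrow> (psl2 \<Rightarrow> complex) \<Rightarrow> functional" where
  "fun_dist \<Gamma> F = (\<lambda>\<psi>. if \<psi> \<in> test_fun \<Gamma> then SM_integral \<Gamma> (\<lambda>g. F g * \<psi> g) else 0)"


section \<open>The resolvent and Ruelle resonant states\<close>

definition resolvent :: "complex \<Rightarrow> (psl2 \<Rightarrow> complex) \<Rightarrow> psl2 \<Rightarrow> complex" where
  "resolvent s f g = - (LINT t:{0..}|lborel. exp (- s * of_real t) * f (geodesic_flow (- t) g))"

type_synonym operator = "(psl2 \<Rightarrow> complex) \<Rightarrow> functional"

text \<open>Linear and separately continuous, that is, continuous from test functions to distributions with
  the weak topology.\<close>

definition cont_operator :: "psl2 set \<Rightarrow> operator \<Rightarrow> bool" where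
  "cont_operator \<Gamma> A \<longleftrightarrow>
     (\<forall>f\<in>test_fun \<Gamma>. A f \<in> distributions \<Gamma>) \<and>
     (\<forall>\<psi>\<in>test_fun \<Gamma>. (\<lambda>f. if f \<in> test_fun \<Gamma> then A f \<psi> else 0) \<in> distributions \<Gamma>)"

definition holomorphic_family :: "psl2 set \<Rightarrow> complex set \<Rightarrow> (complex \<Rightarrow> operator) \<Rightarrow> bool" where
  "holomorphic_family \<Gamma> S R \<longleftrightarrow> (\<forall>s\<in>S. cont_operator \<Gamma> (R s)) \<and>
     (\<forall>f\<in>test_fun \<Gamma>. \<forall>\<psi>\<in>test_fun \<Gamma>. (\<lambda>s. R s f \<psi>) holomorphic_on S)"

text \<open>Holomorphic away from a set \<open>P\<close> without limit points, with at most a pole at each point of \<open>P\<close>.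
  The values at points of \<open>P\<close> are irrelevant.\<close>

definition meromorphic_family :: "psl2 set \<Rightarrow> (complex \<Rightarrow> operator) \<Rightarrow> bool" where
  "meromorphic_family \<Gamma> R \<longleftrightarrow> (\<exists>P. P sparse_in UNIV \<and> holomorphic_family \<Gamma> (- P) R \<and>
     (\<forall>p\<in>P. \<exists>N A H r. 0 < r \<and> (\<forall>k\<in>{1..N::nat}. cont_operator \<Gamma> (A k)) \<and>
        holomorphic_family \<Gamma> (ball p r) H \<and>
        (\<forall>s\<in>ball p r - {p}. \<forall>f\<in>test_fun \<Gamma>. \<forall>\<psi>\<in>test_fun \<Gamma>.
           R s f \<psi> = H s f \<psi> + (\<Sum>k=1..N. A k f \<psi> / (s - p) ^ k))))"

text \<open>For the extended resolvent \<open>R\<close> this is \<open>\<Pi>\<^sup>X\<close> at \<open>s\<^sub>0\<close>.\<close>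

definition residue_op :: "psl2 set \<Rightarrow> (complex \<Rightarrow> operator) \<Rightarrow> complex \<Rightarrow> operator" where
  "residue_op \<Gamma> R s\<^sub>0 f = (\<lambda>\<psi>. if \<psi> \<in> test_fun \<Gamma> then residue (\<lambda>s. R s f \<psi>) s\<^sub>0 else 0)"

definition ran_residue :: "psl2 set \<Rightarrow> (complex \<Rightarrow> operator) \<Rightarrow> complex \<Rightarrow> functional set" where
  "ran_residue \<Gamma> R s\<^sub>0 = residue_op \<Gamma> R s\<^sub>0 ` test_fun \<Gamma>"

definition finite_rank :: "functional set \<Rightarrow> bool" where
  "finite_rank W \<longleftrightarrow> (\<exists>B. finite B \<and> (\<forall>u\<in>W. \<exists>c. u = (\<lambda>\<psi>. \<Sum>b\<in>B. c b * b \<psi>)))"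

text \<open>\<open>R\<close> is the meromorphic extension of \<open>R\<^sub>X\<close> to the complex plane. By the identity theorem it is
  unique up to its values at poles.\<close>

definition resolvent_extension :: "psl2 set \<Rightarrow> (complex \<Rightarrow> operator) \<Rightarrow> bool" where
  "resolvent_extension \<Gamma> R \<longleftrightarrow> meromorphic_family \<Gamma> R \<and>
     (\<forall>s. 0 < Re s \<longrightarrow> (\<forall>f\<in>test_fun \<Gamma>. R s f = fun_dist \<Gamma> (resolvent s f))) \<and>
     (\<forall>s\<^sub>0. finite_rank (ran_residue \<Gamma> R s\<^sub>0))"


section \<open>Internal direct sums\<close>

text \<open>For linear subspaces \<open>E i\<close>: \<open>W\<close> is the sum of the \<open>E i\<close>, and the decomposition of an element of
  \<open>W\<close> is unique.\<close>

definition is_direct_sum :: "'i set \<Rightarrow> ('i \<Rightarrow> functional set) \<Rightarrow> functional set \<Rightarrow> bool" where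
  "is_direct_sum I E W \<longleftrightarrow> bij_betw (\<lambda>v \<psi>. \<Sum>i\<in>I. v i \<psi>) (Pi\<^sub>E I E) W"

end

theory Submission
  imports Defs "HOL-Real_Asymp.Real_Asymp" "HOL-Library.Function_Algebras"
begin

text \<open>Integration over \<open>SM\<close> turns the resolvent in the right half-plane into the Laplace transform of
  the correlations of \<open>f \<circ> \<phi>\<^sub>-\<^sub>t\<close> and \<open>\<psi>\<close>. There the commutation relations with the frame read
  \<open>V R(s) = R(s - w) V\<close>, where \<open>w\<close> is the weight of \<open>V\<close> under \<open>ad X\<close>; by the identity theorem they
  hold everywhere, so the spaces \<open>W\<^sub>s = Ran \<Pi>\<^sub>s\<close> form a representation of \<open>sl(2)\<close> on which \<open>X + s\<close> is
  nilpotent, and \<open>W\<^sub>s = 0\<close> for \<open>Re s > 0\<close>. On \<open>W\<^sub>\<mu> \<inter> ker U\<^sub>-\<close> the operator \<open>U\<^sub>-\<^sup>l U\<^sub>+\<^sup>l\<close> is a polynomial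
  in \<open>X\<close>, invertible unless \<open>\<mu> = 0\<close>, which gives the decomposition of lowest weight type away from
  \<open>\<mu> = 0\<close>.

  At \<open>\<mu> = 0\<close> one needs \<open>U\<^sub>+ W\<^sub>0 = 0\<close> and \<open>U\<^sub>- W\<^sub>-\<^sub>1 = 0\<close>. The pole at \<open>0\<close> is at most simple, and its
  residue is a form on test functions that is bounded in \<open>L\<^sup>2\<close> and invariant under the geodesic flow in
  both arguments; by Mautner's argument it is annihilated by \<open>U\<^sub>+\<close> and \<open>U\<^sub>-\<close>.\<close>

section \<open>Matrices and one-parameter subgroups\<close>

text \<open>The spaces \<open>W \<mu>\<close> sit in the generalized eigenspaces of \<open>X\<close>
  for -\<mu>, and on lowest weight vectors \<open>F E^(l+1) = - (l+1) E^l (2 X + l)\<close>, whose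
  last factor has the single eigenvalue l - 2 \<mu>. As \<open>W \<mu> = 0\<close> for Re \<mu> > 0,
  this is zero only for l = \<mu> = 0: there is one exceptional weight, and Jordan blocks do no harm
  elsewhere. The same vanishing bounds the sum, because its l-th term starts from
  \<open>W (s_0 + l)\<close>. At the exceptional weight the commutation relations do not suffice. Of
  the two analytic facts used there, the one on \<open>W (-1)\<close> concerns the input of the
  residue, since commuting turns \<open>U_-\<close> of a residue at -1 into the residue at 0 of
  \<open>U_- f\<close>; this is why invariance is needed in both arguments. Mautner's argument is
  run on test functions alone: a near-minimizer of a quadratic functional takes the place of a Riesz
  vector. Smoothness speaks of frame derivatives only, so brackets are read off from second order
  Taylor expansions along curves, and the integral over SM is a measure on the \<Gamma>-invariant
  Borel sets of the group.\<close>

lemma psl2_rel_refl [simp]: "psl2_rel A A \<longleftrightarrow> det A = 1"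
  by (auto simp: psl2_rel_def)

lemma psl2_cases: obtains A where "det A = 1" "g = abs_psl2 A"
  by (induction g rule: psl2.abs_induct) auto

lemma abs_psl2_eq_iff:
  assumes "det A = 1" "det B = 1"
  shows "abs_psl2 A = abs_psl2 B \<longleftrightarrow> A = B \<or> A = - B"
  using Quotient3_rel[OF Quotient3_psl2, of A B] assms by (auto simp: psl2_rel_def)

lemma abs_psl2_mult: "det A = 1 \<Longrightarrow> det B = 1 \<Longrightarrow>
  abs_psl2 A * abs_psl2 B = abs_psl2 (A ** B)"
  by (simp add: times_psl2.abs_eq)

lemma abs_psl2_one: "abs_psl2 (mat 1) = 1"
  by (simp add: one_psl2_def)

definition mat22 :: "real \<Rightarrow> real \<Rightarrow> real \<Rightarrow> real \<Rightarrow> mat2" where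
  "mat22 a b c d = vector [vector [a, b], vector [c, d]]"

lemma mat22_nth [simp]:
  "mat22 a b c d $ 1 $ 1 = a" "mat22 a b c d $ 1 $ 2 = b" "mat22 a b c d $ 2 $ 1 = c" "mat22 a b c d $ 2 $ 2 = d"
  by (simp_all add: mat22_def)

lemma mat2_eq_iff: "A = B \<longleftrightarrow> A$1$1 = B$1$1 \<and> A$1$2 = B$1$2 \<and> A$2$1 = B$2$1
  \<and> A$2$2 = (B::mat2)$2$2"
  by (simp add: vec_eq_iff forall_2)

lemma mat22_cases: obtains a b c d where "A = mat22 a b c d"
  by (rule that[of "A$1$1" "A$1$2" "A$2$1" "A$2$2"]) (simp add: mat2_eq_iff)

lemma mat22_eq_iff [simp]: "mat22 a b c d = mat22 a' b' c' d' \<longleftrightarrow>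
  a = a' \<and> b = b' \<and> c = c' \<and> d = d'"
  by (simp add: mat2_eq_iff)

lemma det_mat22 [simp]: "det (mat22 a b c d) = a * d - b * c"
  by (simp add: det_2)

lemma mat22_mult [simp]: "mat22 a b c d ** mat22 a' b' c' d' =
    mat22 (a * a' + b * c') (a * b' + b * d') (c * a' + d * c') (c * b' + d * d')"
  by (simp add: mat2_eq_iff matrix_matrix_mult_def sum_2)

lemma mat_1_mat22: "(mat 1 :: mat2) = mat22 1 0 0 1"
  by (simp add: mat2_eq_iff mat_def)

lemma scaleR_mat22 [simp]: "r *\<^sub>R mat22 a b c d = mat22 (r * a) (r * b) (r * c) (r * d)"
  and minus_mat22 [simp]: "- mat22 a b c d = mat22 (-a) (-b) (-c) (-d)"
  and add_mat22 [simp]: "mat22 a b c d + mat22 a' b' c' d' = mat22 (a+a') (b+b') (c+c') (d+d')"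
  by (simp_all add: mat2_eq_iff)

lemma frame_mat22: "X_mat = mat22 (1/2) 0 0 (-1/2)" "Uplus = mat22 0 1 0 0" "Uminus = mat22 0 0 1 0"
  by (simp_all add: X_mat_def Uplus_def Uminus_def mat22_def)

lemma mat22_basis: "mat22 a b c d = a *\<^sub>R mat22 1 0 0 0 + b *\<^sub>R mat22 0 1 0 0
  + c *\<^sub>R mat22 0 0 1 0 + d *\<^sub>R mat22 0 0 0 1"
  by simp

lemma sums_mat22:
  assumes "f1 sums a" "f2 sums b" "f3 sums c" "f4 sums d"
  shows "(\<lambda>n. mat22 (f1 n) (f2 n) (f3 n) (f4 n)) sums mat22 a b c d"
  unfolding mat22_basis[of "f1 _"] mat22_basis[of a]
  by (intro sums_add sums_scaleR_left assms)

lemma continuous_on_mat22 [continuous_intros]: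
  assumes "continuous_on S f1" "continuous_on S f2" "continuous_on S f3" "continuous_on S f4"
  shows "continuous_on S (\<lambda>x. mat22 (f1 x) (f2 x) (f3 x) (f4 x))"
  unfolding mat22_basis[of "f1 _"]
  by (intro continuous_intros assms)

lemma continuous_on_matrix_mult [continuous_intros]:
  fixes f g :: "'a::topological_space \<Rightarrow> mat2"
  assumes "continuous_on S f" "continuous_on S g"
  shows "continuous_on S (\<lambda>x. f x ** g x)"
proof -
  have "f x ** g x = mat22 (f x$1$1 * g x$1$1 + f x$1$2 * g x$2$1) (f x$1$1 * g x$1$2 + f x$1$2 * g x$2$2)
     (f x$2$1 * g x$1$1 + f x$2$2 * g x$2$1) (f x$2$1 * g x$1$2 + f x$2$2 * g x$2$2)" for x
    by (simp add: mat2_eq_iff matrix_matrix_mult_def sum_2)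
  then show ?thesis
    by (simp only:) (intro continuous_intros assms)
qed

lemma mexp_diag: "mexp (mat22 a 0 0 d) = mat22 (exp a) 0 0 (exp d)"
proof -
  have "((**) (mat22 a 0 0 d) ^^ n) (mat 1) = mat22 (a ^ n) 0 0 (d ^ n)" for n
    by (induction n) (auto simp: mat_1_mat22)
  then have "(\<lambda>n. (1 / fact n) *\<^sub>R (((**) (mat22 a 0 0 d) ^^ n) (mat 1))) =
      (\<lambda>n. mat22 (a ^ n /\<^sub>R fact n) 0 0 (d ^ n /\<^sub>R fact n))"
    by (auto simp: field_simps)
  also have "\<dots> sums mat22 (exp a) 0 0 (exp d)"
    by (intro sums_mat22 exp_converges sums_zero)
  finally show ?thesis
    unfolding mexp_def by (simp add: sums_unique[symmetric])
qed

lemma mexp_nilpotent: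
  assumes "A ** A = 0"
  shows "mexp A = mat 1 + A"
proof -
  have *: "((**) A ^^ n) (mat 1) = (if n = 0 then mat 1 else if n = 1 then A else 0)" for n
    by (induction n) (auto simp: assms)
  have "(\<lambda>n. (1 / fact n) *\<^sub>R (((**) A ^^ n) (mat 1))) sums
      (\<Sum>n<2. (1 / fact n) *\<^sub>R (((**) A ^^ n) (mat 1)))"
    by (rule sums_finite) (auto simp: *)
  then show ?thesis
    unfolding mexp_def by (simp add: sums_unique[symmetric] * numeral_2_eq_2)
qed

lemma mexp_frame:
  "mexp (t *\<^sub>R X_mat) = mat22 (exp (t/2)) 0 0 (exp (-t/2))"
  "mexp (t *\<^sub>R Uplus) = mat22 1 t 0 1"
  "mexp (t *\<^sub>R Uminus) = mat22 1 0 t 1"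
proof -
  show "mexp (t *\<^sub>R X_mat) = mat22 (exp (t/2)) 0 0 (exp (-t/2))"
    using mexp_diag[of "t/2" "-t/2"] by (simp add: frame_mat22)
  show "mexp (t *\<^sub>R Uplus) = mat22 1 t 0 1" "mexp (t *\<^sub>R Uminus) = mat22 1 0 t 1"
    by (subst mexp_nilpotent; simp add: frame_mat22 mat_1_mat22; simp add: mat2_eq_iff)+
qed

lemma frame_cases:
  assumes "V \<in> frame" obtains "V = X_mat" | "V = Uplus" | "V = Uminus"
  using assms by (auto simp: frame_def)

lemma frame_distinct [simp]: "X_mat \<noteq> Uplus" "X_mat \<noteq> Uminus" "Uplus \<noteq> Uminus"
    "Uplus \<noteq> X_mat" "Uminus \<noteq> X_mat" "Uminus \<noteq> Uplus"
  by (auto simp: frame_mat22)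

lemma in_frame [simp]: "X_mat \<in> frame" "Uplus \<in> frame" "Uminus \<in> frame"
  by (auto simp: frame_def)

lemma det_mexp_frame [simp]: "V \<in> frame \<Longrightarrow> det (mexp (t *\<^sub>R V)) = 1"
  by (elim frame_cases) (simp_all add: mexp_frame flip: exp_add)

lemma continuous_mexp_frame:
  assumes "V \<in> frame" "continuous_on S f"
  shows "continuous_on S (\<lambda>x. mexp (f x *\<^sub>R V))"
  using assms(1)
proof (cases rule: frame_cases)
  case 1
  then show ?thesis by (simp add: mexp_frame) (intro continuous_intros assms; simp)
next
  case 2
  then show ?thesis by (simp add: mexp_frame) (intro continuous_intros assms)
next
  case 3
  then show ?thesis by (simp add: mexp_frame) (intro continuous_intros assms)
qed

lemma one_param_0 [simp]: "V \<in> frame \<Longrightarrow> one_param V 0 = 1"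
  unfolding one_param_def abs_psl2_one[symmetric]
  by (rule arg_cong[of _ _ abs_psl2], elim frame_cases, simp_all only: mexp_frame mat_1_mat22) simp

lemma exp_mult_exp_minus [simp]: "exp x * exp (- x) = 1" "exp (- x) * exp x = 1" for x :: real
  by (simp_all flip: exp_add)

lemma one_param_frame:
  "one_param X_mat t = abs_psl2 (mat22 (exp (t/2)) 0 0 (exp (-(t/2))))"
  "one_param Uplus t = abs_psl2 (mat22 1 t 0 1)"
  "one_param Uminus t = abs_psl2 (mat22 1 0 t 1)"
  by (simp_all add: one_param_def mexp_frame)

lemma one_param_add: 
  assumes "V \<in> frame" shows "one_param V (s + t) = one_param V s * one_param V t"
  using assms
proof (cases rule: frame_cases)
  case 1
  have "exp ((s + t) / 2) = exp (s/2) * exp (t/2)" "exp (-((s + t) / 2)) = exp (-(s/2)) * exp (-(t/2))"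
    unfolding exp_add[symmetric] by (simp_all add: field_simps)
  with 1 show ?thesis
    unfolding 1 one_param_frame by (simp add: abs_psl2_mult)
qed (simp_all only: one_param_frame, simp_all add: abs_psl2_mult add.commute)

lemma one_param_minus:
  assumes "V \<in> frame"
  shows "one_param V t * one_param V (-t) = 1" "one_param V (-t) * one_param V t = 1"
  using one_param_add[OF assms, of t "-t"] one_param_add[OF assms, of "-t" t] assms by auto

lemma one_param_cancel [simp]: "V \<in> frame \<Longrightarrow> g * one_param V (-t) * one_param V t = g"
  by (simp add: mult.assoc one_param_minus)

section \<open>Conjugation by the geodesic flow, and the Gauss decomposition\<close>

definition weight :: "mat2 \<Rightarrow> real" where
  "weight V = (if V = Uplus then 1 else if V = Uminus then -1 else 0)"

lemma weight_simps [simp]: "weight X_mat = 0" "weight Uplus = 1" "weight Uminus = -1"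
  by (auto simp: weight_def)

text \<open>This is \<open>Ad (exp (- t X))\<close> on the eigenvector \<open>V\<close> of
  \<open>ad X\<close>. Every contraction or expansion factor below, and with it the shift of the
  spectral parameter by \<open>weight V\<close>, stems from this identity.\<close>

lemma one_param_conj:
  assumes "V \<in> frame"
  shows "one_param V r * one_param X_mat t = one_param X_mat t * one_param V (exp (- weight V * t) * r)"
  using assms
proof (cases rule: frame_cases)
  case 1
  then show ?thesis by (simp add: add.commute[of r] flip: one_param_add)
next
  case 2
  have *: "exp (t/2) * (exp (-t) * r) = r * exp (-(t/2))"
    by (simp flip: mult.assoc exp_add)
  show ?thesis by (simp only: 2 one_param_frame) (simp add: abs_psl2_mult *)
next
  case 3
  have *: "exp (-(t/2)) * (exp t * r) = r * exp (t/2)"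
    by (simp flip: mult.assoc exp_add)
  show ?thesis by (simp only: 3 one_param_frame) (simp add: abs_psl2_mult *)
qed

text \<open>The Gauss factorization of the matrix with rows (1 + s t, s) and (t, 1) into lower
  unipotent, diagonal and upper unipotent parts; the pivot has to be positive for its logarithm. The
  factor 2 before \<open>ln\<close> undoes the entries 1/2 of \<open>X_mat\<close>.\<close>

lemma Uplus_Uminus_decomposition:
  assumes "1 + s * t > 0"
  shows "one_param Uplus s * one_param Uminus t =
    one_param Uminus (t / (1 + s * t)) * one_param X_mat (2 * ln (1 + s * t)) * one_param Uplus (s / (1 + s * t))"
proof -
  define p where "p = 1 + s * t"
  have p: "p > 0" using assms by (simp add: p_def)
  have "exp (2 * ln p / 2) = p" "exp (-(2 * ln p / 2)) = 1 / p"
    using p by (simp_all add: exp_minus field_simps)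
  then have "one_param Uminus (t / p) * one_param X_mat (2 * ln p) * one_param Uplus (s / p) =
      abs_psl2 (mat22 1 0 (t / p) 1 ** mat22 p 0 0 (1 / p) ** mat22 1 (s / p) 0 1)"
    using p by (simp only: one_param_frame) (simp add: abs_psl2_mult)
  also have "t / p * s + 1 / p = 1"
    using p by (simp add: p_def field_simps)
  then have "mat22 1 0 (t / p) 1 ** mat22 p 0 0 (1 / p) ** mat22 1 (s / p) 0 1 = mat22 p s t 1"
    using p by simp
  also have "abs_psl2 (mat22 p s t 1) = one_param Uplus s * one_param Uminus t"
    by (simp only: one_param_frame) (simp add: abs_psl2_mult p_def)
  finally show ?thesis by (simp add: p_def)
qed

subsection \<open>The topology of \<open>PSL(2,R)\<close>\<close>

lemma continuous_on_abs_psl2: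
  assumes "continuous_on S M" "\<And>x. x \<in> S \<Longrightarrow> det (M x) = 1"
  shows "continuous_on S (\<lambda>x. abs_psl2 (M x))"
proof -
  have "continuous_on {A. det A = 1} abs_psl2"
  proof (subst continuous_on_open_invariant, intro allI impI)
    fix B :: "psl2 set" assume "open B"
    then have "openin (top_of_set {A :: mat2. det A = 1}) {A. det A = 1 \<and> abs_psl2 A \<in> B}"
      by (simp add: open_psl2_def)
    then obtain T where "open T" "{A. det A = 1 \<and> abs_psl2 A \<in> B} = {A. det A = 1} \<inter> T"
      by (auto simp: openin_open)
    then show "\<exists>A. open A \<and> A \<inter> {A. det A = 1} = abs_psl2 -` B \<inter> {A. det A = 1}"
      by (intro exI[of _ T]) auto
  qed
  then show ?thesis
    by (rule continuous_on_compose2) (use assms in auto)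
qed

lemma open_psl2I:
  assumes "open T" "{A. det A = 1 \<and> abs_psl2 A \<in> U} = {A. det A = 1} \<inter> T"
  shows "open U"
  unfolding open_psl2_def using assms by (auto simp: openin_open)

text \<open>The universal property of the quotient topology; it allows continuity to be tested on
  matrices, where entries are available.\<close>

lemma continuous_on_psl2_iff:
  fixes f :: "psl2 \<Rightarrow> 'a::topological_space"
  shows "continuous_on UNIV f \<longleftrightarrow> continuous_on {A. det A = 1} (\<lambda>A. f (abs_psl2 A))"
proof
  assume "continuous_on UNIV f"
  moreover have "continuous_on {A. det A = 1} abs_psl2"
    using continuous_on_abs_psl2[OF continuous_on_id, of "{A. det A = 1}"] by simp
  ultimately show "continuous_on {A. det A = 1} (\<lambda>A. f (abs_psl2 A))"
    by (rule continuous_on_compose2) auto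
next
  assume *: "continuous_on {A. det A = 1} (\<lambda>A. f (abs_psl2 A))"
  show "continuous_on UNIV f"
  proof (subst continuous_on_open_vimage[OF open_UNIV], intro allI impI)
    fix B :: "'a set" assume "open B"
    with * obtain T where T: "open T" "T \<inter> {A. det A = 1}
      = (\<lambda>A. f (abs_psl2 A)) -` B \<inter> {A. det A = 1}"
      by (auto simp: continuous_on_open_invariant)
    then show "open (f -` B \<inter> UNIV)"
      by (intro open_psl2I[of T]) auto
  qed
qed

lemma continuous_on_mult_psl2_right: "continuous_on UNIV (\<lambda>g :: psl2. g * a)"
proof -
  obtain A where A: "det A = 1" "a = abs_psl2 A" by (rule psl2_cases)
  have "continuous_on {A. det A = 1} (\<lambda>B. abs_psl2 (B ** A))"
    by (intro continuous_on_abs_psl2 continuous_intros) (auto simp: det_mul A)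
  then show ?thesis
    unfolding continuous_on_psl2_iff
    by (rule continuous_on_eq) (simp add: A abs_psl2_mult)
qed

lemma continuous_on_mult_psl2_left: "continuous_on UNIV (\<lambda>g :: psl2. a * g)"
proof -
  obtain A where A: "det A = 1" "a = abs_psl2 A" by (rule psl2_cases)
  have "continuous_on {A. det A = 1} (\<lambda>B. abs_psl2 (A ** B))"
    by (intro continuous_on_abs_psl2 continuous_intros) (auto simp: det_mul A)
  then show ?thesis
    unfolding continuous_on_psl2_iff
    by (rule continuous_on_eq) (simp add: A abs_psl2_mult)
qed

text \<open>Three factors are what the Gauss decomposition and the Taylor expansions require;
  shorter products arise by setting parameters to 0.\<close>

lemma continuous_on_one_param3:
  assumes V: "V1 \<in> frame" "V2 \<in> frame" "V3 \<in> frame"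
    and f: "continuous_on S f1" "continuous_on S f2" "continuous_on S f3"
  shows "continuous_on S (\<lambda>x. g * one_param V1 (f1 x) * one_param V2 (f2 x) * one_param V3 (f3 x))"
proof -
  obtain A where A: "det A = 1" "g = abs_psl2 A" by (rule psl2_cases)
  have "g * one_param V1 (f1 x) * one_param V2 (f2 x) * one_param V3 (f3 x) =
     abs_psl2 (A ** mexp (f1 x *\<^sub>R V1) ** mexp (f2 x *\<^sub>R V2) ** mexp (f3 x *\<^sub>R V3))" for x
    using A V by (simp add: one_param_def abs_psl2_mult det_mul)
  then show ?thesis
    by (simp only:) (intro continuous_on_abs_psl2 continuous_intros continuous_mexp_frame V f;
      simp add: A V det_mul)
qed

lemma continuous_on_one_param:
  assumes "V \<in> frame" "continuous_on S f"
  shows "continuous_on S (\<lambda>x. g * one_param V (f x))"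
  using continuous_on_one_param3[OF assms(1) assms(1) assms(1) assms(2)
    continuous_on_const[of S 0] continuous_on_const[of S 0]] assms(1)
  by simp

text \<open>A matrix norm that is submultiplicative and blind to the sign, hence well defined on
  \<open>psl2\<close>. Its balls are compact, so that a radius can stand for the compact set in the
  definition of a test function.\<close>

definition entry_sum :: "mat2 \<Rightarrow> real" where
  "entry_sum A = \<bar>A$1$1\<bar> + \<bar>A$1$2\<bar> + \<bar>A$2$1\<bar> + \<bar>A$2$2\<bar>"

lemma entry_sum_mat22 [simp]: "entry_sum (mat22 a b c d) = \<bar>a\<bar> + \<bar>b\<bar> + \<bar>c\<bar>
  + \<bar>d\<bar>"
  by (simp add: entry_sum_def)

lift_definition psl2_size :: "psl2 \<Rightarrow> real" is entry_sum
  by (auto simp: psl2_rel_def entry_sum_def)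

lemma psl2_size_abs [simp]: "det A = 1 \<Longrightarrow> psl2_size (abs_psl2 A) = entry_sum A"
  by (simp add: psl2_size.abs_eq)

lemma entry_sum_mult: "entry_sum (A ** B) \<le> entry_sum A * entry_sum B"
proof -
  obtain a b c d where A: "A = mat22 a b c d" by (rule mat22_cases)
  obtain a' b' c' d' where B: "B = mat22 a' b' c' d'" by (rule mat22_cases)
  have 1: "\<bar>x * y + z * w\<bar> \<le> \<bar>x\<bar> * \<bar>y\<bar> + \<bar>z\<bar> * \<bar>w\<bar>"
    for x y z w :: real
    by (metis abs_mult abs_triangle_ineq)
  have "entry_sum (A ** B) \<le> (\<bar>a\<bar> * \<bar>a'\<bar> + \<bar>b\<bar> * \<bar>c'\<bar>)
    + (\<bar>a\<bar> * \<bar>b'\<bar> + \<bar>b\<bar> * \<bar>d'\<bar>)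
      + (\<bar>c\<bar> * \<bar>a'\<bar> + \<bar>d\<bar> * \<bar>c'\<bar>) + (\<bar>c\<bar> * \<bar>b'\<bar>
        + \<bar>d\<bar> * \<bar>d'\<bar>)"
    unfolding A B mat22_mult entry_sum_mat22 by (intro add_mono 1)
  also have "\<dots> \<le> entry_sum A * entry_sum B"
    unfolding A B entry_sum_mat22 by (simp add: algebra_simps)
  finally show ?thesis .
qed

lemma psl2_size_mult: "psl2_size (g * h) \<le> psl2_size g * psl2_size h"
  by (rule psl2_cases[of g], rule psl2_cases[of h]) (simp add: abs_psl2_mult det_mul entry_sum_mult)

lemma psl2_size_nonneg [simp]: "psl2_size g \<ge> 0"
  by (rule psl2_cases[of g]) (simp add: entry_sum_def)

lemma continuous_on_entry_sum [continuous_intros]: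
  "continuous_on S f \<Longrightarrow> continuous_on S (\<lambda>x. entry_sum (f x))"
  unfolding entry_sum_def by (intro continuous_intros)

lemma continuous_on_psl2_size: "continuous_on UNIV psl2_size"
  unfolding continuous_on_psl2_iff
  by (rule continuous_on_eq[where f = entry_sum]) (auto intro: continuous_intros)

lemma norm_le_entry_sum: "norm A \<le> entry_sum A"
proof -
  have "norm A \<le> (\<Sum>i\<in>UNIV. norm (A $ i))"
    unfolding norm_vec_def by (rule L2_set_le_sum) simp
  also have "\<dots> \<le> (\<Sum>i\<in>UNIV. \<Sum>j\<in>UNIV. norm (A $ i $ j))"
    unfolding norm_vec_def by (intro sum_mono L2_set_le_sum) simp
  also have "\<dots> = entry_sum A"
    by (simp add: sum_2 entry_sum_def)
  finally show ?thesis .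
qed

lemma compact_psl2_size: "compact {g. psl2_size g \<le> r}"
proof -
  let ?K = "{A. det A = 1 \<and> entry_sum A \<le> r}"
  have K: "{g. psl2_size g \<le> r} = abs_psl2 ` ?K"
  proof (intro equalityI subsetI)
    fix g assume "g \<in> {g. psl2_size g \<le> r}"
    then show "g \<in> abs_psl2 ` ?K"
      by (cases rule: psl2_cases[of g]) auto
  qed auto
  have "compact ?K"
  proof (rule compact_eq_bounded_closed[THEN iffD2], intro conjI)
    show "bounded ?K"
      by (rule boundedI[of _ r]) (use norm_le_entry_sum order_trans in blast)
    have "closed {A :: mat2. det A = 1}" "closed {A. entry_sum A \<le> r}"
      unfolding det_2 by (intro closed_Collect_eq closed_Collect_le continuous_intros)+
    then show "closed ?K"
      using closed_Int by (auto simp: Collect_conj_eq)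
  qed
  then show ?thesis
    unfolding K by (intro compact_continuous_image continuous_on_abs_psl2 continuous_on_id) auto
qed

text \<open>The flow direction costs at most 2 + 2, a horocyclic direction at most 3. The 4
  reappears below as the factor by which supports are enlarged.\<close>

lemma psl2_size_one_param:
  assumes "V \<in> frame" "\<bar>t\<bar> \<le> 1"
  shows "psl2_size (one_param V t) \<le> 4"
  using assms(1)
proof (cases rule: frame_cases)
  case 1
  have "exp (t/2) \<le> 2" "exp (-(t/2)) \<le> 2" 
    using assms exp_bound_half[of "t/2"] exp_bound_half[of "-(t/2)"] by auto
  then show ?thesis by (simp only: 1 one_param_frame) simp
qed (use assms in \<open>simp_all only: one_param_frame, auto\<close>)

section \<open>Smooth functions and test functions\<close>

lemma lie_word_simps [simp]: "lie_word [] f = f" "lie_word (V # Vs) f = lie_deriv V (lie_word Vs f)"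
  by (simp_all add: lie_word_def)

lemma lie_word_lie_deriv: "lie_word Vs (lie_deriv V f) = lie_word (Vs @ [V]) f"
  by (simp add: lie_word_def)

lemma smoothD:
  assumes "smooth f"
  shows "continuous_on UNIV f"
    and "V \<in> frame \<Longrightarrow> (\<lambda>t. f (g * one_param V t)) differentiable (at 0)"
  using assms unfolding smooth_def by (metis empty_set empty_subsetI lie_word_simps(1))+

lemma smooth_lie_deriv [intro]:
  assumes "smooth f" "V \<in> frame" shows "smooth (lie_deriv V f)"
  unfolding smooth_def lie_word_lie_deriv
proof (intro allI impI)
  fix Vs assume "set Vs \<subseteq> frame"
  then have "set (Vs @ [V]) \<subseteq> frame" using assms by auto
  then show "continuous_on UNIV (lie_word (Vs @ [V]) f) \<and>
      (\<forall>Va\<in>frame. \<forall>g. (\<lambda>t. lie_word (Vs @ [V]) f (g * one_param Va t)) differentiable at 0)"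
    using assms(1) unfolding smooth_def by blast
qed

lemma smooth_lie_word: "smooth f \<Longrightarrow> set Vs \<subseteq> frame \<Longrightarrow> smooth (lie_word Vs f)"
  by (induction Vs) auto

text \<open>Smoothness only provides the derivative at time 0; the one-parameter property moves the
  base point to time t.\<close>

lemma has_vector_derivative_lie_deriv:
  assumes f: "smooth f" and V: "V \<in> frame"
  shows "((\<lambda>t. f (g * one_param V t)) has_vector_derivative lie_deriv V f (g * one_param V t)) (at t)"
proof -
  define h where "h = (\<lambda>s. f (g * one_param V t * one_param V s))"
  have "(h has_vector_derivative lie_deriv V f (g * one_param V t)) (at 0)"
    unfolding h_def lie_deriv_def vector_derivative_works[symmetric]
    by (rule smoothD(2)[OF f V])
  then have "(h has_vector_derivative lie_deriv V f (g * one_param V t)) (at (t - t))"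
    by simp
  then have "((h \<circ> (\<lambda>s. s - t)) has_vector_derivative 1 *\<^sub>R lie_deriv V f (g * one_param V
    t)) (at t)"
    by (intro vector_diff_chain_at) (auto intro!: derivative_eq_intros)
  moreover have "h \<circ> (\<lambda>s. s - t) = (\<lambda>s. f (g * one_param V s))"
    by (simp add: h_def fun_eq_iff mult.assoc V flip: one_param_add)
  ultimately show ?thesis by simp
qed

lemma lie_derivI:
  assumes "((\<lambda>t. f (g * one_param V t)) has_vector_derivative d) (at 0)"
  shows "lie_deriv V f g = d"
  unfolding lie_deriv_def using assms by (rule vector_derivative_at)

lemma has_vector_derivative_lie_deriv_0:
  assumes "smooth f" "V \<in> frame"
  shows "((\<lambda>t. f (g * one_param V t)) has_vector_derivative lie_deriv V f g) (at 0)"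
  using has_vector_derivative_lie_deriv[OF assms, of g 0] assms by simp

lemma lie_deriv_lincomb:
  assumes "smooth f" "smooth h" "V \<in> frame"
  shows "lie_deriv V (\<lambda>x. a * f x + b * h x) = (\<lambda>x. a * lie_deriv V f x + b * lie_deriv V h x)"
  by (intro ext lie_derivI has_vector_derivative_add has_vector_derivative_mult_right
      has_vector_derivative_lie_deriv_0 assms)

lemma lie_word_lincomb:
  assumes "smooth f" "smooth h" "set Vs \<subseteq> frame"
  shows "lie_word Vs (\<lambda>x. a * f x + b * h x) = (\<lambda>x. a * lie_word Vs f x + b * lie_word Vs h x)"
  using assms(3) by (induction Vs) (auto simp: lie_deriv_lincomb smooth_lie_word assms)

lemma smooth_lincomb:
  assumes "smooth f" "smooth h"
  shows "smooth (\<lambda>x. a * f x + b * h x)"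
  unfolding smooth_def
proof (intro allI impI conjI ballI)
  fix Vs assume Vs: "set Vs \<subseteq> frame"
  note w = lie_word_lincomb[OF assms Vs] smooth_lie_word[OF _ Vs]
  show "continuous_on UNIV (lie_word Vs (\<lambda>x. a * f x + b * h x))"
    unfolding w(1) by (intro continuous_intros smoothD w assms)
  fix V g assume "V \<in> frame"
  then show "(\<lambda>t. lie_word Vs (\<lambda>x. a * f x + b * h x) (g * one_param V t)) differentiable at 0"
    unfolding w(1) by (intro differentiable_add differentiable_mult differentiable_const smoothD w assms)
qed

section \<open>Pull-back by the geodesic flow\<close>

definition flow_pull :: "real \<Rightarrow> (psl2 \<Rightarrow> complex) \<Rightarrow> psl2 \<Rightarrow> complex" where
  "flow_pull T f = (\<lambda>g. f (geodesic_flow T g))"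

lemma flow_pull_add: "flow_pull S (flow_pull T f) = flow_pull (S + T) f"
  by (simp add: flow_pull_def geodesic_flow_def one_param_add mult.assoc)

lemma flow_pull_0 [simp]: "flow_pull 0 f = f"
  by (simp add: flow_pull_def geodesic_flow_def)

text \<open>Moving \<open>exp (t V)\<close> past the flow rescales t by
  \<open>exp (- weight V * T)\<close>. The scalar \<open>c\<close> is there for iteration, since
  each derivative produces one more factor of this kind.\<close>

lemma has_vector_derivative_flow_pull:
  assumes "smooth f" "V \<in> frame"
  shows "((\<lambda>t. c * flow_pull T f (g * one_param V t)) has_vector_derivative
     c * of_real (exp (- weight V * T)) * flow_pull T (lie_deriv V f) g) (at 0)"
proof -
  let ?e = "exp (- weight V * T)" and ?h = "\<lambda>t. f (geodesic_flow T g * one_param V t)"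
  have "(?h has_vector_derivative lie_deriv V f (geodesic_flow T g)) (at (0 * ?e))"
    using has_vector_derivative_lie_deriv_0[OF assms] by simp
  then have "((?h \<circ> (\<lambda>t. t * ?e)) has_vector_derivative ?e *\<^sub>R lie_deriv V f (geodesic_flow
    T g)) (at 0)"
    by (intro vector_diff_chain_at) (auto intro!: derivative_eq_intros)
  moreover have "(\<lambda>t. flow_pull T f (g * one_param V t)) = (?h \<circ> (\<lambda>t. t * ?e))"
    by (simp add: flow_pull_def geodesic_flow_def fun_eq_iff mult.assoc one_param_conj assms mult.commute)
  ultimately have "((\<lambda>t. flow_pull T f (g * one_param V t)) has_vector_derivative
      ?e *\<^sub>R lie_deriv V f (geodesic_flow T g)) (at 0)"
    by simp
  from has_vector_derivative_mult_right[OF this, of c] show ?thesis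
    by (simp add: flow_pull_def scaleR_conv_of_real mult.assoc)
qed

lemma lie_deriv_flow_pull:
  assumes "smooth f" "V \<in> frame"
  shows "lie_deriv V (\<lambda>g. c * flow_pull T f g) =
     (\<lambda>g. c * of_real (exp (- weight V * T)) * flow_pull T (lie_deriv V f) g)"
  by (intro ext lie_derivI has_vector_derivative_flow_pull assms)

lemma smooth_flow_pull:
  assumes "smooth f" shows "smooth (flow_pull T f)"
proof -
  \<comment> \<open>Up to a scalar, differentiation commutes with the pull-back, so the words of the
    pull-back inherit continuity and differentiability from those of \<open>f\<close>.\<close>
  have *: "\<exists>c. lie_word Vs (flow_pull T f) = (\<lambda>g. c * flow_pull T (lie_word Vs f) g)"
    if "set Vs \<subseteq> frame" for Vs
    using that
  proof (induction Vs)
    case Nil show ?case by (rule exI[of _ 1]) simp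
  next
    case (Cons V Vs)
    then obtain c where "lie_word Vs (flow_pull T f) = (\<lambda>g. c * flow_pull T (lie_word Vs f) g)"
      by auto
    moreover have V: "V \<in> frame" "set Vs \<subseteq> frame"
      using Cons.prems by auto
    moreover have "smooth (lie_word Vs f)"
      by (rule smooth_lie_word[OF assms V(2)])
    ultimately show ?case
      by (auto simp: lie_deriv_flow_pull)
  qed
  show ?thesis
    unfolding smooth_def
  proof (intro allI impI conjI ballI)
    fix Vs assume Vs: "set Vs \<subseteq> frame"
    from *[OF Vs] obtain c where c: "lie_word Vs (flow_pull T f) = (\<lambda>g. c * flow_pull T (lie_word Vs f) g)" ..
    have "continuous_on UNIV (\<lambda>g. lie_word Vs f (g * one_param X_mat T))"
      by (rule continuous_on_compose2[OF smoothD(1) continuous_on_mult_psl2_right])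
         (use smooth_lie_word[OF assms Vs] in auto)
    then show "continuous_on UNIV (lie_word Vs (flow_pull T f))"
      unfolding c by (intro continuous_intros) (simp add: flow_pull_def geodesic_flow_def)
    fix V g assume V: "V \<in> frame"
    show "(\<lambda>t. lie_word Vs (flow_pull T f) (g * one_param V t)) differentiable at 0"
      unfolding c using has_vector_derivative_flow_pull[OF smooth_lie_word[OF assms Vs] V]
      by (rule differentiableI_vector)
  qed
qed

text \<open>The \<Gamma>-saturation of a ball, that is, the preimage in the group of a compact
  subset of SM.\<close>

definition size_supp :: "psl2 set \<Rightarrow> real \<Rightarrow> psl2 set" where
  "size_supp \<Gamma> r = {g. \<exists>\<gamma>\<in>\<Gamma>. psl2_size (\<gamma> * g) \<le> r}"

text \<open>Balls of \<open>psl2_size\<close> are compact and every compact set lies in one. The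
  support condition thus becomes a number, which is easy to follow under translations.\<close>

lemma test_fun_iff: "f \<in> test_fun \<Gamma> \<longleftrightarrow>
  smooth f \<and> (\<forall>\<gamma>\<in>\<Gamma>. \<forall>g. f (\<gamma> * g) = f g) \<and>
   (\<exists>r. \<forall>g. f g \<noteq> 0 \<longrightarrow> g \<in> size_supp \<Gamma> r)"
proof -
  have "(\<exists>K. compact K \<and> supported_in \<Gamma> K f) \<longleftrightarrow>
    (\<exists>r. \<forall>g. f g \<noteq> 0 \<longrightarrow> g \<in> size_supp \<Gamma> r)"
  proof
    assume "\<exists>K. compact K \<and> supported_in \<Gamma> K f"
    then obtain K where K: "compact K" "supported_in \<Gamma> K f" by blast
    then have "compact (psl2_size ` K)"
      by (intro compact_continuous_image continuous_on_subset[OF continuous_on_psl2_size]) auto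
    then obtain r where "\<And>g. g \<in> K \<Longrightarrow> norm (psl2_size g) \<le> r"
      using compact_imp_bounded bounded_iff by (metis imageI)
    then have "\<And>g. g \<in> K \<Longrightarrow> psl2_size g \<le> r" by auto
    then show "\<exists>r. \<forall>g. f g \<noteq> 0 \<longrightarrow> g \<in> size_supp \<Gamma> r"
      using K unfolding supported_in_def size_supp_def by blast
  next
    assume "\<exists>r. \<forall>g. f g \<noteq> 0 \<longrightarrow> g \<in> size_supp \<Gamma> r"
    then show "\<exists>K. compact K \<and> supported_in \<Gamma> K f"
      using compact_psl2_size unfolding supported_in_def size_supp_def by fastforce
  qed
  then show ?thesis by (auto simp: test_fun_def)
qed

lemma size_supp_mono: "r \<le> r' \<Longrightarrow> size_supp \<Gamma> r \<subseteq> size_supp \<Gamma> r'"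
  unfolding size_supp_def by (blast intro: order_trans)

text \<open>Submultiplicativity: \<open>h'\<close> is the inverse of \<open>h\<close>, and its size
  bounds how far right translation by \<open>h\<close> moves a support.\<close>

lemma size_supp_mult:
  assumes "g * h \<in> size_supp \<Gamma> r" "psl2_size h' \<le> c" "h * h' = 1"
  shows "g \<in> size_supp \<Gamma> (r * c)"
proof -
  obtain \<gamma> where \<gamma>: "\<gamma> \<in> \<Gamma>" "psl2_size (\<gamma> * (g * h)) \<le> r"
    using assms by (auto simp: size_supp_def)
  have "psl2_size (\<gamma> * g) = psl2_size (\<gamma> * (g * h) * h')"
    using assms(3) by (simp add: mult.assoc)
  also have "\<dots> \<le> psl2_size (\<gamma> * (g * h)) * psl2_size h'" by (rule psl2_size_mult)
  also have "\<dots> \<le> r * c" using \<gamma> assms by (intro mult_mono) (auto intro: order_trans[OF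
    psl2_size_nonneg])
  finally show ?thesis using \<gamma> by (auto simp: size_supp_def)
qed

lemma test_fun_smooth [dest]: "f \<in> test_fun \<Gamma> \<Longrightarrow> smooth f"
  by (simp add: test_fun_iff)

lemma test_fun_invariant: "f \<in> test_fun \<Gamma> \<Longrightarrow> \<gamma> \<in> \<Gamma> \<Longrightarrow>
  f (\<gamma> * g) = f g"
  by (simp add: test_fun_iff)

lemma test_fun_supp:
  assumes "f \<in> test_fun \<Gamma>" obtains r where "r \<ge> 0" "\<And>g. f g \<noteq> 0 \<Longrightarrow>
    g \<in> size_supp \<Gamma> r"
proof -
  obtain r where r: "\<And>g. f g \<noteq> 0 \<Longrightarrow>
    g \<in> size_supp \<Gamma> r" using assms by (auto simp: test_fun_iff)
  show ?thesis
    by (rule that[of "max r 0"]) (use r size_supp_mono[of r "max r 0"] in auto)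
qed

lemma test_fun_lincomb:
  assumes "f \<in> test_fun \<Gamma>" "h \<in> test_fun \<Gamma>"
  shows "(\<lambda>x. a * f x + b * h x) \<in> test_fun \<Gamma>"
proof -
  obtain r where r: "r \<ge> 0" "\<And>g. f g \<noteq> 0 \<Longrightarrow>
    g \<in> size_supp \<Gamma> r" using test_fun_supp assms by blast
  obtain s where s: "s \<ge> 0" "\<And>g. h g \<noteq> 0 \<Longrightarrow>
    g \<in> size_supp \<Gamma> s" using test_fun_supp assms by blast
  have "g \<in> size_supp \<Gamma> (max r s)" if "a * f g + b * h g \<noteq> 0" for g
    using r(2)[of g] s(2)[of g] that size_supp_mono[of r "max r s" \<Gamma>] size_supp_mono[of s "max r s" \<Gamma>]
    by (cases "f g = 0") auto
  then show ?thesis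
    using assms by (auto simp: test_fun_iff smooth_lincomb)
qed

lemma test_fun_scale: "f \<in> test_fun \<Gamma> \<Longrightarrow> (\<lambda>x. a * f x) \<in> test_fun \<Gamma>"
  using test_fun_lincomb[of f \<Gamma> f a 0] by simp

text \<open>A zero of \<open>f\<close> need not be a zero of its derivative. The radius is enlarged
  to 4 r so that, outside, \<open>f\<close> vanishes on a whole interval of the curve.\<close>

lemma test_fun_lie_deriv:
  assumes f: "f \<in> test_fun \<Gamma>" and V: "V \<in> frame"
  shows "lie_deriv V f \<in> test_fun \<Gamma>"
proof -
  obtain r where r: "r \<ge> 0" "\<And>g. f g \<noteq> 0 \<Longrightarrow>
    g \<in> size_supp \<Gamma> r" using test_fun_supp f by blast
  have "g \<in> size_supp \<Gamma> (r * 4)" if "lie_deriv V f g \<noteq> 0" for g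
  proof (rule ccontr)
    assume "g \<notin> size_supp \<Gamma> (r * 4)"
    then have 0: "f (g * one_param V t) = 0" if "\<bar>t\<bar> < 1" for t
      using size_supp_mult[of g "one_param V t" \<Gamma> r "one_param V (-t)" 4] that r
         psl2_size_one_param[OF V, of "-t"] one_param_minus[OF V, of t] by force
    have "((\<lambda>t. f (g * one_param V t)) has_vector_derivative 0) (at 0)"
      by (rule has_vector_derivative_transform_within_open[of "\<lambda>_. 0" _ _ "{-1<..<1}"]) (auto simp: 0)
    then have "lie_deriv V f g = 0" by (rule lie_derivI)
    with that show False by simp
  qed
  moreover have "lie_deriv V f (\<gamma> * g) = lie_deriv V f g" if "\<gamma> \<in> \<Gamma>" for \<gamma> g
    using f that by (simp add: lie_deriv_def mult.assoc test_fun_invariant)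
  ultimately show ?thesis
    using f V by (auto simp: test_fun_iff)
qed

lemma test_fun_flow_pull:
  assumes f: "f \<in> test_fun \<Gamma>"
  shows "flow_pull T f \<in> test_fun \<Gamma>"
proof -
  obtain r where r: "r \<ge> 0" "\<And>g. f g \<noteq> 0 \<Longrightarrow>
    g \<in> size_supp \<Gamma> r" using test_fun_supp f by blast
  have "g \<in> size_supp \<Gamma> (r * psl2_size (one_param X_mat (-T)))" if "flow_pull T f g \<noteq> 0" for g
    using that r(2) by (intro size_supp_mult[of g "one_param X_mat T" _ _ "one_param X_mat (-T)"])
      (auto simp: flow_pull_def geodesic_flow_def one_param_minus)
  then show ?thesis
    using f smooth_flow_pull[of f T] unfolding test_fun_iff
    by (auto simp: flow_pull_def geodesic_flow_def mult.assoc)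
qed

lemma test_fun_zero: "(\<lambda>x. 0) \<in> test_fun \<Gamma>"
proof -
  have [simp]: "lie_deriv V (\<lambda>x. 0) = (\<lambda>x. 0)" for V
    by (rule ext) (simp add: lie_deriv_def)
  have [simp]: "lie_word Vs (\<lambda>x. 0) = (\<lambda>x. 0)" for Vs
    by (induction Vs) auto
  show ?thesis by (auto simp: test_fun_iff smooth_def)
qed

text \<open>Invariance under \<Gamma> moves each point of the support into one fixed compact
  ball.\<close>

lemma test_fun_bounded:
  assumes f: "f \<in> test_fun \<Gamma>"
  obtains C where "C \<ge> 0" "\<And>g. norm (f g) \<le> C"
proof -
  obtain r where r: "r \<ge> 0" "\<And>g. f g \<noteq> 0 \<Longrightarrow>
    g \<in> size_supp \<Gamma> r" using test_fun_supp f by blast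
  have "compact (f ` {g. psl2_size g \<le> r})"
    using f by (intro compact_continuous_image compact_psl2_size continuous_on_subset[OF smoothD(1)]) auto
  then obtain C where C: "\<And>g. psl2_size g \<le> r \<Longrightarrow> norm (f g) \<le> C"
    using compact_imp_bounded bounded_iff by (metis (mono_tags, lifting) imageI mem_Collect_eq)
  show ?thesis
  proof (rule that[of "max C 0"])
    fix g show "norm (f g) \<le> max C 0"
    proof (cases "f g = 0")
      case False
      then obtain \<gamma> where "\<gamma> \<in> \<Gamma>" "psl2_size (\<gamma> * g) \<le> r" using r
        by (auto simp: size_supp_def)
      with C[of "\<gamma> * g"] f show ?thesis by (auto simp: test_fun_invariant)
    qed auto
  qed auto
qed

subsection \<open>Commutators of the frame\<close>

lemma uniform_near:
  fixes F :: "psl2 \<Rightarrow> complex"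
  assumes "continuous_on UNIV F" "A \<in> frame" "B \<in> frame" "C \<in> frame" "\<epsilon> > 0"
  shows "\<exists>\<delta>>0. \<forall>a b c. \<bar>a\<bar> < \<delta> \<and> \<bar>b\<bar> < \<delta>
    \<and> \<bar>c\<bar> < \<delta> \<longrightarrow>
     norm (F (g * one_param A a * one_param B b * one_param C c) - F g) < \<epsilon>"
proof -
  let ?P = "\<lambda>x :: real \<times> real \<times> real. F (g * one_param A (fst x) * one_param B (fst (snd
    x)) * one_param C (snd (snd x)))"
  have "continuous_on UNIV ?P"
    by (rule continuous_on_compose2[OF assms(1)])
       (auto intro!: continuous_on_one_param3 assms continuous_intros)
  then obtain d where d: "d > 0" "\<And>x. dist x (0,0,0) < d \<Longrightarrow> dist (?P x) (?P (0,0,0)) < \<epsilon>"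
    using assms(5) unfolding continuous_on_iff by (metis UNIV_I)
  have "norm (F (g * one_param A a * one_param B b * one_param C c) - F g) < \<epsilon>"
    if "\<bar>a\<bar> < d/3" "\<bar>b\<bar> < d/3" "\<bar>c\<bar> < d/3" for a b c
  proof -
    have "norm (a, b, c) \<le> \<bar>a\<bar> + (\<bar>b\<bar> + \<bar>c\<bar>)"
      using norm_Pair_le[of a "(b,c)"] norm_Pair_le[of b c] by simp
    with that have "dist (a,b,c) (0,0,0) < d" by (simp add: dist_norm)
    from d(2)[OF this] assms show ?thesis by (simp add: dist_norm)
  qed
  with d(1) show ?thesis by (intro exI[of _ "d/3"]) auto
qed

section \<open>Second order Taylor expansion along products of one-parameter subgroups\<close>

lemma vector_mean_value:
  fixes F :: "real \<Rightarrow> 'a::real_normed_vector"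
  assumes F: "\<And>t. \<bar>t\<bar> \<le> \<bar>c\<bar> \<Longrightarrow> (F has_vector_derivative F' t) (at t)"
    and b: "\<And>t. \<bar>t\<bar> \<le> \<bar>c\<bar> \<Longrightarrow> norm (F' t) \<le> B"
  shows "norm (F c - F 0) \<le> B * \<bar>c\<bar>"
proof -
  let ?S = "{-\<bar>c\<bar>..\<bar>c\<bar>}" 
  have "norm (F c - F 0) \<le> B * norm (c - 0)"
  proof (rule differentiable_bound[where S = ?S and f' = "\<lambda>t x. x *\<^sub>R F' t"])
    fix t assume "t \<in> ?S"
    then have t: "\<bar>t\<bar> \<le> \<bar>c\<bar>" by auto
    show "(F has_derivative (\<lambda>x. x *\<^sub>R F' t)) (at t within ?S)"
      using F[OF t] unfolding has_vector_derivative_def by (rule has_derivative_at_withinI)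
    have "onorm (\<lambda>x. x *\<^sub>R F' t) \<le> norm (F' t)"
      by (rule onorm_le) (simp add: mult.commute)
    also have "\<dots> \<le> B" using b t by auto
    finally show "onorm (\<lambda>x. x *\<^sub>R F' t) \<le> B" .
  qed auto
  then show ?thesis by simp
qed

text \<open>The reference value \<open>v\<close> is left free instead of being the derivative at
  \<open>h\<close>: it will be taken at another base point.\<close>

lemma taylor1:
  assumes f: "smooth f" "C \<in> frame"
    and v: "\<And>t. \<bar>t\<bar> \<le> \<bar>c\<bar> \<Longrightarrow>
      norm (lie_deriv C f (h * one_param C t) - v) \<le> \<epsilon>"
  shows "norm (f (h * one_param C c) - (f h + of_real c * v)) \<le> \<epsilon> * \<bar>c\<bar>"
proof -
  let ?F = "\<lambda>t. f (h * one_param C t) - of_real t * v"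
  have "norm (?F c - ?F 0) \<le> \<epsilon> * \<bar>c\<bar>"
  proof (rule vector_mean_value)
    fix t show "(?F has_vector_derivative lie_deriv C f (h * one_param C t) - 1 * v) (at t)"
      using has_vector_derivative_of_real[OF DERIV_ident[of "at t"], where 'a=complex]
      by (intro has_vector_derivative_diff has_vector_derivative_lie_deriv f
          has_vector_derivative_mult_left) simp
  qed (use v in auto)
  with f show ?thesis by (simp add: algebra_simps)
qed

lemma taylor2:
  assumes f: "smooth f" "C \<in> frame"
    and v: "\<And>t. \<bar>t\<bar> \<le> \<bar>c\<bar> \<Longrightarrow>
      norm (lie_deriv C (lie_deriv C f) (h * one_param C t) - v) \<le> \<epsilon>"
  shows "norm (f (h * one_param C c) - (f h + of_real c * lie_deriv C f h + of_real (c\<^sup>2/2) * v))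
    \<le> \<epsilon> * c\<^sup>2"
proof -
  let ?F = "\<lambda>t. f (h * one_param C t) - of_real t * lie_deriv C f h - of_real (t\<^sup>2/2) * v"
  have "0 \<le> \<epsilon>" using order_trans[OF norm_ge_zero v[of 0]] by simp
  have "norm (?F c - ?F 0) \<le> (\<epsilon> * \<bar>c\<bar>) * \<bar>c\<bar>"
  proof (rule vector_mean_value)
    fix t
    have "((\<lambda>t. t\<^sup>2/2) has_real_derivative t) (at t)"
      by (auto intro!: derivative_eq_intros)
    from has_vector_derivative_of_real[OF this, where 'a=complex]
      has_vector_derivative_of_real[OF DERIV_ident[of "at t"], where 'a=complex]
    show "(?F has_vector_derivative lie_deriv C f (h * one_param C t) - 1 * lie_deriv C f h - of_real t * v) (at t)"
      by (intro has_vector_derivative_diff has_vector_derivative_lie_deriv f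
          has_vector_derivative_mult_left) simp_all
    assume t: "\<bar>t\<bar> \<le> \<bar>c\<bar>"
    have "norm (lie_deriv C f (h * one_param C t) - (lie_deriv C f h + of_real t * v)) \<le> \<epsilon> * \<bar>t\<bar>"
      by (rule taylor1) (use f v t in auto)
    also have "\<dots> \<le> \<epsilon> * \<bar>c\<bar>" using t \<open>0 \<le> \<epsilon>\<close>
      by (intro mult_left_mono)
    finally show "norm (lie_deriv C f (h * one_param C t) - 1 * lie_deriv C f h - of_real t * v)
      \<le> \<epsilon> * \<bar>c\<bar>"
      by (simp add: algebra_simps)
  qed
  with f show ?thesis by (simp add: algebra_simps power2_eq_square)
qed

text \<open>The second order part of the product of three exponentials of differential operators. In
  a mixed term the derivative of the factor further left is applied last, because that factor is the
  one next to \<open>g\<close>.\<close>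

definition taylor_poly :: "mat2 \<Rightarrow> mat2 \<Rightarrow> mat2 \<Rightarrow> (psl2 \<Rightarrow>
  complex) \<Rightarrow> psl2 \<Rightarrow> real \<Rightarrow> real \<Rightarrow> real \<Rightarrow> complex" where
  "taylor_poly A B C f g a b c =
     f g + of_real a * lie_deriv A f g + of_real b * lie_deriv B f g + of_real c * lie_deriv C f g
     + of_real (a\<^sup>2/2) * lie_deriv A (lie_deriv A f) g + of_real (b\<^sup>2/2) * lie_deriv B (lie_deriv B f) g
     + of_real (c\<^sup>2/2) * lie_deriv C (lie_deriv C f) g
     + of_real (a*b) * lie_deriv A (lie_deriv B f) g + of_real (a*c) * lie_deriv A (lie_deriv C f) g
     + of_real (b*c) * lie_deriv B (lie_deriv C f) g"

lemma uniform_near_finite: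
  assumes "finite Fs" "\<And>F. F \<in> Fs \<Longrightarrow>
    continuous_on UNIV F" "A \<in> frame" "B \<in> frame" "C \<in> frame" "\<epsilon> > 0"
  shows "\<exists>\<delta>>0. \<forall>F\<in>Fs. \<forall>a b c. \<bar>a\<bar> < \<delta>
    \<and> \<bar>b\<bar> < \<delta> \<and> \<bar>c\<bar> < \<delta> \<longrightarrow>
     norm (F (g * one_param A a * one_param B b * one_param C c) - F g :: complex) < \<epsilon>"
  using assms(1,2)
proof (induction Fs)
  case empty
  show ?case by (rule exI[of _ 1]) auto
next
  case (insert F Fs)
  obtain d where d: "d > 0" "\<forall>F\<in>Fs. \<forall>a b c. \<bar>a\<bar> < d \<and> \<bar>b\<bar> < d
    \<and> \<bar>c\<bar> < d \<longrightarrow>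
     norm (F (g * one_param A a * one_param B b * one_param C c) - F g) < \<epsilon>"
    using insert by blast
  obtain e where e: "e > 0" "\<forall>a b c. \<bar>a\<bar> < e \<and> \<bar>b\<bar> < e
    \<and> \<bar>c\<bar> < e \<longrightarrow>
     norm (F (g * one_param A a * one_param B b * one_param C c) - F g) < \<epsilon>"
    using uniform_near[of F A B C \<epsilon> g] insert assms(3-) by blast
  show ?case
    by (rule exI[of _ "min d e"]) (use d e in auto)
qed

text \<open>The factors are removed from the right: expand in c at \<open>h\<close>, then the
  coefficients in b at \<open>k\<close>, then in a at \<open>g\<close>. First derivatives are
  expanded as well, so only second derivatives are compared with their values at \<open>g\<close>,
  and for these continuity is enough.\<close>

lemma taylor3:
  assumes f: "smooth f" and ABC: "A \<in> frame" "B \<in> frame" "C \<in> frame" and "\<epsilon> > 0"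
  shows "\<exists>\<delta>>0. \<forall>a b c. \<bar>a\<bar> < \<delta> \<and> \<bar>b\<bar> < \<delta>
    \<and> \<bar>c\<bar> < \<delta> \<longrightarrow>
     norm (f (g * one_param A a * one_param B b * one_param C c) - taylor_poly A B C f g a b c)
        \<le> \<epsilon> * (\<bar>a\<bar> + \<bar>b\<bar> + \<bar>c\<bar>)\<^sup>2"
proof -
  let ?Fs = "(\<lambda>(V, W). lie_deriv V (lie_deriv W f)) ` ({A, B, C} \<times> {A, B, C})"
  have cont: "continuous_on UNIV F" if "F \<in> ?Fs" for F
    using that ABC by (auto intro!: smoothD(1) smooth_lie_deriv f)
  have fin: "finite ?Fs" by simp
  have VW: "lie_deriv V (lie_deriv W f) \<in> ?Fs" if "V \<in> {A, B, C}" "W \<in> {A, B, C}" for V W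
    using that by (intro image_eqI[of _ _ "(V, W)"]) auto
  obtain \<delta> where \<delta>: "\<delta> > 0" "\<And>F a b c. F \<in> ?Fs \<Longrightarrow>
    \<bar>a\<bar> < \<delta> \<Longrightarrow> \<bar>b\<bar> < \<delta> \<Longrightarrow>
      \<bar>c\<bar> < \<delta> \<Longrightarrow>
     norm (F (g * one_param A a * one_param B b * one_param C c) - F g) < \<epsilon>"
    using uniform_near_finite[OF fin cont ABC \<open>\<epsilon> > 0\<close>] by (metis (lifting))
  have "norm (f (g * one_param A a * one_param B b * one_param C c) - taylor_poly A B C f g a b c)
        \<le> \<epsilon> * (\<bar>a\<bar> + \<bar>b\<bar> + \<bar>c\<bar>)\<^sup>2" if abc: "\<bar>a\<bar> <
          \<delta>" "\<bar>b\<bar> < \<delta>" "\<bar>c\<bar> < \<delta>" for a b c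
  proof -
    note sm = smooth_lie_deriv f ABC
    define k where "k = g * one_param A a"
    define h where "h = k * one_param B b"
    have near3: "norm (lie_deriv V (lie_deriv W f) (h * one_param C t) - lie_deriv V (lie_deriv W f) g)
      \<le> \<epsilon>"
      if "\<bar>t\<bar> \<le> \<bar>c\<bar>" "V \<in> {A, B, C}" "W \<in> {A, B, C}" for t V W
      using \<delta>(2)[OF VW[OF that(2,3)], of a b t] that abc by (simp add: h_def k_def)
    have near2: "norm (lie_deriv V (lie_deriv W f) (k * one_param B t) - lie_deriv V (lie_deriv W f) g)
      \<le> \<epsilon>"
      if "\<bar>t\<bar> \<le> \<bar>b\<bar>" "V \<in> {A, B, C}" "W \<in> {A, B, C}" for t V W
      using \<delta>(2)[OF VW[OF that(2,3)], of a t 0] that abc \<delta>(1) ABC by (simp add: k_def)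
    have near1: "norm (lie_deriv V (lie_deriv W f) (g * one_param A t) - lie_deriv V (lie_deriv W f) g)
      \<le> \<epsilon>"
      if "\<bar>t\<bar> \<le> \<bar>a\<bar>" "V \<in> {A, B, C}" "W \<in> {A, B, C}" for t V W
      using \<delta>(2)[OF VW[OF that(2,3)], of t 0 0] that abc \<delta>(1) ABC by simp
    \<comment> \<open>\<open>E1\<close>, \<open>E4\<close>, \<open>E6\<close> are the quadratic
      errors in c, b, a; the other three are linear errors of first derivatives, each to be
      multiplied by one more parameter. Together they meet every monomial of degree two once, which
      the square of the sum dominates.\<close>
    define E1 where "E1 = f (h * one_param C c) - (f h + of_real c * lie_deriv C f h
      + of_real (c\<^sup>2/2) * lie_deriv C (lie_deriv C f) g)"
    define E2 where "E2 = lie_deriv C f h - (lie_deriv C f k + of_real b * lie_deriv B (lie_deriv C f) g)"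
    define E3 where "E3 = lie_deriv C f k - (lie_deriv C f g + of_real a * lie_deriv A (lie_deriv C f) g)"
    define E4 where "E4 = f h - (f k + of_real b * lie_deriv B f k
      + of_real (b\<^sup>2/2) * lie_deriv B (lie_deriv B f) g)"
    define E5 where "E5 = lie_deriv B f k - (lie_deriv B f g + of_real a * lie_deriv A (lie_deriv B f) g)"
    define E6 where "E6 = f k - (f g + of_real a * lie_deriv A f g
      + of_real (a\<^sup>2/2) * lie_deriv A (lie_deriv A f) g)"
    have 1: "norm E1 \<le> \<epsilon> * c\<^sup>2" unfolding E1_def by (rule taylor2) (use sm near3 in auto)
    have "norm E2 \<le> \<epsilon> * \<bar>b\<bar>" unfolding E2_def h_def by (rule taylor1) (use sm near2 in auto)
    from mult_left_mono[OF this, of "\<bar>c\<bar>"] have 2: "norm (of_real c * E2)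
      \<le> \<epsilon> * \<bar>b\<bar> * \<bar>c\<bar>" by (simp add: norm_mult mult_ac)
    have "norm E3 \<le> \<epsilon> * \<bar>a\<bar>" unfolding E3_def k_def by (rule taylor1) (use sm near1 in auto)
    from mult_left_mono[OF this, of "\<bar>c\<bar>"] have 3: "norm (of_real c * E3)
      \<le> \<epsilon> * \<bar>a\<bar> * \<bar>c\<bar>" by (simp add: norm_mult mult_ac)
    have 4: "norm E4 \<le> \<epsilon> * b\<^sup>2" unfolding E4_def h_def by (rule taylor2) (use sm near2 in auto)
    have "norm E5 \<le> \<epsilon> * \<bar>a\<bar>" unfolding E5_def k_def by (rule taylor1) (use sm near1 in auto)
    from mult_left_mono[OF this, of "\<bar>b\<bar>"] have 5: "norm (of_real b * E5)
      \<le> \<epsilon> * \<bar>a\<bar> * \<bar>b\<bar>" by (simp add: norm_mult mult_ac)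
    have 6: "norm E6 \<le> \<epsilon> * a\<^sup>2" unfolding E6_def k_def by (rule taylor2) (use sm near1 in auto)
    have "f (g * one_param A a * one_param B b * one_param C c) - taylor_poly A B C f g a b c
        = E1 + of_real c * E2 + of_real c * E3 + E4 + of_real b * E5 + E6"
      unfolding E1_def E2_def E3_def E4_def E5_def E6_def taylor_poly_def 
      by (simp add: k_def[symmetric] h_def[symmetric] algebra_simps)
    also have "norm \<dots> \<le> \<epsilon> * c\<^sup>2 + \<epsilon> * \<bar>b\<bar> * \<bar>c\<bar>
      + \<epsilon> * \<bar>a\<bar> * \<bar>c\<bar> + \<epsilon> * b\<^sup>2
        + \<epsilon> * \<bar>a\<bar> * \<bar>b\<bar> + \<epsilon> * a\<^sup>2"
      by (intro norm_triangle_mono 1 2 3 4 5 6)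
    also have "\<dots> = \<epsilon> * (\<bar>c\<bar>\<^sup>2 + \<bar>b\<bar> * \<bar>c\<bar>
      + \<bar>a\<bar> * \<bar>c\<bar> + \<bar>b\<bar>\<^sup>2 + \<bar>a\<bar> * \<bar>b\<bar> + \<bar>a\<bar>\<^sup>2)"
      by (simp add: algebra_simps)
    also have "\<dots> \<le> \<epsilon> * (\<bar>a\<bar> + \<bar>b\<bar> + \<bar>c\<bar>)\<^sup>2"
    proof (intro mult_left_mono)
      have "0 \<le> \<bar>b\<bar> * \<bar>c\<bar>" "0 \<le> \<bar>a\<bar> * \<bar>c\<bar>"
        "0 \<le> \<bar>a\<bar> * \<bar>b\<bar>" by simp_all
      then show "\<bar>c\<bar>\<^sup>2 + \<bar>b\<bar> * \<bar>c\<bar> + \<bar>a\<bar> * \<bar>c\<bar>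
        + \<bar>b\<bar>\<^sup>2 + \<bar>a\<bar> * \<bar>b\<bar> + \<bar>a\<bar>\<^sup>2 \<le> (\<bar>a\<bar>
          + \<bar>b\<bar> + \<bar>c\<bar>)\<^sup>2"
        by (simp add: power2_eq_square algebra_simps del: abs_mult_self_eq)
    qed (use \<open>\<epsilon> > 0\<close> in auto)
    finally show ?thesis .
  qed
  with \<delta>(1) show ?thesis by blast
qed

text \<open>With parameters of order s the remainder is o(s^2), the precision at which a commutator
  becomes visible.\<close>

lemma taylor_curve:
  fixes a b c :: "real \<Rightarrow> real"
  assumes f: "smooth f" and ABC: "A \<in> frame" "B \<in> frame" "C \<in> frame"
    and abc: "((\<lambda>s. a s / s) \<longlongrightarrow> a1) (at_right 0)"
      "((\<lambda>s. b s / s) \<longlongrightarrow> b1) (at_right 0)"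
      "((\<lambda>s. c s / s) \<longlongrightarrow> c1) (at_right 0)"
    and \<gamma>: "\<And>s. s > 0 \<Longrightarrow> \<gamma> s
      = one_param A (a s) * one_param B (b s) * one_param C (c s)"
  shows "((\<lambda>s. (f (g * \<gamma> s) - taylor_poly A B C f g (a s) (b s) (c s)) / of_real (s\<^sup>2))
    \<longlongrightarrow> 0) (at_right 0)"
proof (rule tendstoI)
  fix \<epsilon> :: real assume "\<epsilon> > 0"
  \<comment> \<open>A strict upper bound for the limit of the three quotients together; the 1 also
    keeps it positive.\<close>
  define K where "K = \<bar>a1\<bar> + \<bar>b1\<bar> + \<bar>c1\<bar> + 1"
  have K: "K > 0" unfolding K_def by (intro add_nonneg_pos add_nonneg_nonneg) auto
  have lim: "((\<lambda>s. \<bar>a s / s\<bar> + \<bar>b s / s\<bar>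
    + \<bar>c s / s\<bar>) \<longlongrightarrow> \<bar>a1\<bar> + \<bar>b1\<bar> + \<bar>c1\<bar>) (at_right 0)"
    by (intro tendsto_intros abc)
  have ev1: "\<forall>\<^sub>F s in at_right 0. \<bar>a s / s\<bar> + \<bar>b s / s\<bar> + \<bar>c s / s\<bar> < K"
    using order_tendstoD(2)[OF lim, of K] by (simp add: K_def)
  \<comment> \<open>Chosen so that \<epsilon>' (K s)^2 is half of \<epsilon> s^2, which leaves room
    for the strict inequality.\<close>
  define \<epsilon>' where "\<epsilon>' = \<epsilon> / (2 * K\<^sup>2)"
  have \<epsilon>': "\<epsilon>' > 0" using \<open>\<epsilon> > 0\<close> K by (simp add: \<epsilon>'_def)
  from taylor3[OF f ABC \<epsilon>', of g] obtain \<delta> where \<delta>: "\<delta> > 0"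
    "\<And>a b c. \<bar>a\<bar> < \<delta> \<Longrightarrow> \<bar>b\<bar> < \<delta> \<Longrightarrow>
      \<bar>c\<bar> < \<delta> \<Longrightarrow>
      norm (f (g * one_param A a * one_param B b * one_param C c) - taylor_poly A B C f g a b c)
        \<le> \<epsilon>' * (\<bar>a\<bar> + \<bar>b\<bar> + \<bar>c\<bar>)\<^sup>2" by blast
  have ev2: "\<forall>\<^sub>F s in at_right (0::real). s \<in> {0<..<\<delta>/K}"
    by (rule eventually_at_right_real) (use \<delta> K in auto)
  show "\<forall>\<^sub>F s in at_right 0. dist ((f (g * \<gamma> s)
    - taylor_poly A B C f g (a s) (b s) (c s)) / of_real (s\<^sup>2)) 0 < \<epsilon>"
    using ev1 ev2
  proof eventually_elim
    case (elim s)
    then have s: "s > 0" "K * s < \<delta>" using K by (auto simp: field_simps)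
    then have sum: "\<bar>a s\<bar> + \<bar>b s\<bar> + \<bar>c s\<bar> < K * s"
      using elim(1) by (simp add: field_simps)
    then have "norm (f (g * \<gamma> s) - taylor_poly A B C f g (a s) (b s) (c s))
      \<le> \<epsilon>' * (\<bar>a s\<bar> + \<bar>b s\<bar> + \<bar>c s\<bar>)\<^sup>2"
      unfolding \<gamma>[OF s(1)] mult.assoc[symmetric] using s by (intro \<delta>(2)) linarith+
    also have "\<dots> \<le> \<epsilon>' * (K * s)\<^sup>2"
      using sum \<epsilon>' by (intro mult_left_mono power_mono) auto
    also have "\<dots> = \<epsilon> / 2 * s\<^sup>2" using K by (simp add: \<epsilon>'_def power2_eq_square)
    also have "\<dots> < \<epsilon> * s\<^sup>2" using s \<open>\<epsilon> > 0\<close> by simp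
    finally show ?case using s by (simp add: dist_norm norm_divide divide_less_eq norm_power)
  qed
qed

text \<open>Both commutators come from comparing second order expansions of one curve in the group that is
  written as a product of one-parameter subgroups in two ways.\<close>

lemma taylor_compare:
  assumes p: "((\<lambda>s. (F s - p s) / of_real (s\<^sup>2)) \<longlongrightarrow> 0) (at_right (0::real))"
    and q: "((\<lambda>s. (F s - q s) / of_real (s\<^sup>2)) \<longlongrightarrow> 0) (at_right (0::real))"
    and l: "(h \<longlongrightarrow> l) (at_right (0::real))"
    and h: "\<And>s. s > 0 \<Longrightarrow> h s = (p s - q s) / of_real (s\<^sup>2)"
  shows "l = (0 :: complex)"
proof -
  have "((\<lambda>s. (F s - q s) / of_real (s\<^sup>2) - (F s
    - p s) / of_real (s\<^sup>2)) \<longlongrightarrow> 0) (at_right (0::real))"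
    using tendsto_diff[OF q p] by simp
  then have "(h \<longlongrightarrow> 0) (at_right 0)"
  proof (rule Lim_transform_eventually)
    show "\<forall>\<^sub>F s in at_right 0. (F s - q s) / of_real (s\<^sup>2) - (F s
      - p s) / of_real (s\<^sup>2) = h s"
      using eventually_at_right_less[of "0::real"] by eventually_elim (simp add: h diff_divide_distrib)
  qed
  then show ?thesis by (rule tendsto_unique[OF _ l, rotated]) simp
qed

text \<open>The curve \<open>exp (s V) exp (s X)\<close> equals \<open>exp (s X) exp (e V)\<close>
  with \<open>e\<close> = s - weight V s^2 + o(s^2). At order s^2 the linear term in
  \<open>V\<close> leaves the weight, and the mixed terms leave the commutator.\<close>

lemma bracket_X:
  assumes f: "smooth f" and V: "V \<in> frame"
  shows "lie_deriv X_mat (lie_deriv V f) g = lie_deriv V (lie_deriv X_mat f) g + weight V * lie_deriv V f g"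
proof -
  define e where "e = (\<lambda>s. exp (- weight V * s) * s)"
  have e: "((\<lambda>s. e s / s) \<longlongrightarrow> 1) (at_right 0)"
    "((\<lambda>s. (s - e s) / s\<^sup>2) \<longlongrightarrow> weight V) (at_right 0)"
    "((\<lambda>s. (e s)\<^sup>2 / s\<^sup>2) \<longlongrightarrow> 1) (at_right 0)"
    unfolding e_def by real_asymp+
  have id: "((\<lambda>s::real. s / s) \<longlongrightarrow> 1) (at_right 0)" and z: "((\<lambda>s::real. 0 /
    s) \<longlongrightarrow> 0) (at_right 0)"
    by real_asymp+
  let ?V = "lie_deriv V f g" and ?VV = "lie_deriv V (lie_deriv V f) g"
    and ?VX = "lie_deriv V (lie_deriv X_mat f) g" and ?XV = "lie_deriv X_mat (lie_deriv V f) g"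
  let ?\<gamma> = "\<lambda>s. one_param V s * one_param X_mat s"
  have "((\<lambda>s. of_real ((s - e s) / s\<^sup>2) * ?V + of_real (1/2
    - ((e s)\<^sup>2 / s\<^sup>2) / 2) * ?VV + ?VX - of_real (e s / s) * ?XV)
      \<longlongrightarrow> of_real (weight V) * ?V + of_real (1/2 - 1 / 2) * ?VV + ?VX - of_real 1 * ?XV) (at_right 0)"
    by (intro tendsto_intros e) simp
  then have "of_real (weight V) * ?V + of_real (1/2 - 1 / 2) * ?VV + ?VX - of_real 1 * ?XV = 0"
  proof (rule taylor_compare[rotated 2])
    show "((\<lambda>s. (f (g * ?\<gamma> s) - taylor_poly V X_mat X_mat f g s s 0) / of_real (s\<^sup>2))
      \<longlongrightarrow> 0) (at_right 0)"
      by (rule taylor_curve[OF f V in_frame(1) in_frame(1) id id z]) simp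
    show "((\<lambda>s. (f (g * ?\<gamma> s) - taylor_poly X_mat V X_mat f g s (e s) 0) / of_real (s\<^sup>2))
      \<longlongrightarrow> 0) (at_right 0)"
      by (rule taylor_curve[OF f in_frame(1) V in_frame(1) id e(1) z]) (simp add: one_param_conj[OF V] e_def)
  qed (simp add: taylor_poly_def field_simps power2_eq_square)
  then show ?thesis by (simp add: add.commute)
qed

text \<open>The curve \<open>exp (s U_+) exp (s U_-)\<close> and its Gauss decomposition. The middle
  parameter \<open>b\<close> is 2 s^2 to leading order and contributes 2 X; \<open>e\<close> differs
  from s only at order s^3, so that otherwise just the two mixed derivatives survive.\<close>

lemma bracket_Uplus_Uminus:
  assumes f: "smooth f"
  shows "lie_deriv Uplus (lie_deriv Uminus f) g = lie_deriv Uminus (lie_deriv Uplus f) g + 2 * lie_deriv X_mat f g"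
proof -
  define e where "e = (\<lambda>s::real. s / (1 + s * s))"
  define b where "b = (\<lambda>s::real. 2 * ln (1 + s * s))"
  have e: "((\<lambda>s. e s / s) \<longlongrightarrow> 1) (at_right 0)"
    "((\<lambda>s. (s - e s) / s\<^sup>2) \<longlongrightarrow> 0) (at_right 0)"
    "((\<lambda>s. (e s)\<^sup>2 / s\<^sup>2) \<longlongrightarrow> 1) (at_right 0)" 
    "((\<lambda>s. b s / s) \<longlongrightarrow> 0) (at_right 0)"
      "((\<lambda>s. b s / s\<^sup>2) \<longlongrightarrow> 2) (at_right 0)"
    "((\<lambda>s. (b s)\<^sup>2 / s\<^sup>2) \<longlongrightarrow> 0) (at_right 0)"
      "((\<lambda>s. (e s * b s) / s\<^sup>2) \<longlongrightarrow> 0) (at_right 0)"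
    unfolding e_def b_def by real_asymp+
  have id: "((\<lambda>s::real. s / s) \<longlongrightarrow> 1) (at_right 0)" and z: "((\<lambda>s::real. 0 /
    s) \<longlongrightarrow> 0) (at_right 0)"
    by real_asymp+
  let ?D = "\<lambda>V. lie_deriv V f g" and ?D2 = "\<lambda>V W. lie_deriv V (lie_deriv W f) g"
  let ?\<gamma> = "\<lambda>s. one_param Uplus s * one_param Uminus s"
  let ?a = "?D Uplus + ?D Uminus" and ?b = "?D2 Uplus Uplus + ?D2 Uminus Uminus" and ?c = "?D2 Uminus X_mat
    + ?D2 X_mat Uplus"
  have "((\<lambda>s. of_real ((s - e s) / s\<^sup>2) * ?a + of_real (1/2 - ((e s)\<^sup>2 / s\<^sup>2) / 2) * ?b
       + ?D2 Uplus Uminus - of_real ((e s)\<^sup>2 / s\<^sup>2) * ?D2 Uminus Uplus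
         - of_real (b s / s\<^sup>2) * ?D X_mat
       - of_real ((b s)\<^sup>2 / s\<^sup>2 / 2) * ?D2 X_mat X_mat
         - of_real ((e s * b s) / s\<^sup>2) * ?c) \<longlongrightarrow> 
       of_real 0 * ?a + of_real (1/2 - 1 / 2) * ?b + ?D2 Uplus Uminus - of_real 1 * ?D2 Uminus Uplus
       - of_real 2 * ?D X_mat - of_real (0 / 2) * ?D2 X_mat X_mat - of_real 0 * ?c) (at_right 0)"
    by (intro tendsto_intros e) simp_all
  then have "of_real 0 * ?a + of_real (1/2 - 1 / 2) * ?b + ?D2 Uplus Uminus - of_real 1 * ?D2 Uminus Uplus
       - of_real 2 * ?D X_mat - of_real (0 / 2) * ?D2 X_mat X_mat - of_real 0 * ?c = 0"
  proof (rule taylor_compare[rotated 2])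
    show "((\<lambda>s. (f (g * ?\<gamma> s) - taylor_poly Uplus Uminus X_mat f g s s 0) / of_real (s\<^sup>2))
      \<longlongrightarrow> 0) (at_right 0)"
      by (rule taylor_curve[OF f in_frame(2) in_frame(3) in_frame(1) id id z]) simp
    show "((\<lambda>s. (f (g * ?\<gamma> s) - taylor_poly Uminus X_mat Uplus f g (e s) (b s) (e s)) / of_real
      (s\<^sup>2)) \<longlongrightarrow> 0) (at_right 0)"
      by (rule taylor_curve[OF f in_frame(3) in_frame(1) in_frame(2) e(1) e(4) e(1)])
         (simp add: Uplus_Uminus_decomposition e_def b_def add_pos_pos)
  qed (simp add: taylor_poly_def field_simps power2_eq_square)
  then show ?thesis by (simp add: algebra_simps)
qed

section \<open>Invariance of the Haar measure\<close>

text \<open>Boxes go to boxes with the same side lengths, and boxes determine Lebesgue measure.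
  Domain and target may differ because \<open>rows\<close> passes from pairs of vectors to
  matrices.\<close>

lemma distr_lborel_basis:
  fixes L :: "'a::euclidean_space \<Rightarrow> 'b::euclidean_space"
  assumes L: "linear L" and bij: "bij_betw L Basis Basis"
  shows "distr lborel borel L = lborel"
proof (rule lborel_eqI[symmetric])
  have meas: "L \<in> borel_measurable borel"
    by (intro borel_measurable_continuous_onI linear_continuous_on) (use L linear_linear
      linear_conv_bounded_linear in blast)
  have inner: "L x \<bullet> L b = x \<bullet> b" if b: "b \<in> Basis" for x b
  proof -
    have "L x = (\<Sum>j\<in>Basis. (x \<bullet> j) *\<^sub>R L j)"
      by (metis (no_types, lifting) L euclidean_representation linear_scale linear_sum sum.cong)
    then have "L x \<bullet> L b = (\<Sum>j\<in>Basis. (x \<bullet> j) * (L j \<bullet> L b))"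
      by (simp add: inner_sum_left)
    also have "\<dots> = (\<Sum>j\<in>Basis. (x \<bullet> j) * (if j = b then 1 else 0))"
    proof (intro sum.cong refl)
      fix j :: 'a assume j: "j \<in> Basis"
      have "L j \<in> Basis" "L b \<in> Basis" using bij j b by (auto simp: bij_betw_def)
      moreover have "L j = L b \<longleftrightarrow> j = b" using bij j b by (auto simp: bij_betw_def inj_on_def)
      ultimately show "(x \<bullet> j) * (L j \<bullet> L b) = (x \<bullet> j) * (if j = b then 1 else 0)"
        by (simp add: inner_Basis)
    qed
    also have "\<dots> = x \<bullet> b" using b by (simp add: if_distrib cong: if_cong)
    finally show ?thesis .
  qed
  fix l u :: 'b assume lu: "\<And>b. b \<in> Basis \<Longrightarrow> l \<bullet> b \<le> u \<bullet> b"
  define l' u' where "l' = (\<Sum>b\<in>Basis. (l \<bullet> L b) *\<^sub>R b)" and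
    "u' = (\<Sum>b\<in>Basis. (u \<bullet> L b) *\<^sub>R b)"
  have l'u': "l' \<bullet> b = l \<bullet> L b" "u' \<bullet> b = u \<bullet> L b" if "b \<in> Basis" for b
    using that by (auto simp: l'_def u'_def inner_sum_left inner_Basis if_distrib cong: if_cong)
  have LB: "Basis = L ` Basis" using bij by (auto simp: bij_betw_def)
  have vimage: "L -` box l u = box l' u'"
    by (subst (1) box_def, subst LB) (auto simp: box_def inner l'u')
  have "emeasure (distr lborel borel L) (box l u) = emeasure lborel (box l' u')"
    using meas by (subst emeasure_distr) (auto simp: vimage)
  also have "\<dots> = (\<Prod>b\<in>Basis. (u' - l') \<bullet> b)"
    using lu bij by (intro emeasure_lborel_box) (auto simp: l'u' bij_betw_def)
  also have "(\<Prod>b\<in>Basis. (u' - l') \<bullet> b) = (\<Prod>b\<in>Basis. (u - l) \<bullet> L b)"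
    by (intro prod.cong) (auto simp: inner_diff_left l'u')
  also have "\<dots> = (\<Prod>b\<in>Basis. (u - l) \<bullet> b)"
    using prod.reindex_bij_betw[OF bij, of "\<lambda>b. (u - l) \<bullet> b"] .
  finally show "emeasure (distr lborel borel L) (box l u) = ennreal (\<Prod>b\<in>Basis. (u - l) \<bullet> b)" .
qed simp

section \<open>Lebesgue measure on matrices under multiplication by \<open>SL(2,R)\<close>\<close>

definition lborel_preserving :: "('a::euclidean_space \<Rightarrow> 'b::euclidean_space) \<Rightarrow> bool" where
  "lborel_preserving L \<longleftrightarrow> L \<in> borel_measurable borel \<and> distr lborel borel L = lborel"

lemma lborel_preserving_compose:
  assumes "lborel_preserving L" "lborel_preserving K"
  shows "lborel_preserving (\<lambda>x. L (K x))"
proof -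
  have "distr lborel borel (\<lambda>x. L (K x)) = distr (distr lborel borel K) borel L"
    using assms by (subst distr_distr) (auto simp: lborel_preserving_def o_def)
  then show ?thesis using assms by (auto simp: lborel_preserving_def)
qed

lemma lborel_preserving_compose':
  assumes "lborel_preserving L" "lborel_preserving K" "\<And>x. N x = L (K x)"
  shows "lborel_preserving N"
  using lborel_preserving_compose[OF assms(1,2)] assms(3) by presburger

lemma lborel_preserving_basis:
  fixes L :: "'a::euclidean_space \<Rightarrow> 'b::euclidean_space"
  assumes "linear L" "bij_betw L Basis Basis"
  shows "lborel_preserving L"
  unfolding lborel_preserving_def
  by (intro conjI distr_lborel_basis assms borel_measurable_continuous_onI linear_continuous_on)
     (use assms linear_conv_bounded_linear in blast)

text \<open>Viewing a matrix as the pair of its rows turns an elementary row operation into a shear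
  of a product space.\<close>

definition rows :: "(real^2) \<times> (real^2) \<Rightarrow> mat2" where
  "rows p = (\<chi> i. if i = 1 then fst p else snd p)"

lemma lborel_preserving_rows: "lborel_preserving rows"
proof (rule lborel_preserving_basis)
  show "linear rows"
    by (rule linearI) (auto simp: rows_def vec_eq_iff)
  have ax: "rows (b, 0) = axis (1::2) b" "rows (0, b) = axis (2::2) b" for b
    by (auto simp: rows_def axis_def vec_eq_iff forall_2)
  have Basis: "Basis = axis (1::2) ` (Basis :: (real^2) set) \<union> axis (2::2) ` (Basis :: (real^2) set)"
    by (simp add: Basis_vec_def[where 'a="real^2" and 'b=2] UNIV_2 image_def) blast
  show "bij_betw rows Basis Basis"
    unfolding bij_betw_def
  proof
    show "inj_on rows Basis"
      by (rule inj_onI) (auto simp: rows_def vec_eq_iff forall_2 prod_eq_iff)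
    show "rows ` Basis = Basis"
      unfolding Basis Basis_prod_def by (auto simp: ax image_Un image_image)
  qed
qed

lemma lborel_preserving_transpose: "lborel_preserving (transpose :: mat2 \<Rightarrow> mat2)"
proof (rule lborel_preserving_basis)
  show "linear (transpose :: mat2 \<Rightarrow> mat2)"
    by (rule linearI) (auto simp: transpose_def vec_eq_iff)
  have ax: "transpose (axis i (axis j (1::real))) = axis j (axis i 1)" for i j :: 2
    by (auto simp: transpose_def axis_def vec_eq_iff)
  have Basis: "(Basis :: mat2 set) = (\<Union>i j. {axis i (axis j 1)})"
    by (auto simp: Basis_vec_def)
  show "bij_betw (transpose :: mat2 \<Rightarrow> mat2) Basis Basis"
    unfolding bij_betw_def
  proof
    show "inj_on (transpose :: mat2 \<Rightarrow> mat2) Basis"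
      by (rule inj_onI) (metis transpose_transpose)
    show "transpose ` (Basis :: mat2 set) = Basis"
      unfolding Basis by (auto simp: image_UN ax)
  qed
qed

lemma distr_eqI_borel:
  assumes "L \<in> borel_measurable borel"
    and "\<And>A. A \<in> sets borel \<Longrightarrow> emeasure lborel (L -` A) = emeasure lborel A"
  shows "lborel_preserving L"
  unfolding lborel_preserving_def
proof (intro conjI assms measure_eqI)
  fix A assume "A \<in> sets (distr lborel borel L)"
  then show "emeasure (distr lborel borel L) A = emeasure lborel A"
    using assms by (simp add: emeasure_distr)
qed simp

lemma emeasure_lborel_plus:
  fixes c :: "'a::euclidean_space"
  assumes "A \<in> sets borel" shows "emeasure lborel ((+) c -` A) = emeasure lborel A"
proof -
  have "emeasure (distr lborel borel ((+) c)) A = emeasure lborel ((+) c -` A)"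
    using assms by (subst emeasure_distr) auto
  then show ?thesis by (simp add: lborel_distr_plus)
qed

text \<open>On each fibre over the first component the map is a translation, so Fubini
  applies.\<close>

lemma lborel_preserving_shear:
  "lborel_preserving (\<lambda>p :: 'a::euclidean_space \<times> 'a. (fst p, t *\<^sub>R fst p + snd p))"
proof (rule distr_eqI_borel)
  show meas: "(\<lambda>p :: 'a \<times> 'a. (fst p, t *\<^sub>R fst p + snd p)) \<in> borel_measurable borel"
    by (intro borel_measurable_continuous_onI continuous_intros)
  have s: "sets (lborel \<Otimes>\<^sub>M lborel :: ('a \<times> 'a) measure) = sets borel"
    by (subst lborel_prod) simp
  fix A :: "('a \<times> 'a) set" assume A: "A \<in> sets borel"
  let ?A' = "(\<lambda>p. (fst p, t *\<^sub>R fst p + snd p)) -` A"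
  have A': "?A' \<in> sets borel" using measurable_sets[OF meas A] by simp
  have "emeasure lborel ?A' = (\<integral>\<^sup>+x. emeasure lborel (Pair x -` ?A') \<partial>lborel)"
    unfolding lborel_prod[symmetric] using A' s by (intro lborel.emeasure_pair_measure_alt) auto
  also have "\<dots> = (\<integral>\<^sup>+x. emeasure lborel (Pair x -` A) \<partial>lborel)"
  proof (intro nn_integral_cong)
    fix x :: 'a
    have "Pair x -` A \<in> sets borel"
      using sets_Pair1[of A "lborel :: 'a measure" "lborel :: 'a measure" x] A unfolding s by simp
    moreover have "Pair x -` ?A' = (+) (t *\<^sub>R x) -` (Pair x -` A)" by auto
    ultimately show "emeasure lborel (Pair x -` ?A') = emeasure lborel (Pair x -` A)"
      by (simp add: emeasure_lborel_plus)
  qed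
  also have "\<dots> = emeasure lborel A"
    unfolding lborel_prod[symmetric] using A s by (intro lborel.emeasure_pair_measure_alt[symmetric]) auto
  finally show "emeasure lborel ?A' = emeasure lborel A" .
qed

lemma lborel_preserving_swap: "lborel_preserving (prod.swap :: 'a::euclidean_space \<times> 'a \<Rightarrow> _)"
proof (rule lborel_preserving_basis)
  show "linear (prod.swap :: 'a \<times> 'a \<Rightarrow> _)" by (rule linearI) auto
  have "prod.swap ` (Basis :: ('a \<times> 'a) set) = Basis"
    unfolding Basis_prod_def by (auto simp: image_Un image_image)
  then show "bij_betw prod.swap (Basis :: ('a \<times> 'a) set) Basis" by (auto simp: bij_betw_def inj_on_def)
qed

lemma lborel_preserving_conj:
  fixes L :: "mat2 \<Rightarrow> mat2"
  assumes "lborel_preserving S" "\<And>p. L (rows p) = rows (S p)" "L \<in> borel_measurable borel"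
  shows "lborel_preserving L"
proof -
  have rows: "distr lborel borel rows = lborel" "rows \<in> borel_measurable borel"
    using lborel_preserving_rows by (auto simp: lborel_preserving_def)
  have "lborel_preserving (\<lambda>p. L (rows p))"
    by (rule lborel_preserving_compose'[OF lborel_preserving_rows assms(1,2)])
  then have "distr lborel borel (\<lambda>p. L (rows p)) = lborel"
    by (simp only: lborel_preserving_def)
  moreover have "distr (distr lborel borel rows) borel L = distr lborel borel (\<lambda>p. L (rows p))"
    using rows(2) assms(3) by (subst distr_distr) (auto simp: o_def)
  ultimately show ?thesis
    using rows(1) assms(3) by (simp only: lborel_preserving_def)
qed

lemma borel_measurable_matrix_mult:
  fixes B :: mat2
  shows "(\<lambda>A :: mat2. B ** A) \<in> borel_measurable borel"
proof (rule borel_measurable_continuous_onI)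
  show "continuous_on UNIV (\<lambda>A :: mat2. B ** A)"
    by (rule continuous_on_matrix_mult[OF continuous_on_const continuous_on_id])
qed

lemma lborel_preserving_elementary:
  "lborel_preserving (\<lambda>A :: mat2. mat22 1 0 t 1 ** A)"
    "lborel_preserving (\<lambda>A :: mat2. mat22 1 t 0 1 ** A)"
proof -
  show "lborel_preserving (\<lambda>A :: mat2. mat22 1 0 t 1 ** A)"
  proof (rule lborel_preserving_conj[OF lborel_preserving_shear])
    show "mat22 1 0 t 1 ** rows p = rows (fst p, t *\<^sub>R fst p + snd p)" for p
      by (auto simp: mat2_eq_iff rows_def matrix_matrix_mult_def sum_2)
  qed (rule borel_measurable_matrix_mult)
  show "lborel_preserving (\<lambda>A :: mat2. mat22 1 t 0 1 ** A)"
  proof (rule lborel_preserving_conj[OF lborel_preserving_compose[OF lborel_preserving_swap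
        lborel_preserving_compose[OF lborel_preserving_shear lborel_preserving_swap]]])
    show "mat22 1 t 0 1 ** rows p = rows (prod.swap (fst (prod.swap p), t *\<^sub>R fst (prod.swap p)
      + snd (prod.swap p)))" for p
      by (auto simp: mat2_eq_iff rows_def matrix_matrix_mult_def sum_2)
  qed (rule borel_measurable_matrix_mult)
qed

text \<open>Unipotent row operations are shears, and they generate \<open>SL(2,R)\<close>.\<close>

lemma lborel_preserving_left:
  assumes "det (B :: mat2) = 1"
  shows "lborel_preserving (\<lambda>A :: mat2. B ** A)"
proof -
  have *: "lborel_preserving (\<lambda>A :: mat2. mat22 a b c d ** A)" if "c \<noteq> 0" "a * d - b * c = 1" for a b c d
  proof -
    \<comment> \<open>Three shears suffice when c is nonzero; the upper right entry comes out as b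
      because a d - b c = 1.\<close>
    have "mat22 1 ((a - 1) / c) 0 1 ** mat22 1 0 c 1 ** mat22 1 ((d - 1) / c) 0 1 = mat22 a b c d"
    proof -
      have "a * (d - 1) / c + (a - 1) / c = b"
      proof -
        have "a * (d - 1) + (a - 1) = b * c" using that by (simp add: algebra_simps)
        then have "(a * (d - 1) + (a - 1)) / c = b" using that by simp
        then show ?thesis by (simp add: add_divide_distrib)
      qed
      then show ?thesis using that by simp
    qed
    then have "mat22 a b c d ** A = mat22 1 ((a - 1) / c) 0 1 ** (mat22 1 0 c 1 ** (mat22 1 ((d
      - 1) / c) 0 1 ** A))" for A :: mat2
      by (metis matrix_mul_assoc)
    then show ?thesis
      by (rule lborel_preserving_compose'[OF lborel_preserving_elementary(2)
           lborel_preserving_compose[OF lborel_preserving_elementary(1) lborel_preserving_elementary(2)]])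
  qed
  obtain a b c d where B: "B = mat22 a b c d" by (rule mat22_cases)
  have det: "a * d - b * c = 1" using assms by (simp add: B)
  show ?thesis
  proof (cases "c = 0")
    case False
    with * det B show ?thesis by simp
  next
    case True
    with det have "a \<noteq> 0" by auto
    \<comment> \<open>For c = 0 one row operation puts a into the lower left corner, where it is
      nonzero by the determinant condition; this is the case already treated.\<close>
    have "mat22 1 0 (-1) 1 ** mat22 a b a (b + d) = B" using True by (simp add: B)
    then have eq: "B ** A = mat22 1 0 (-1) 1 ** (mat22 a b a (b + d) ** A)" for A :: mat2
      by (metis matrix_mul_assoc)
    show ?thesis
      by (rule lborel_preserving_compose'[OF lborel_preserving_elementary(1) * eq])
         (use det True \<open>a \<noteq> 0\<close> in \<open>auto simp: algebra_simps\<close>)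
  qed
qed

lemma lborel_preserving_right:
  assumes "det (B :: mat2) = 1"
  shows "lborel_preserving (\<lambda>A :: mat2. A ** B)"
proof -
  have eq: "A ** B = transpose (transpose B ** transpose A)" for A
    by (simp add: matrix_transpose_mul[symmetric])
  show ?thesis
    by (rule lborel_preserving_compose'[OF lborel_preserving_transpose
       lborel_preserving_compose[OF lborel_preserving_left lborel_preserving_transpose] eq])
       (simp add: assms det_transpose)
qed

section \<open>Haar measure as Lebesgue measure of cones\<close>

definition cone_dom :: "mat2 set" where "cone_dom = {A. 0 < det A \<and> det A \<le> 1}"

definition cone_proj :: "mat2 \<Rightarrow> psl2" where "cone_proj A = abs_psl2 ((1 / sqrt (det A)) *\<^sub>R A)"

lemma haar_def': "haar = distr (restrict_space lborel cone_dom) borel cone_proj"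
  by (simp add: haar_def cone_dom_def cone_proj_def[abs_def])

lemma det_scaleR_mat2: "det (r *\<^sub>R A) = r\<^sup>2 * det (A :: mat2)"
  by (simp add: det_2 power2_eq_square algebra_simps)

lemma det_normalize: "0 < det A \<Longrightarrow> det ((1 / sqrt (det A)) *\<^sub>R (A :: mat2)) = 1"
  by (simp add: det_scaleR_mat2 power_divide)

lemma cone_dom_borel [measurable]: "cone_dom \<in> sets borel"
proof -
  have "continuous_on UNIV (det :: mat2 \<Rightarrow> real)" unfolding det_2 by (intro continuous_intros)
  then have [measurable]: "(det :: mat2 \<Rightarrow> real) \<in> borel_measurable borel"
    by (rule borel_measurable_continuous_onI)
  show ?thesis unfolding cone_dom_def by measurable
qed

lemma cone_proj_measurable: "cone_proj \<in> borel_measurable (restrict_space lborel cone_dom)"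
proof -
  have "continuous_on cone_dom (det :: mat2 \<Rightarrow> real)" unfolding det_2 by (intro continuous_intros)
  then have "continuous_on cone_dom cone_proj"
    unfolding cone_proj_def
    by (intro continuous_on_abs_psl2 continuous_intros det_normalize) (auto simp: cone_dom_def)
  then have "cone_proj \<in> borel_measurable (restrict_space borel cone_dom)"
    by (rule borel_measurable_continuous_on_restrict)
  then show ?thesis
    by (simp add: measurable_def space_restrict_space sets_restrict_space)
qed

lemma sets_haar [simp, measurable_cong]: "sets haar = sets borel" and space_haar [simp]: "space haar = UNIV"
  by (simp_all add: haar_def)

lemma cone_proj_vimage: "E \<in> sets borel \<Longrightarrow> cone_proj -` E \<inter> cone_dom \<in> sets borel"
  using measurable_sets[OF cone_proj_measurable, of E]
  by (auto simp: space_restrict_space sets_restrict_space cone_dom_borel Int_absorb2 Int_commute)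

lemma emeasure_haar: 
  assumes "E \<in> sets borel"
  shows "emeasure haar E = emeasure lborel (cone_proj -` E \<inter> cone_dom)"
  unfolding haar_def' using assms cone_proj_measurable
  by (simp add: emeasure_distr space_restrict_space emeasure_restrict_space)

lemma cone_proj_mult:
  assumes "A \<in> cone_dom" "det B = 1"
  shows "cone_proj (B ** A) = abs_psl2 B * cone_proj A" "cone_proj (A ** B) = cone_proj A * abs_psl2 B"
proof -
  have A: "0 < det A" using assms by (simp add: cone_dom_def)
  have "B ** (r *\<^sub>R A) = r *\<^sub>R (B ** A)" "(r *\<^sub>R A) ** B = r *\<^sub>R (A ** B)" for r
    by (simp_all add: mat2_eq_iff matrix_matrix_mult_def sum_2 algebra_simps)
  then show "cone_proj (B ** A) = abs_psl2 B * cone_proj A" "cone_proj (A ** B) = cone_proj A * abs_psl2 B"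
    using assms A by (simp_all add: cone_proj_def abs_psl2_mult det_normalize det_mul)
qed

lemma borel_measurable_psl2_mult [measurable]:
  "(\<lambda>g :: psl2. a * g) \<in> borel_measurable borel" "(\<lambda>g :: psl2. g * a) \<in> borel_measurable borel"
  by (intro borel_measurable_continuous_onI continuous_on_mult_psl2_left continuous_on_mult_psl2_right)+

text \<open>Multiplication by \<open>SL(2,R)\<close> preserves the determinant, hence the truncated
  cone, and it commutes with the radial projection; so both invariances of Lebesgue measure descend.
  Right invariance will make the flow measure preserving, left invariance lets the measure pass to
  the quotient.\<close>

lemma emeasure_haar_mult:
  assumes E: "E \<in> sets borel"
  shows "emeasure haar ((\<lambda>g. a * g) -` E) = emeasure haar E"
    and "emeasure haar ((\<lambda>g. g * a) -` E) = emeasure haar E"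
proof -
  obtain B where B: "det B = 1" "a = abs_psl2 B" by (rule psl2_cases)
  have dom: "B ** A \<in> cone_dom \<longleftrightarrow> A \<in> cone_dom"
    "A ** B \<in> cone_dom \<longleftrightarrow> A \<in> cone_dom" for A
    using B by (auto simp: cone_dom_def det_mul)
  have pres: "emeasure lborel (L -` S) = emeasure lborel S"
    if "lborel_preserving L" "S \<in> sets borel" for L :: "mat2 \<Rightarrow> mat2" and S
  proof -
    have "emeasure lborel S = emeasure (distr lborel borel L) S" using that by (simp add: lborel_preserving_def)
    also have "\<dots> = emeasure lborel (L -` S)" using that
      by (subst emeasure_distr) (auto simp: lborel_preserving_def)
    finally show ?thesis by simp
  qed
  have E1: "(\<lambda>g. a * g) -` E \<in> sets borel" "(\<lambda>g. g * a) -` E \<in> sets borel"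
    using measurable_sets[OF borel_measurable_psl2_mult(1) E] measurable_sets[OF borel_measurable_psl2_mult(2)
      E] by auto
  have "cone_proj -` ((\<lambda>g. a * g) -` E) \<inter> cone_dom
    = (\<lambda>A. B ** A) -` (cone_proj -` E \<inter> cone_dom)"
    by (auto simp: dom cone_proj_mult B)
  then show "emeasure haar ((\<lambda>g. a * g) -` E) = emeasure haar E"
    using E E1 pres[OF lborel_preserving_left[OF B(1)] cone_proj_vimage] by (simp add: emeasure_haar)
  have "cone_proj -` ((\<lambda>g. g * a) -` E) \<inter> cone_dom
    = (\<lambda>A. A ** B) -` (cone_proj -` E \<inter> cone_dom)"
    by (auto simp: dom cone_proj_mult B)
  then show "emeasure haar ((\<lambda>g. g * a) -` E) = emeasure haar E"
    using E E1 pres[OF lborel_preserving_right[OF B(1)] cone_proj_vimage] by (simp add: emeasure_haar)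
qed

lemma borel_measurable_psl2_size [measurable]: "psl2_size \<in> borel_measurable borel"
  by (intro borel_measurable_continuous_onI continuous_on_psl2_size)

text \<open>The cone over a ball consists of matrices of bounded size multiplied by sqrt (det A),
  which is at most 1; it is bounded.\<close>

lemma emeasure_haar_psl2_size: "emeasure haar {g. psl2_size g \<le> r} < \<infinity>"
proof -
  have E: "{g. psl2_size g \<le> r} \<in> sets borel" by measurable
  have "norm A \<le> \<bar>r\<bar>" if A: "cone_proj A \<in> {g. psl2_size g \<le> r}" "A \<in> cone_dom" for A
  proof -
    have det: "0 < det A" "det A \<le> 1" using A by (auto simp: cone_dom_def)
    have "entry_sum A = sqrt (det A) * entry_sum ((1 / sqrt (det A)) *\<^sub>R A)"
      using det by (simp add: entry_sum_def abs_mult field_simps)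
    also have "\<dots> = sqrt (det A) * psl2_size (cone_proj A)"
      using det by (simp add: cone_proj_def det_normalize)
    also have "\<dots> \<le> 1 * \<bar>r\<bar>" using A det by (intro mult_mono) auto
    finally show ?thesis using norm_le_entry_sum[of A] by simp
  qed
  then have "bounded (cone_proj -` {g. psl2_size g \<le> r} \<inter> cone_dom)"
    by (intro boundedI[of _ "\<bar>r\<bar>"]) auto
  then show ?thesis
    unfolding emeasure_haar[OF E] by (rule emeasure_bounded_finite)
qed

section \<open>The invariant measure on the quotient\<close>

locale surface =
  fixes \<Gamma> :: "psl2 set"
  assumes surface: "surface_group \<Gamma>"
begin

lemma one_in: "1 \<in> \<Gamma>"
  using surface subgroup.one_closed[of \<Gamma> PSL2R] by (simp add: surface_group_def PSL2R_def)

lemma mult_in: "a \<in> \<Gamma> \<Longrightarrow> b \<in> \<Gamma> \<Longrightarrow> a * b \<in> \<Gamma>"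
  using surface subgroup.m_closed[of \<Gamma> PSL2R a b] by (simp add: surface_group_def PSL2R_def)

definition ginv :: "psl2 \<Rightarrow> psl2" where "ginv a = inv\<^bsub>PSL2R\<^esub> a"

lemma ginv: "ginv a * a = 1" "a * ginv a = 1" "a \<in> \<Gamma> \<Longrightarrow> ginv a \<in> \<Gamma>"
  using surface subgroup.m_inv_closed[of \<Gamma> PSL2R a] group.l_inv[OF group_PSL2R, of a] group.r_inv[OF
    group_PSL2R, of a]
  by (simp_all add: surface_group_def PSL2R_def ginv_def)

lemma ginv_cancel [simp]: "ginv a * (a * b) = b" "a * (ginv a * b) = b" "b * ginv a * a = b" "b * a * ginv a = b"
  by (simp_all add: ginv mult.assoc[symmetric]) (simp_all add: ginv mult.assoc)

lemma isolated_identity: obtains U where "open U" "U \<inter> \<Gamma> = {1}"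
  using surface one_in by (auto simp: surface_group_def discrete_def isolated_in_def)

text \<open>The map sending (A, B) to the class of A B^-1 is continuous with value 1 at (G, G), so
  near that point it stays in a neighbourhood that isolates 1 in \<Gamma>.\<close>

lemma small_neighbourhood:
  assumes G: "det G = 1"
  obtains e where "e > 0" 
    "\<And>A B \<gamma>. A \<in> ball G e \<Longrightarrow> B \<in> ball G e \<Longrightarrow>
      det A = 1 \<Longrightarrow> det B = 1 \<Longrightarrow> \<gamma> \<in> \<Gamma> \<Longrightarrow> 
       \<gamma> * abs_psl2 B = abs_psl2 A \<Longrightarrow> \<gamma> = 1"
proof -
  obtain U where U: "open U" "U \<inter> \<Gamma> = {1}" by (rule isolated_identity)
  \<comment> \<open>The adjugate: the inverse on determinant 1, and visibly continuous.\<close>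
  define adj :: "mat2 \<Rightarrow> mat2" where "adj A = mat22 (A$2$2) (- A$1$2) (- A$2$1) (A$1$1)" for A
  have det_adj: "det (adj A) = det A" for A by (simp add: adj_def det_2)
  have adj: "A ** adj A = mat 1" if "det A = 1" for A
    using that by (simp add: adj_def mat2_eq_iff matrix_matrix_mult_def sum_2 det_2 mat_def algebra_simps)
  let ?S = "{A :: mat2. det A = 1} \<times> {A :: mat2. det A = 1}"
  have "continuous_on ?S (\<lambda>p. abs_psl2 (fst p ** adj (snd p)))"
    unfolding adj_def by (intro continuous_on_abs_psl2 continuous_intros)
      (auto simp: det_mul det_adj[unfolded adj_def, simplified])
  then obtain T where T: "open T" "T \<inter> ?S = (\<lambda>p. abs_psl2 (fst p ** adj (snd p))) -` U \<inter> ?S"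
    using U by (auto simp: continuous_on_open_invariant)
  have "(G, G) \<in> T \<inter> ?S"
    unfolding T(2) using G U by (auto simp: adj abs_psl2_one)
  then obtain e where e: "e > 0" "ball (G, G) e \<subseteq> T"
    using T(1) by (meson IntD1 open_contains_ball)
  show ?thesis
  proof (rule that[of "e/2"])
    fix A B \<gamma> assume *: "A \<in> ball G (e/2)" "B \<in> ball G (e/2)" "det A = 1" "det B = 1"
      "\<gamma> \<in> \<Gamma>" "\<gamma> * abs_psl2 B = abs_psl2 A"
    have "dist (G, G) (A, B) \<le> dist G A + dist G B"
      unfolding dist_Pair_Pair by (rule sqrt_sum_squares_le_sum_abs[THEN order_trans]) simp
    also have "\<dots> < e" using * by simp
    finally have "(A, B) \<in> T \<inter> ?S" using e * by auto
    then have "abs_psl2 (A ** adj B) \<in> U" unfolding T(2) by auto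
    also have "abs_psl2 (A ** adj B) = abs_psl2 A * abs_psl2 (adj B)"
      using * det_adj by (simp add: abs_psl2_mult)
    also have "\<dots> = \<gamma> * abs_psl2 (B ** adj B)"
      using * det_adj by (simp add: abs_psl2_mult[symmetric] mult.assoc flip: *(6))
    also have "\<dots> = \<gamma>" using * by (simp add: adj abs_psl2_one)
    finally show "\<gamma> = 1" using U * by blast
  qed (use e in auto)
qed

text \<open>Evenly covered open sets for the projection to SM, reduced to countably many by the
  Lindelof property of matrices. Both the countability of \<Gamma> and a Borel fundamental domain
  come from this cover.\<close>

lemma small_cover:
  obtains V :: "nat \<Rightarrow> psl2 set" where "\<And>n. open (V n)" "(\<Union>n. V n) = UNIV"
    "\<And>n \<gamma> v. \<gamma> \<in> \<Gamma> \<Longrightarrow> v \<in> V n \<Longrightarrow>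
      \<gamma> * v \<in> V n \<Longrightarrow> \<gamma> = 1"
proof -
  let ?SL = "{A :: mat2. det A = 1}"
  define Q where "Q G e \<longleftrightarrow> e > 0 \<and> (\<forall>A B \<gamma>. A
    \<in> ball G e \<longrightarrow> B \<in> ball G e \<longrightarrow> det A = 1 \<longrightarrow>
      det B = 1 \<longrightarrow> \<gamma> \<in> \<Gamma> \<longrightarrow>
       \<gamma> * abs_psl2 B = abs_psl2 A \<longrightarrow> \<gamma> = 1)" for G e
  have "\<exists>e. Q G e" if "det G = 1" for G
  proof (rule small_neighbourhood[OF that])
    fix e :: real assume e: "e > 0" "\<And>A B \<gamma>. A \<in> ball G e \<Longrightarrow>
      B \<in> ball G e \<Longrightarrow> det A = 1 \<Longrightarrow> det B = 1 \<Longrightarrow>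
        \<gamma> \<in> \<Gamma> \<Longrightarrow> 
       \<gamma> * abs_psl2 B = abs_psl2 A \<Longrightarrow> \<gamma> = 1"
    then have "Q G e" unfolding Q_def by blast
    then show ?thesis ..
  qed
  then obtain e where Q: "\<And>G. det G = 1 \<Longrightarrow> Q G (e G)" by metis
  have e: "\<And>G. det G = 1 \<Longrightarrow> e G > 0"
     "\<And>G A B \<gamma>. det G = 1 \<Longrightarrow> A \<in> ball G (e G) \<Longrightarrow>
       B \<in> ball G (e G) \<Longrightarrow> det A = 1 \<Longrightarrow> det B = 1 \<Longrightarrow>
         \<gamma> \<in> \<Gamma> \<Longrightarrow>
       \<gamma> * abs_psl2 B = abs_psl2 A \<Longrightarrow> \<gamma> = 1"
    using Q unfolding Q_def by blast+
  let ?F = "(\<lambda>G. ball G (e G)) ` ?SL"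
  obtain F' where F': "F' \<subseteq> ?F" "countable F'" "\<Union>F' = \<Union>?F"
    using Lindelof[of ?F] by (metis (no_types, lifting) imageE open_ball)
  obtain C where C: "C \<subseteq> ?SL" "countable C" "F' = (\<lambda>G. ball G (e G)) ` C"
    using F' countable_subset_image[of F' "\<lambda>G. ball G (e G)" ?SL] by auto
  have "mat 1 \<in> ball (mat 1) (e (mat 1))" "ball (mat 1) (e (mat 1)) \<in> ?F" using e(1)[of "mat 1"] by auto
  then have "mat 1 \<in> \<Union>F'" unfolding F'(3) by (rule UnionI[rotated])
  then have "C \<noteq> {}" unfolding C by blast
  define V where "V n = abs_psl2 ` (ball (from_nat_into C n) (e (from_nat_into C n)) \<inter> ?SL)" for n
  have inC: "from_nat_into C n \<in> C" for n using \<open>C \<noteq> {}\<close> by (rule from_nat_into)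
  show ?thesis
  proof (rule that[of V])
    fix n
    let ?G = "from_nat_into C n"
    \<comment> \<open>Openness in the quotient is tested on the full preimage, which contains both
      signs of each matrix.\<close>
    have "{A. det A = 1 \<and> abs_psl2 A \<in> V n} = ?SL \<inter> (ball ?G (e ?G) \<union> uminus ` ball ?G (e ?G))"
    proof (intro equalityI subsetI)
      fix A assume "A \<in> {A. det A = 1 \<and> abs_psl2 A \<in> V n}"
      then obtain B where B: "B \<in> ball ?G (e ?G)" "det B = 1" "abs_psl2 A = abs_psl2 B" "det A = 1"
        unfolding V_def by blast
      then have "A = B \<or> A = - B" by (simp add: abs_psl2_eq_iff)
      with B show "A \<in> ?SL \<inter> (ball ?G (e ?G) \<union> uminus ` ball ?G (e ?G))" by blast
    next
      fix A assume A: "A \<in> ?SL \<inter> (ball ?G (e ?G) \<union> uminus ` ball ?G (e ?G))"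
      then obtain B where B: "B \<in> ball ?G (e ?G)" "A = B \<or> A = - B" by blast
      then have "det B = 1" using A det_uminus_mat2[of B] by auto
      then have "abs_psl2 A = abs_psl2 B" using A B by (simp add: abs_psl2_eq_iff)
      then show "A \<in> {A. det A = 1 \<and> abs_psl2 A \<in> V n}"
        using A B \<open>det B = 1\<close> unfolding V_def by blast
    qed
    then show "open (V n)"
      by (intro open_psl2I[of "ball ?G (e ?G) \<union> uminus ` ball ?G (e ?G)"] open_Un open_negations open_ball)
    fix \<gamma> v assume \<gamma>: "\<gamma> \<in> \<Gamma>" and v: "v \<in> V n" "\<gamma> * v \<in> V n"
    from v obtain A B where "A \<in> ball ?G (e ?G)" "B \<in> ball ?G (e ?G)" "det A = 1" "det B = 1"
      "v = abs_psl2 B" "\<gamma> * v = abs_psl2 A"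
      unfolding V_def by auto
    then show "\<gamma> = 1" using e(2)[of ?G A B \<gamma>] inC[of n] C \<gamma> by auto
  next
    show "(\<Union>n. V n) = UNIV"
    proof (rule UNIV_eq_I[symmetric])
      fix g :: psl2
      obtain A where A: "det A = 1" "g = abs_psl2 A" by (rule psl2_cases)
      then have "A \<in> ball A (e A)" "ball A (e A) \<in> ?F" using e(1)[of A] by auto
      then have "A \<in> \<Union>F'" unfolding F'(3) by (rule UnionI[rotated])
      then obtain G where "G \<in> C" "A \<in> ball G (e G)" unfolding C by blast
      moreover obtain n where "from_nat_into C n = G" using C \<open>G \<in> C\<close> from_nat_into_surj by metis
      ultimately show "g \<in> (\<Union>n. V n)" using A by (auto simp: V_def intro!: exI[of _ n])
    qed
  qed
qed

text \<open>An evenly covered set holds at most one element of \<Gamma>, because two of them would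
  differ by a left factor from \<Gamma>.\<close>

lemma countable_group: "countable \<Gamma>"
proof -
  obtain V :: "nat \<Rightarrow> psl2 set" where V: "(\<Union>n. V n) = UNIV" 
    "\<And>n \<gamma> v. \<gamma> \<in> \<Gamma> \<Longrightarrow> v \<in> V n \<Longrightarrow>
      \<gamma> * v \<in> V n \<Longrightarrow> \<gamma> = 1"
    by (rule small_cover) metis
  obtain n where n: "\<And>\<gamma>. \<gamma> \<in> V (n \<gamma> :: nat)" using V(1) by (metis UNIV_I UN_iff)
  have "inj_on n \<Gamma>"
  proof (rule inj_onI)
    fix a b assume ab: "a \<in> \<Gamma>" "b \<in> \<Gamma>" "n a = n b"
    have "b * ginv a = 1"
      using V(2)[of "b * ginv a" a "n a"] ab n[of a] n[of b] by (simp add: mult_in ginv)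
    then have "b * ginv a * a = a" by simp
    then show "a = b" by simp
  qed
  then show ?thesis by (rule countableI)
qed

text \<open>From the n-th set of the cover only those points are kept whose orbit misses all earlier
  sets. An orbit then meets the union only at its least index, and there exactly once.\<close>

lemma fundamental_domain_exists: "\<exists>D. fundamental_domain \<Gamma> D"
proof -
  obtain V :: "nat \<Rightarrow> psl2 set" where V: "\<And>n. open (V n)" "(\<Union>n. V n) = UNIV" 
    "\<And>n \<gamma> v. \<gamma> \<in> \<Gamma> \<Longrightarrow> v \<in> V n \<Longrightarrow>
      \<gamma> * v \<in> V n \<Longrightarrow> \<gamma> = 1"
    by (rule small_cover) metis
  have V_borel [measurable]: "V n \<in> sets borel" for n using V(1) by auto
  define W where "W n = V n - (\<Union>m<n. \<Union>\<gamma>\<in>\<Gamma>. (\<lambda>g. \<gamma> * g) -` V m)" for n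
  have "(\<lambda>g. \<gamma> * g) -` V m \<in> sets borel" for \<gamma> m
    using measurable_sets[OF borel_measurable_psl2_mult(1) V_borel, of \<gamma>] by simp
  then have "(\<Union>\<gamma>\<in>\<Gamma>. (\<lambda>g. \<gamma> * g) -` V m) \<in> sets borel" for m
    using countable_group by (intro sets.countable_UN') auto
  then have "(\<Union>m<n. \<Union>\<gamma>\<in>\<Gamma>. (\<lambda>g. \<gamma> * g) -` V m) \<in> sets borel"
    for n :: nat
    by (rule sets.finite_UN[OF finite_lessThan])
  then have "W n \<in> sets borel" for n
    unfolding W_def by (intro sets.Diff V_borel)
  then have "(\<Union>n. W n) \<in> sets borel"
    by (intro sets.countable_UN) auto
  moreover have "\<exists>!\<gamma>. \<gamma> \<in> \<Gamma> \<and> \<gamma> * g \<in> (\<Union>n. W n)" for g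
  proof -
    define n where "n = (LEAST n. \<exists>\<gamma>\<in>\<Gamma>. \<gamma> * g \<in> V n)"
    obtain k where "1 * g \<in> V k" using V(2) by (metis UNIV_I UN_iff)
    then have "\<exists>n. \<exists>\<gamma>\<in>\<Gamma>. \<gamma> * g \<in> V n" using one_in by blast
    from LeastI_ex[OF this] obtain \<gamma> where \<gamma>: "\<gamma> \<in> \<Gamma>"
      "\<gamma> * g \<in> V n" unfolding n_def by blast
    have least: "\<gamma>' * g \<notin> V m" if "m < n" "\<gamma>' \<in> \<Gamma>" for m \<gamma>'
      using not_less_Least[of m "\<lambda>n. \<exists>\<gamma>\<in>\<Gamma>. \<gamma> * g \<in> V n"] that
        unfolding n_def by blast
    have "\<gamma> * g \<in> W n"
      unfolding W_def using \<gamma> least by (auto simp: mult.assoc[symmetric] mult_in)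
    moreover have "\<gamma>' = \<gamma>" if "\<gamma>' \<in> \<Gamma>" "\<gamma>' * g \<in> W n'" for \<gamma>' n'
    proof -
      have n': "n' = n"
      proof (rule linorder_cases[of n' n])
        assume "n < n'"
        have "(\<gamma> * ginv \<gamma>') * (\<gamma>' * g) \<in> V n" using \<gamma> by (simp add: mult.assoc)
        moreover have "\<gamma> * ginv \<gamma>' \<in> \<Gamma>" using \<gamma> that by (simp add: mult_in ginv)
        ultimately have "\<gamma>' * g \<in> (\<Union>\<gamma>\<in>\<Gamma>. (\<lambda>g. \<gamma> * g) -` V
          n)" by blast
        then have "\<gamma>' * g \<notin> W n'" using \<open>n < n'\<close> unfolding W_def by blast
        with that show ?thesis by simp
      next
        assume "n' < n"
        with least[of n' \<gamma>'] that show ?thesis by (auto simp: W_def)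
      qed
      have "\<gamma>' * ginv \<gamma> = 1"
      proof (rule V(3)[of _ "\<gamma> * g" n])
        show "\<gamma>' * ginv \<gamma> \<in> \<Gamma>" using \<gamma> that by (simp add: mult_in ginv)
        show "\<gamma>' * ginv \<gamma> * (\<gamma> * g) \<in> V n" using that n' by (auto simp: W_def mult.assoc)
      next
        show "\<gamma> * g \<in> V n" by (rule \<gamma>)
      qed
      then have "\<gamma>' * ginv \<gamma> * \<gamma> = \<gamma>" by simp
      then show ?thesis by simp
    qed
    ultimately show ?thesis using \<gamma> by blast
  qed
  ultimately show ?thesis unfolding fundamental_domain_def by blast
qed

text \<open>The Borel sets of SM, seen upstairs: a measure on this sigma-algebra is a measure on the
  quotient, without a type for the quotient.\<close>

definition inv_sets :: "psl2 set set" where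
  "inv_sets = {E \<in> sets borel. \<forall>\<gamma>\<in>\<Gamma>. \<forall>g. \<gamma> * g
    \<in> E \<longleftrightarrow> g \<in> E}"

lemma sigma_algebra_inv_sets: "sigma_algebra UNIV inv_sets"
proof (rule sigma_algebra_iff2[THEN iffD2], intro conjI ballI allI impI)
  fix A :: "nat \<Rightarrow> psl2 set" assume "range A \<subseteq> inv_sets"
  then have "A i \<in> inv_sets" for i by auto
  then show "(\<Union>i. A i) \<in> inv_sets" by (fastforce simp: inv_sets_def)
qed (auto simp: inv_sets_def)

text \<open>The push-forward under the identity only coarsens the sigma-algebra; on invariant sets
  the choice of the domain will no longer matter.\<close>

definition SM_of :: "psl2 set \<Rightarrow> psl2 measure" where
  "SM_of D = distr (restrict_space haar D) (sigma UNIV inv_sets) (\<lambda>x. x)"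

lemma sets_SM_of [simp]: "sets (SM_of D) = inv_sets" and space_SM_of [simp]: "space (SM_of D) = UNIV"
  using sigma_algebra.sets_measure_of_eq[OF sigma_algebra_inv_sets] by (simp_all add: SM_of_def)

lemma measurable_SM_of:
  assumes "D \<in> sets borel"
  shows "(\<lambda>x. x) \<in> restrict_space haar D \<rightarrow>\<^sub>M sigma UNIV inv_sets"
proof (rule measurableI)
  fix A assume "A \<in> sets (sigma UNIV inv_sets)"
  then have "A \<in> sets borel"
    using sigma_algebra.sets_measure_of_eq[OF sigma_algebra_inv_sets] by (auto simp: inv_sets_def)
  then show "(\<lambda>x. x) -` A \<inter> space (restrict_space haar D) \<in> sets (restrict_space haar D)"
    using assms by (auto simp: space_restrict_space sets_restrict_space)
qed auto

lemma emeasure_SM_of: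
  assumes "D \<in> sets borel" "E \<in> inv_sets"
  shows "emeasure (SM_of D) E = emeasure haar (E \<inter> D)"
  unfolding SM_of_def using assms sigma_algebra.sets_measure_of_eq[OF sigma_algebra_inv_sets]
  by (subst emeasure_distr[OF measurable_SM_of])
     (auto simp: space_restrict_space emeasure_restrict_space Int_commute Int_left_commute intro!:
       arg_cong2[where f=emeasure])

lemma fundamental_domainD:
  assumes "fundamental_domain \<Gamma> D"
  shows "D \<in> sets borel" and "\<exists>\<gamma>\<in>\<Gamma>. \<gamma> * g \<in> D"
    and "\<gamma> \<in> \<Gamma> \<Longrightarrow> \<gamma>' \<in> \<Gamma> \<Longrightarrow>
      \<gamma> * g \<in> D \<Longrightarrow> \<gamma>' * g \<in> D \<Longrightarrow> \<gamma> = \<gamma>'"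
  using assms unfolding fundamental_domain_def by blast+

lemma vimage_mult_borel: "E \<in> sets borel \<Longrightarrow>
  (\<lambda>g :: psl2. a * g) -` E \<in> sets borel" "E \<in> sets borel \<Longrightarrow>
    (\<lambda>g :: psl2. g * a) -` E \<in> sets borel"
  using measurable_sets[OF borel_measurable_psl2_mult(1), of E a] measurable_sets[OF
    borel_measurable_psl2_mult(2), of E a] by auto

lemma emeasure_split:
  assumes D: "fundamental_domain \<Gamma> D" and B: "B \<in> sets borel"
  shows "emeasure haar B = (\<integral>\<^sup>+\<gamma>. emeasure haar (B \<inter> (\<lambda>g. \<gamma> * g)
    -` D) \<partial>count_space \<Gamma>)"
proof -
  have "B = (\<Union>\<gamma>\<in>\<Gamma>. B \<inter> (\<lambda>g. \<gamma> * g) -` D)"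
    using fundamental_domainD(2)[OF D] by auto
  also have "emeasure haar \<dots> = (\<integral>\<^sup>+\<gamma>. emeasure haar (B \<inter> (\<lambda>g.
    \<gamma> * g) -` D) \<partial>count_space \<Gamma>)"
    using countable_group B fundamental_domainD(1)[OF D] fundamental_domainD(3)[OF D]
    by (intro emeasure_UN_countable) (auto simp: disjoint_family_on_def intro!: sets.Int vimage_mult_borel)
  finally show ?thesis .
qed

text \<open>Left translation by \<gamma> carries each piece of the domain onto a piece of
  \<open>B\<close>; inverting the summation index then gives \<open>emeasure_split\<close>.\<close>

lemma emeasure_swap:
  assumes D: "fundamental_domain \<Gamma> D" and B: "B \<in> sets borel"
  shows "(\<integral>\<^sup>+\<gamma>. emeasure haar (D \<inter> (\<lambda>g. \<gamma> * g) -` B)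
    \<partial>count_space \<Gamma>) = emeasure haar B"
proof -
  have bij: "bij_betw ginv \<Gamma> \<Gamma>"
    by (rule bij_betw_byWitness[where f' = ginv])
       (use ginv group.inv_inv[OF group_PSL2R] in \<open>auto simp: ginv_def PSL2R_def\<close>)
  have "(\<integral>\<^sup>+\<gamma>. emeasure haar (D \<inter> (\<lambda>g. \<gamma> * g) -` B)
    \<partial>count_space \<Gamma>)
      = (\<integral>\<^sup>+\<gamma>. emeasure haar (B \<inter> (\<lambda>g. ginv \<gamma> * g) -` D)
        \<partial>count_space \<Gamma>)"
  proof (intro nn_integral_cong)
    fix \<gamma>
    have "D \<inter> (\<lambda>g. \<gamma> * g) -` B = (\<lambda>g. \<gamma> * g) -` (B \<inter> (\<lambda>g.
      ginv \<gamma> * g) -` D)"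
      by auto
    then show "emeasure haar (D \<inter> (\<lambda>g. \<gamma> * g) -` B)
      = emeasure haar (B \<inter> (\<lambda>g. ginv \<gamma> * g) -` D)"
      using emeasure_haar_mult(1)[of "B \<inter> (\<lambda>g. ginv \<gamma> * g) -` D" \<gamma>] B
        vimage_mult_borel(1)[OF fundamental_domainD(1)[OF D]]
      by auto
  qed
  also have "\<dots> = (\<integral>\<^sup>+\<gamma>. emeasure haar (B \<inter> (\<lambda>g. \<gamma> * g) -` D)
    \<partial>count_space \<Gamma>)"
    using nn_integral_bij_count_space[OF bij, of "\<lambda>\<gamma>. emeasure haar (B \<inter> (\<lambda>g.
      \<gamma> * g) -` D)"] .
  finally show ?thesis using emeasure_split[OF D B] by simp
qed

text \<open>Cut the part of an invariant set in one domain by the translates of the other and move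
  the pieces back. This makes the choice by \<open>SOME\<close> in \<open>SM_integral\<close>
  immaterial.\<close>

lemma SM_of_indep:
  assumes D: "fundamental_domain \<Gamma> D" and D': "fundamental_domain \<Gamma> D'"
  shows "SM_of D = SM_of D'"
proof (rule measure_eqI)
  fix E assume "E \<in> sets (SM_of D)"
  then have E: "E \<in> inv_sets" by simp
  then have Eb: "E \<in> sets borel" and Einv: "\<And>\<gamma> g. \<gamma> \<in> \<Gamma> \<Longrightarrow>
    \<gamma> * g \<in> E \<longleftrightarrow> g \<in> E" by (auto simp: inv_sets_def)
  note b = fundamental_domainD(1)[OF D] fundamental_domainD(1)[OF D']
  have "emeasure haar (E \<inter> D) = (\<integral>\<^sup>+\<gamma>. emeasure haar ((E \<inter> D) \<inter>
    (\<lambda>g. \<gamma> * g) -` D') \<partial>count_space \<Gamma>)"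
    using Eb b by (intro emeasure_split[OF D']) auto
  also have "\<dots> = (\<integral>\<^sup>+\<gamma>. emeasure haar (D \<inter> (\<lambda>g. \<gamma> * g) -` (E
    \<inter> D')) \<partial>count_space \<Gamma>)"
    using Einv by (intro nn_integral_cong arg_cong[where f="emeasure haar"]) auto
  also have "\<dots> = emeasure haar (E \<inter> D')"
    using Eb b by (intro emeasure_swap[OF D]) auto
  finally show "emeasure (SM_of D) E = emeasure (SM_of D') E"
    using E b by (simp add: emeasure_SM_of)
qed simp

definition M :: "psl2 measure" where "M = SM_of (SOME D. fundamental_domain \<Gamma> D)"

lemma M_eq: "fundamental_domain \<Gamma> D \<Longrightarrow> M = SM_of D"
  unfolding M_def by (rule SM_of_indep) (metis someI_ex fundamental_domain_exists)

lemma sets_M [simp]: "sets M = inv_sets" and space_M [simp]: "space M = UNIV"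
  by (simp_all add: M_def)

lemma emeasure_M: "fundamental_domain \<Gamma> D \<Longrightarrow> E \<in> inv_sets \<Longrightarrow>
  emeasure M E = emeasure haar (E \<inter> D)"
  using emeasure_SM_of fundamental_domainD(1) M_eq by metis

text \<open>Points are closed in a T1 space, so level sets of a function measurable for
  \<open>M\<close> are invariant sets, and the function itself is invariant.\<close>

lemma measurable_M_iff:
  "f \<in> borel_measurable M \<longleftrightarrow> (f \<in> borel_measurable borel
    \<and> (\<forall>\<gamma>\<in>\<Gamma>. \<forall>g. f (\<gamma> * g) = f g))" 
  for f :: "psl2 \<Rightarrow> 'a::t1_space"
proof (intro iffI conjI ballI allI)
  assume f: "f \<in> borel_measurable M"
  then show "f \<in> borel_measurable borel"
    by (auto simp: measurable_def inv_sets_def)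
  fix \<gamma> g assume "\<gamma> \<in> \<Gamma>"
  have "f -` {f g} \<inter> space M \<in> sets M" using f by (rule measurable_sets) simp
  then show "f (\<gamma> * g) = f g" using \<open>\<gamma> \<in> \<Gamma>\<close> by (auto simp: inv_sets_def)
qed (auto simp: measurable_def inv_sets_def)

lemma mult_measurable_M [measurable]: "(\<lambda>g. g * a) \<in> M \<rightarrow>\<^sub>M M"
  by (rule measurableI) (auto simp: inv_sets_def mult.assoc vimage_mult_borel)

text \<open>Right translation commutes with the left action of \<Gamma>, hence carries a fundamental
  domain to another one; independence of the domain and right invariance of \<open>haar\<close> do
  the rest. In particular the geodesic flow preserves \<open>M\<close>.\<close>

lemma distr_M_mult: "distr M M (\<lambda>g. g * a) = M"
proof (rule measure_eqI)
  fix E assume "E \<in> sets (distr M M (\<lambda>g. g * a))"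
  then have E: "E \<in> inv_sets" by simp
  obtain D where D: "fundamental_domain \<Gamma> D" using fundamental_domain_exists ..
  have D': "fundamental_domain \<Gamma> ((\<lambda>g. g * ginv a) -` D)"
    using D unfolding fundamental_domain_def by (auto simp: mult.assoc vimage_mult_borel)
  have aE: "(\<lambda>g. g * a) -` E \<in> inv_sets"
    using E by (auto simp: inv_sets_def vimage_mult_borel mult.assoc)
  have "emeasure (distr M M (\<lambda>g. g * a)) E = emeasure M ((\<lambda>g. g * a) -` E)"
    using E by (subst emeasure_distr) auto
  also have "\<dots> = emeasure haar ((\<lambda>g. g * a) -` E \<inter> D)" using D aE by (simp add: emeasure_M)
  also have "(\<lambda>g. g * a) -` E \<inter> D = (\<lambda>g. g * a) -` (E \<inter> (\<lambda>g. g * ginv a)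
    -` D)" by auto
  also have "emeasure haar \<dots> = emeasure haar (E \<inter> (\<lambda>g. g * ginv a) -` D)"
    using E fundamental_domainD(1)[OF D'] by (intro emeasure_haar_mult(2)) (auto simp: inv_sets_def)
  also have "\<dots> = emeasure M E" using D' E by (simp add: emeasure_M)
  finally show "emeasure (distr M M (\<lambda>g. g * a)) E = emeasure M E" .
qed simp

lemma integral_M_mult:
  fixes F :: "psl2 \<Rightarrow> 'a::{banach,second_countable_topology}"
  assumes "F \<in> borel_measurable M"
  shows "(\<integral>g. F (g * a) \<partial>M) = (\<integral>g. F g \<partial>M)"
    and "integrable M (\<lambda>g. F (g * a)) \<longleftrightarrow> integrable M F"
  using integral_distr[OF mult_measurable_M assms, of a] integrable_distr_eq[OF mult_measurable_M assms, of a]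
  by (simp_all add: distr_M_mult)

lemma size_supp_inv_sets: "size_supp \<Gamma> r \<in> inv_sets"
proof -
  have "size_supp \<Gamma> r = (\<Union>\<gamma>\<in>\<Gamma>. (\<lambda>g. \<gamma> * g) -` {g. psl2_size g
    \<le> r})" by (auto simp: size_supp_def)
  also have "\<dots> \<in> sets borel"
    using countable_group by (intro sets.countable_UN' vimage_mult_borel) auto
  finally have "size_supp \<Gamma> r \<in> sets borel" .
  moreover have "\<gamma> * g \<in> size_supp \<Gamma> r \<longleftrightarrow>
    g \<in> size_supp \<Gamma> r" if "\<gamma> \<in> \<Gamma>" for \<gamma> g
  proof
    assume "\<gamma> * g \<in> size_supp \<Gamma> r"
    then obtain \<gamma>' where "\<gamma>' \<in> \<Gamma>" "psl2_size (\<gamma>' * \<gamma> * g) \<le> r"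
      by (auto simp: size_supp_def mult.assoc)
    then show "g \<in> size_supp \<Gamma> r" using that mult_in unfolding size_supp_def by blast
  next
    assume "g \<in> size_supp \<Gamma> r"
    then obtain \<gamma>' where "\<gamma>' \<in> \<Gamma>" "psl2_size (\<gamma>' * g) \<le> r"
      by (auto simp: size_supp_def)
    then have "\<gamma>' * ginv \<gamma> \<in> \<Gamma>" "psl2_size ((\<gamma>' * ginv \<gamma>) * (\<gamma> *
      g)) \<le> r"
      using that by (auto simp: mult.assoc mult_in ginv)
    then show "\<gamma> * g \<in> size_supp \<Gamma> r" unfolding size_supp_def by blast
  qed
  ultimately show ?thesis by (auto simp: inv_sets_def)
qed

text \<open>On a fundamental domain the indicator of the saturation is at most the sum of the
  indicators of all translates of the ball, and these pieces reassemble the ball itself.\<close>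

lemma emeasure_size_supp: "emeasure M (size_supp \<Gamma> r) < \<infinity>"
proof -
  obtain D where D: "fundamental_domain \<Gamma> D" using fundamental_domain_exists ..
  have b: "D \<in> sets borel" by (rule fundamental_domainD(1)[OF D])
  define B where "B = {g. psl2_size g \<le> r}"
  have B: "B \<in> sets borel" unfolding B_def by measurable
  have s: "size_supp \<Gamma> r \<in> sets borel" using size_supp_inv_sets by (auto simp: inv_sets_def)
  have "emeasure M (size_supp \<Gamma> r) = emeasure haar (size_supp \<Gamma> r \<inter> D)"
    by (rule emeasure_M[OF D size_supp_inv_sets])
  also have "\<dots> = (\<integral>\<^sup>+g. indicator (size_supp \<Gamma> r \<inter> D) g \<partial>haar)"
    using b s by (subst nn_integral_indicator) auto
  also have "\<dots> \<le> (\<integral>\<^sup>+g. \<integral>\<^sup>+\<gamma>. indicator (D \<inter>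
    (\<lambda>g. \<gamma> * g) -` B) g \<partial>count_space \<Gamma> \<partial>haar)"
  proof (intro nn_integral_mono)
    fix g
    show "indicator (size_supp \<Gamma> r \<inter> D) g \<le> (\<integral>\<^sup>+\<gamma>. indicator (D
      \<inter> (\<lambda>g. \<gamma> * g) -` B) g \<partial>count_space \<Gamma>)"
    proof (cases "g \<in> size_supp \<Gamma> r \<inter> D")
      case True
      then obtain \<gamma> where \<gamma>: "\<gamma> \<in> \<Gamma>"
        "\<gamma> * g \<in> B" by (auto simp: size_supp_def B_def)
      have "indicator (size_supp \<Gamma> r \<inter> D) g = indicator (D \<inter> (\<lambda>g. \<gamma> * g) -` B) g"
        using True \<gamma> by simp
      also have "\<dots> \<le> (\<integral>\<^sup>+\<gamma>. indicator (D \<inter> (\<lambda>g. \<gamma> * g)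
        -` B) g \<partial>count_space \<Gamma>)"
        using \<gamma>(1) by (rule nn_integral_ge_point)
      finally show ?thesis .
    qed simp
  qed
  also have "\<dots> = (\<integral>\<^sup>+\<gamma>. \<integral>\<^sup>+g. indicator (D \<inter> (\<lambda>g.
    \<gamma> * g) -` B) g \<partial>haar \<partial>count_space \<Gamma>)"
    using countable_group b vimage_mult_borel(1)[OF B]
    by (intro nn_integral_count_space_nn_integral) (auto intro!: borel_measurable_indicator)
  also have "\<dots> = (\<integral>\<^sup>+\<gamma>. emeasure haar (D \<inter> (\<lambda>g. \<gamma> * g) -` B)
    \<partial>count_space \<Gamma>)"
    using b vimage_mult_borel(1)[OF B] by (intro nn_integral_cong nn_integral_indicator) auto
  also have "\<dots> = emeasure haar B" by (rule emeasure_swap[OF D B])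
  also have "\<dots> < \<infinity>" unfolding B_def by (rule emeasure_haar_psl2_size)
  finally show ?thesis .
qed

text \<open>The saturations of balls exhaust the group; this opens the way to Fubini on the product
  of time and SM.\<close>

lemma sigma_finite_M: "sigma_finite_measure M"
proof
  let ?A = "(\<lambda>n::nat. size_supp \<Gamma> (real n)) ` UNIV"
  have "(\<Union>n::nat. size_supp \<Gamma> (real n)) = UNIV"
  proof (rule UNIV_eq_I[symmetric])
    fix g
    obtain n where "psl2_size g \<le> real n" using real_arch_simple by blast
    then have "psl2_size (1 * g) \<le> real n" by simp
    then show "g \<in> (\<Union>n::nat. size_supp \<Gamma> (real n))" unfolding size_supp_def using one_in by blast
  qed
  then show "\<exists>A. countable A \<and> A \<subseteq> sets M \<and> \<Union>A = space M
    \<and> (\<forall>a\<in>A. emeasure M a \<noteq> \<infinity>)"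
    using emeasure_size_supp size_supp_inv_sets by (intro exI[of _ ?A]) (auto simp: less_top)
qed

lemma SM_integral_eq:
  assumes "F \<in> borel_measurable M"
  shows "SM_integral \<Gamma> F = (\<integral>g. F g \<partial>M)"
proof -
  let ?D = "SOME D. fundamental_domain \<Gamma> D"
  have D: "fundamental_domain \<Gamma> ?D" using fundamental_domain_exists by (rule someI_ex)
  have b: "?D \<in> sets borel" by (rule fundamental_domainD(1)[OF D])
  have F: "F \<in> borel_measurable (sigma UNIV inv_sets)"
    using assms sigma_algebra.sets_measure_of_eq[OF sigma_algebra_inv_sets]
    by (simp add: measurable_def)
  have "(\<integral>g. F g \<partial>M) = (\<integral>g. F g \<partial>restrict_space haar ?D)"
    unfolding M_def SM_of_def by (rule integral_distr[OF measurable_SM_of[OF b] F])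
  also have "\<dots> = SM_integral \<Gamma> F"
    unfolding SM_integral_def set_lebesgue_integral_def using b by (subst integral_restrict_space) auto
  finally show ?thesis by simp
qed

lemma test_fun_measurable:
  assumes "f \<in> test_fun \<Gamma>" shows "f \<in> borel_measurable M"
  unfolding measurable_M_iff using assms
  by (auto simp: test_fun_invariant intro!: borel_measurable_continuous_onI smoothD(1))

lemma integrable_bounded_supp:
  fixes F :: "psl2 \<Rightarrow> 'a::{banach,second_countable_topology}"
  assumes F: "F \<in> borel_measurable M" "\<And>g. norm (F g) \<le> C"
    "\<And>g. F g \<noteq> 0 \<Longrightarrow> g \<in> size_supp \<Gamma> r"
  shows "integrable M F"
proof (rule Bochner_Integration.integrable_bound)
  show "integrable M (\<lambda>g. C * indicator (size_supp \<Gamma> r) g)"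
    using emeasure_size_supp[of r] size_supp_inv_sets[of r]
    by (intro integrable_mult_right integrable_real_indicator) auto
  show "AE g in M. norm (F g) \<le> norm (C * indicator (size_supp \<Gamma> r) g :: real)"
  proof (intro always_eventually allI)
    fix g
    have "C \<ge> 0" using order_trans[OF norm_ge_zero F(2)] .
    then show "norm (F g) \<le> norm (C * indicator (size_supp \<Gamma> r) g :: real)"
      using F(2)[of g] F(3)[of g] by (cases "F g = 0") auto
  qed
qed (rule F)

end

section \<open>Correlations and the resolvent in the half-plane\<close>

lemma integrable_exp_decay:
  fixes a :: real assumes "a > 0"
  shows "has_bochner_integral lborel (\<lambda>t. indicator {0..} t * exp (- a * t)) (1 / a)"
proof (rule has_bochner_integral_nn_integral)
  have "((\<lambda>t. - exp (- a * t) / a) \<longlongrightarrow> 0) at_top"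
    using assms by real_asymp
  then have "(\<integral>\<^sup>+ t. ennreal (exp (- a * t)) * indicator {0..} t \<partial>lborel) = ennreal (0
    - (- exp (- a * 0) / a))"
    using assms by (intro nn_integral_FTC_atLeast) (auto intro!: derivative_eq_intros)
  then show "(\<integral>\<^sup>+ t. ennreal (indicator {0..} t * exp (- a * t)) \<partial>lborel) = ennreal (1 / a)"
    by (simp add: ennreal_mult' ennreal_indicator mult.commute)
qed (use assms in auto)

lemma integral_FTC_atLeast_0:
  fixes f F :: "real \<Rightarrow> complex"
  assumes F: "\<And>x. (F has_vector_derivative f x) (at x)" and f: "continuous_on UNIV f"
    and int: "set_integrable lborel {0..} f" and lim: "(F \<longlongrightarrow> 0) at_top"
  shows "(LINT x:{0..}|lborel. f x) = - F 0"
proof -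
  have "(LBINT x=ereal 0..\<infinity>. f x) = 0 - F 0"
  proof (rule interval_integral_FTC_integrable)
    show "set_integrable lborel (einterval (ereal 0) \<infinity>) f"
      by (rule set_integrable_subset[OF int]) (auto simp: einterval_def)
    have "continuous (at 0) F" using F has_vector_derivative_continuous by blast
    then have "(F \<longlongrightarrow> F 0) (at_right 0)"
      by (meson continuous_at filterlim_at_split)
    then show "((F \<circ> real_of_ereal) \<longlongrightarrow> F 0) (at_right (ereal 0))"
      by (simp add: at_right_ereal filterlim_filtermap o_def)
    show "((F \<circ> real_of_ereal) \<longlongrightarrow> 0) (at_left \<infinity>)"
      using lim by (simp add: at_left_PInf filterlim_filtermap o_def)
  qed (use F f in \<open>auto simp: continuous_on_eq_continuous_at\<close>)
  then have "(LINT x:{0<..}|lborel. f x) = - F 0"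
    by (simp add: interval_integral_to_infinity_eq)
  moreover have "(LINT x:{0<..}|lborel. f x) = (LINT x:{0..}|lborel. f x)"
    unfolding set_lebesgue_integral_def
  proof (rule integral_cong_AE)
    have [measurable]: "f \<in> borel_measurable borel" by (rule borel_measurable_continuous_onI[OF f])
    show "(\<lambda>x. indicator {0<..} x *\<^sub>R f x) \<in> borel_measurable lborel"
      "(\<lambda>x. indicator {0..} x *\<^sub>R f x) \<in> borel_measurable lborel"
      by measurable
    have "AE x in lborel. x \<noteq> (0::real)" by (rule AE_lborel_singleton)
    then show "AE x in lborel. indicator {0<..} x *\<^sub>R f x = indicator {0..} x *\<^sub>R f x"
      by eventually_elim (auto simp: indicator_def)
  qed
  ultimately show ?thesis by simp
qed

text \<open>A Caratheodory function: rounding t down to multiples of 1/(n+1) leaves countably many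
  measurable slices, and continuity in t gives the limit.\<close>

lemma joint_measurable:
  fixes F :: "real \<Rightarrow> 'a \<Rightarrow> complex"
  assumes cont: "\<And>g. continuous_on UNIV (\<lambda>t. F t g)" and meas: "\<And>t. F t \<in> borel_measurable N"
  shows "(\<lambda>p. F (fst p) (snd p)) \<in> borel_measurable (lborel \<Otimes>\<^sub>M N)"
proof (rule borel_measurable_LIMSEQ_metric)
  let ?s = "\<lambda>(n::nat) t. real_of_int \<lfloor>t * real (Suc n)\<rfloor> / real (Suc n)"
  fix n
  have "(\<lambda>p. F (real_of_int i / real (Suc n)) (snd p))
    \<in> borel_measurable (lborel \<Otimes>\<^sub>M N)" for i :: int
    using meas by measurable
  moreover have "(\<lambda>p. \<lfloor>fst p * real (Suc n)\<rfloor>)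
    \<in> lborel \<Otimes>\<^sub>M N \<rightarrow>\<^sub>M count_space UNIV"
    by measurable
  ultimately show "(\<lambda>p. F (?s n (fst p)) (snd p)) \<in> borel_measurable (lborel \<Otimes>\<^sub>M N)"
    by (rule measurable_compose_countable)
next
  let ?s = "\<lambda>(n::nat) t. real_of_int \<lfloor>t * real (Suc n)\<rfloor> / real (Suc n)"
  fix p :: "real \<times> 'a" assume "p \<in> space (lborel \<Otimes>\<^sub>M N)"
  have "(\<lambda>n. ?s n (fst p)) \<longlonglongrightarrow> fst p" by real_asymp
  moreover have "isCont (\<lambda>t. F t (snd p)) (fst p)" using cont by (simp add: continuous_on_eq_continuous_at)
  ultimately show "(\<lambda>n. F (?s n (fst p)) (snd p)) \<longlonglongrightarrow> F (fst p) (snd p)"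
    using isCont_tendsto_compose[of "fst p" "\<lambda>t. F t (snd p)"] by simp
qed

lemma vector_derivative_quotient_limit:
  fixes p :: "real \<Rightarrow> 'a::real_normed_vector"
  assumes "(p has_vector_derivative d) (at 0)"
  shows "((\<lambda>t. (1 / t) *\<^sub>R (p t - p 0)) \<longlongrightarrow> d) (at 0)"
proof -
  have "((\<lambda>h. norm (p (0 + h) - p 0 - h *\<^sub>R d) / norm h) \<longlongrightarrow> 0) (at 0)"
    using assms unfolding has_vector_derivative_def has_derivative_at by blast
  then have "((\<lambda>h. norm ((1 / h) *\<^sub>R (p h - p 0) - d)) \<longlongrightarrow> 0) (at 0)"
  proof (rule Lim_transform_eventually)
    have "norm (p (0 + h) - p 0 - h *\<^sub>R d) / norm h = norm ((1 / h) *\<^sub>R (p h - p 0)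
      - d)" if "h \<noteq> 0" for h
    proof -
      have "(1 / h) *\<^sub>R (p h - p 0) - d = (1 / h) *\<^sub>R (p h - p 0 - h *\<^sub>R d)"
        using that by (simp add: scaleR_diff_right)
      then show ?thesis by simp
    qed
    then show "\<forall>\<^sub>F h in at 0. norm (p (0 + h) - p 0 - h *\<^sub>R d) / norm h
      = norm ((1 / h) *\<^sub>R (p h - p 0) - d)"
      by (auto simp: eventually_at_filter)
  qed
  then show ?thesis by (simp add: tendsto_norm_zero_iff LIM_zero_iff)
qed

context surface
begin

text \<open>Bilinear, without conjugation, in accordance with the pairing of distributions and test
  functions.\<close>

definition corr :: "(psl2 \<Rightarrow> complex) \<Rightarrow> (psl2 \<Rightarrow> complex) \<Rightarrow> real
  \<Rightarrow> complex" where
  "corr f \<psi> t = (\<integral>g. flow_pull (- t) f g * \<psi> g \<partial>M)"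

definition energy :: "(psl2 \<Rightarrow> complex) \<Rightarrow> real" where
  "energy f = (\<integral>g. (norm (f g))\<^sup>2 \<partial>M)"

lemma test_fun_sup:
  assumes "f \<in> test_fun \<Gamma>" "h \<in> test_fun \<Gamma>"
  obtains r where "r \<ge> 0" "\<And>g. f g \<noteq> 0 \<or> h g \<noteq> 0 \<Longrightarrow>
    g \<in> size_supp \<Gamma> r"
proof -
  obtain r where r: "r \<ge> 0" "\<And>g. f g \<noteq> 0 \<Longrightarrow>
    g \<in> size_supp \<Gamma> r" using test_fun_supp assms by blast
  obtain s where s: "s \<ge> 0" "\<And>g. h g \<noteq> 0 \<Longrightarrow>
    g \<in> size_supp \<Gamma> s" using test_fun_supp assms by blast
  show ?thesis
    by (rule that[of "max r s"])
       (use r s size_supp_mono[of r "max r s" \<Gamma>] size_supp_mono[of s "max r s" \<Gamma>] in auto)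
qed

lemma integrable_mult_test:
  assumes F: "F \<in> borel_measurable M" "\<And>g. norm (F g) \<le> C" and \<psi>: "\<psi> \<in> test_fun \<Gamma>"
  shows "integrable M (\<lambda>g. F g * \<psi> g :: complex)"
proof -
  obtain r where r: "r \<ge> 0" "\<And>g. \<psi> g \<noteq> 0 \<Longrightarrow>
    g \<in> size_supp \<Gamma> r" using test_fun_supp \<psi> by blast
  obtain B where B: "B \<ge> 0" "\<And>g. norm (\<psi> g) \<le> B" using test_fun_bounded \<psi> by blast
  have "C \<ge> 0" using order_trans[OF norm_ge_zero F(2)] .
  show ?thesis
  proof (rule integrable_bounded_supp)
    show "norm (F g * \<psi> g) \<le> C * B" for g
      using F(2) B \<open>C \<ge> 0\<close> by (simp add: norm_mult mult_mono)
    show "(\<lambda>g. F g * \<psi> g) \<in> borel_measurable M"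
      using F(1) test_fun_measurable[OF \<psi>] by simp
  qed (use r in auto)
qed

lemma integrable_test_mult: "f \<in> test_fun \<Gamma> \<Longrightarrow>
  \<psi> \<in> test_fun \<Gamma> \<Longrightarrow> integrable M (\<lambda>g. f g * \<psi> g)"
  using test_fun_bounded test_fun_measurable integrable_mult_test by metis

lemma integrable_energy: 
  assumes "f \<in> test_fun \<Gamma>" shows "integrable M (\<lambda>g. (norm (f g))\<^sup>2)"
  using integrable_norm[OF integrable_test_mult[OF assms assms]]
  by (simp add: norm_mult power2_eq_square)

lemma energy_nonneg [simp]: "0 \<le> energy f"
  unfolding energy_def by (rule integral_nonneg_AE) simp

lemma energy_flow_pull:
  assumes "f \<in> test_fun \<Gamma>" shows "energy (flow_pull T f) = energy f"
  unfolding energy_def flow_pull_def geodesic_flow_def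
  using test_fun_measurable[OF assms] by (intro integral_M_mult(1)) measurable

lemma corr_pull_left:
  assumes "f \<in> test_fun \<Gamma>" shows "corr (flow_pull T f) \<psi> t = corr f \<psi> (t - T)"
  by (simp add: corr_def flow_pull_add)

lemma corr_pull_right:
  assumes f: "f \<in> test_fun \<Gamma>" and \<psi>: "\<psi> \<in> test_fun \<Gamma>"
  shows "corr f (flow_pull T \<psi>) t = corr f \<psi> (t + T)"
proof -
  have m: "(\<lambda>g. flow_pull (- t - T) f g * \<psi> g) \<in> borel_measurable M"
    by (intro borel_measurable_times test_fun_measurable test_fun_flow_pull f \<psi>)
  have "flow_pull (-t) f g = flow_pull (-t-T) f (g * one_param X_mat T)" for g
    by (simp add: flow_pull_def geodesic_flow_def mult.assoc flip: one_param_add)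
  then have "corr f (flow_pull T \<psi>) t = (\<integral>g. flow_pull (- t
    - T) f (g * one_param X_mat T) * \<psi> (g * one_param X_mat T) \<partial>M)"
    by (simp add: corr_def flow_pull_def[of T] geodesic_flow_def)
  also have "\<dots> = corr f \<psi> (t + T)"
    unfolding corr_def using integral_M_mult(1)[OF m, of "one_param X_mat T"] by simp
  finally show ?thesis .
qed

text \<open>The pointwise inequality 2 x y \<le> x^2 + y^2 takes the place of Cauchy-Schwarz. The
  bound does not depend on t because the flow preserves the energy; from it come the convergence for
  Re s > 0 and the order of growth at the imaginary axis.\<close>

lemma norm_corr_le:
  assumes f: "f \<in> test_fun \<Gamma>" and \<psi>: "\<psi> \<in> test_fun \<Gamma>"
  shows "norm (corr f \<psi> t) \<le> (energy f + energy \<psi>) / 2"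
proof -
  let ?F = "flow_pull (- t) f"
  have F: "?F \<in> test_fun \<Gamma>" by (rule test_fun_flow_pull[OF f])
  have "norm (corr f \<psi> t) \<le> (\<integral>g. norm (?F g * \<psi> g) \<partial>M)"
    unfolding corr_def by (rule integral_norm_bound)
  also have "\<dots> \<le> (\<integral>g. (norm (?F g))\<^sup>2 / 2 + (norm (\<psi> g))\<^sup>2 / 2 \<partial>M)"
  proof (intro integral_mono)
    fix g
    have "2 * (norm (?F g) * norm (\<psi> g)) \<le> (norm (?F g))\<^sup>2 + (norm (\<psi> g))\<^sup>2"
      using sum_squares_bound[of "norm (?F g)" "norm (\<psi> g)"] by simp
    then show "norm (?F g * \<psi> g) \<le> (norm (?F g))\<^sup>2 / 2 + (norm (\<psi> g))\<^sup>2 / 2"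
      by (simp add: norm_mult)
  qed (intro integrable_norm integrable_test_mult F \<psi> Bochner_Integration.integrable_add integrable_divide
    integrable_energy)+
  also have "\<dots> = energy ?F / 2 + energy \<psi> / 2"
    unfolding energy_def by (simp add: integrable_energy F \<psi>)
  finally show ?thesis using energy_flow_pull[OF f] by (simp add: add_divide_distrib)
qed

lemma continuous_flow_line:
  assumes "f \<in> test_fun \<Gamma>" shows "continuous_on UNIV (\<lambda>t. flow_pull (- t) f g)"
  unfolding flow_pull_def geodesic_flow_def
  using assms by (intro continuous_on_compose2[OF smoothD(1)[of f]] continuous_on_one_param continuous_intros) auto

lemma flow_joint_measurable:
  assumes "f \<in> test_fun \<Gamma>"
  shows "(\<lambda>p. flow_pull (- fst p) f (snd p)) \<in> borel_measurable (lborel \<Otimes>\<^sub>M M)"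
  using joint_measurable[of "\<lambda>t. flow_pull (- t) f" M] continuous_flow_line[OF assms]
    test_fun_measurable[OF test_fun_flow_pull[OF assms]] by simp

lemma corr_measurable [measurable]:
  assumes f: "f \<in> test_fun \<Gamma>" and \<psi>: "\<psi> \<in> test_fun \<Gamma>"
  shows "corr f \<psi> \<in> borel_measurable lborel"
proof -
  interpret sigma_finite_measure M by (rule sigma_finite_M)
  have "(\<lambda>p. flow_pull (- fst p) f (snd p) * \<psi> (snd p))
    \<in> borel_measurable (lborel \<Otimes>\<^sub>M M)"
    using flow_joint_measurable[OF f] test_fun_measurable[OF \<psi>] by measurable
  then show ?thesis
    unfolding corr_def[abs_def] by (intro borel_measurable_lebesgue_integral) (simp add: case_prod_beta')
qed

lemma set_integrable_corr:
  assumes f: "f \<in> test_fun \<Gamma>" and \<psi>: "\<psi> \<in> test_fun \<Gamma>" and s: "0 < Re s"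
  shows "set_integrable lborel {0..} (\<lambda>t. exp (- s * of_real t) * corr f \<psi> t)"
    and "norm (LINT t:{0..}|lborel. exp (- s * of_real t) * corr f \<psi> t) \<le> (energy f
      + energy \<psi>) / 2 / Re s"
proof -
  let ?K = "(energy f + energy \<psi>) / 2"
  note e = integrable_exp_decay[OF s]
  have b: "norm (indicator {0..} t *\<^sub>R (exp (- s * of_real t) * corr f \<psi> t))
    \<le> (indicator {0..} t * exp (- Re s * t)) * ?K" for t :: real
    using norm_corr_le[OF f \<psi>, of t] by (auto simp: norm_mult indicator_def)
  have i: "integrable lborel (\<lambda>t. (indicator {0..} t * exp (- Re s * t)) * ?K)"
    using e by (intro integrable_mult_left) (simp add: has_bochner_integral_iff)
  show "set_integrable lborel {0..} (\<lambda>t. exp (- s * of_real t) * corr f \<psi> t)"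
    unfolding set_integrable_def
  proof (rule Bochner_Integration.integrable_bound[OF i])
    have "corr f \<psi> \<in> borel_measurable lborel" by (rule corr_measurable[OF f \<psi>])
    then show "(\<lambda>t. indicator {0..} t *\<^sub>R (exp (- s * of_real t) * corr f \<psi> t))
      \<in> borel_measurable lborel"
      by measurable
    show "AE t in lborel. norm (indicator {0..} t *\<^sub>R (exp (- s * of_real t) * corr f \<psi> t))
      \<le> norm (indicator {0..} t * exp (- Re s * t) * ?K)"
      by (intro always_eventually allI) (rule order_trans[OF b], simp)
  qed
  have "norm (LINT t:{0..}|lborel. exp (- s * of_real t) * corr f \<psi> t) \<le>
      (\<integral>t. (indicator {0..} t * exp (- Re s * t)) * ?K \<partial>lborel)"
    unfolding set_lebesgue_integral_def
    by (rule order_trans[OF integral_norm_bound integral_mono[OF integrable_norm i b]])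
       (use \<open>set_integrable _ _ _\<close> in \<open>simp add: set_integrable_def\<close>)
  also have "\<dots> = 1 / Re s * ?K"
    using has_bochner_integral_integral_eq[OF e] by simp
  finally show "norm (LINT t:{0..}|lborel. exp (- s * of_real t) * corr f \<psi> t) \<le> ?K / Re s" by simp
qed

lemma set_integrable_flow:
  assumes f: "f \<in> test_fun \<Gamma>" and s: "0 < Re s"
  shows "set_integrable lborel {0..} (\<lambda>t. exp (- s * of_real t) * flow_pull (- t) f g)"
proof -
  obtain C where C: "C \<ge> 0" "\<And>g. norm (f g) \<le> C" using test_fun_bounded f by blast
  have i: "integrable lborel (\<lambda>t. (indicator {0..} t * exp (- Re s * t)) * C)"
    using integrable_exp_decay[OF s] by (intro integrable_mult_left) (simp add: has_bochner_integral_iff)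
  show ?thesis
    unfolding set_integrable_def
  proof (rule Bochner_Integration.integrable_bound[OF i])
    have "(\<lambda>t. flow_pull (- t) f g) \<in> borel_measurable lborel"
      using borel_measurable_continuous_onI[OF continuous_flow_line[OF f]] by simp
    then show "(\<lambda>t. indicator {0..} t *\<^sub>R (exp (- s * of_real t) * flow_pull (- t) f g))
      \<in> borel_measurable lborel"
      by measurable
    show "AE t in lborel. norm (indicator {0..} t *\<^sub>R (exp (- s * of_real t) * flow_pull (- t) f g))
      \<le> norm (indicator {0..} t * exp (- Re s * t) * C)"
      using C by (intro always_eventually allI) (auto simp: norm_mult indicator_def flow_pull_def intro!:
        mult_left_mono)
  qed
qed

lemma resolvent_eq: "resolvent s f g = - (LINT t:{0..}|lborel. exp (- s * of_real t) * flow_pull (- t) f g)"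
  by (simp add: resolvent_def flow_pull_def)

lemma resolvent_measurable:
  assumes f: "f \<in> test_fun \<Gamma>"
  shows "resolvent s f \<in> borel_measurable M"
proof -
  have "(\<lambda>p. flow_pull (- fst (snd p, fst p)) f (snd (snd p, fst p)))
    \<in> borel_measurable (M \<Otimes>\<^sub>M lborel)"
    by (rule measurable_compose[OF _ flow_joint_measurable[OF f]]) measurable
  then have "(\<lambda>(g, t). indicator {0..} t *\<^sub>R (exp (- s * of_real t) * flow_pull (- t) f g))
    \<in> borel_measurable (M \<Otimes>\<^sub>M lborel)"
    by (simp add: case_prod_beta')
  then show ?thesis
    unfolding resolvent_eq[abs_def] set_lebesgue_integral_def
    by (intro borel_measurable_uminus lborel.borel_measurable_lebesgue_integral)
qed

text \<open>Fubini; the integrand is dominated by \<open>exp (- Re s * t)\<close> times a constant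
  times |\<psi>|, and \<psi> is integrable as a bounded function with support of finite
  measure.\<close>

lemma integral_resolvent:
  assumes f: "f \<in> test_fun \<Gamma>" and \<psi>: "\<psi> \<in> test_fun \<Gamma>" and s: "0 < Re s"
  shows "(\<integral>g. resolvent s f g * \<psi> g \<partial>M) =
    - (LINT t:{0..}|lborel. exp (- s * of_real t) * corr f \<psi> t)"
proof -
  interpret M: sigma_finite_measure M by (rule sigma_finite_M)
  interpret P: pair_sigma_finite lborel M ..
  obtain C where C: "C \<ge> 0" "\<And>g. norm (f g) \<le> C" using test_fun_bounded f by blast
  define H where "H t g = indicator {0..} t *\<^sub>R (exp (- s * of_real t) * (flow_pull (- t) f g * \<psi>
    g))" for t g
  have flow: "integrable M (\<lambda>g. flow_pull (- t) f g * \<psi> g)" for t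
    by (intro integrable_test_mult test_fun_flow_pull f \<psi>)
  have Hint: "integrable M (H t)" for t
    unfolding H_def by (intro integrable_scaleR_right integrable_mult_right flow)
  have Hmeas: "(\<lambda>p. H (fst p) (snd p)) \<in> borel_measurable (lborel \<Otimes>\<^sub>M M)"
    unfolding H_def using flow_joint_measurable[OF f] test_fun_measurable[OF \<psi>] by measurable
  have "integrable (lborel \<Otimes>\<^sub>M M) (\<lambda>p. H (fst p) (snd p))"
  proof (rule P.Fubini_integrable[OF Hmeas])
    define N where "N = (\<integral>g. norm (\<psi> g) \<partial>M)"
    have \<psi>int: "integrable M (\<lambda>g. norm (\<psi> g))"
      by (intro integrable_norm) (use integrable_mult_test[of "\<lambda>_. 1" 1, OF _ _ \<psi>] in auto)
    have i: "integrable lborel (\<lambda>t. (indicator {0..} t * exp (- Re s * t)) * (C * N))"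
      using integrable_exp_decay[OF s] by (intro integrable_mult_left) (simp add: has_bochner_integral_iff)
    show "integrable lborel (\<lambda>t. \<integral>g. norm (H (fst (t, g)) (snd (t, g))) \<partial>M)"
    proof (rule Bochner_Integration.integrable_bound[OF i])
      show "(\<lambda>t. \<integral>g. norm (H (fst (t, g)) (snd (t, g))) \<partial>M) \<in> borel_measurable lborel"
        by (intro M.borel_measurable_lebesgue_integral) (use Hmeas in \<open>simp add: case_prod_beta'\<close>)
      show "AE t in lborel. norm (\<integral>g. norm (H (fst (t, g)) (snd (t, g))) \<partial>M)
        \<le> norm (indicator {0..} t * exp (- Re s * t) * (C * N))"
      proof (intro always_eventually allI)
        fix t :: real
        have "(\<integral>g. norm (H t g) \<partial>M) \<le> (\<integral>g. indicator {0..} t * exp (- Re s *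
          t) * C * norm (\<psi> g) \<partial>M)"
        proof (rule integral_mono[OF integrable_norm[OF Hint] integrable_mult_right[OF \<psi>int]])
          fix g
          show "norm (H t g) \<le> indicator {0..} t * exp (- Re s * t) * C * norm (\<psi> g)"
            using C by (auto simp: H_def norm_mult indicator_def flow_pull_def mult.assoc intro!:
              mult_left_mono mult_right_mono)
        qed
        also have "\<dots> = indicator {0..} t * exp (- Re s * t) * (C * N)"
          by (simp add: N_def)
        finally show "norm (\<integral>g. norm (H (fst (t, g)) (snd (t, g))) \<partial>M)
          \<le> norm (indicator {0..} t * exp (- Re s * t) * (C * N))"
          by (simp add: integral_nonneg_AE)
      qed
    qed
    show "AE t in lborel. integrable M (\<lambda>g. H (fst (t, g)) (snd (t, g)))"
      using Hint by simp
  qed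
  then have "(\<integral>g. (\<integral>t. H t g \<partial>lborel) \<partial>M)
    = (\<integral>t. (\<integral>g. H t g \<partial>M) \<partial>lborel)"
    by (intro P.Fubini_integral) (simp add: case_prod_beta')
  also have "(\<lambda>t. \<integral>g. H t g \<partial>M) = (\<lambda>t. indicator {0..} t *\<^sub>R (exp (- s
    * of_real t) * corr f \<psi> t))"
    by (simp add: H_def corr_def)
  also have "(\<lambda>g. \<integral>t. H t g \<partial>lborel) = (\<lambda>g. - resolvent s f g * \<psi> g)"
  proof
    fix g
    have "H t g = (indicator {0..} t *\<^sub>R (exp (- s * of_real t) * flow_pull (- t) f g)) * \<psi> g" for t
      by (simp add: H_def mult.assoc)
    then have "(\<integral>t. H t g \<partial>lborel) = (\<integral>t. (indicator {0..} t *\<^sub>R (exp (- s *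
      of_real t) * flow_pull (- t) f g)) * \<psi> g \<partial>lborel)"
      by presburger
    also have "\<dots> = - resolvent s f g * \<psi> g"
      unfolding integral_mult_left_zero resolvent_eq set_lebesgue_integral_def by simp
    finally show "(\<integral>t. H t g \<partial>lborel) = - resolvent s f g * \<psi> g" .
  qed
  finally have "- (\<integral>g. resolvent s f g * \<psi> g \<partial>M)
    = (LINT t:{0..}|lborel. exp (- s * of_real t) * corr f \<psi> t)"
    by (simp add: set_lebesgue_integral_def)
  then show ?thesis by (simp only: minus_equation_iff[of "integral\<^sup>L _ _"])
qed

text \<open>Integration by parts in time: differentiating \<open>exp (- s t) f o \<phi>_(-t)\<close>
  produces both terms, and the boundary value at t = 0 is the term \<open>- f\<close>.\<close>

lemma resolvent_X:
  assumes f: "f \<in> test_fun \<Gamma>" and s: "0 < Re s"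
  shows "resolvent s (lie_deriv X_mat f) g = - f g - s * resolvent s f g"
proof -
  let ?Xf = "lie_deriv X_mat f"
  have Xf: "?Xf \<in> test_fun \<Gamma>" by (rule test_fun_lie_deriv[OF f]) simp
  obtain C where C: "C \<ge> 0" "\<And>g. norm (f g) \<le> C" using test_fun_bounded f by blast
  note i1 = set_integrable_flow[OF f s, of g] and i2 = set_integrable_flow[OF Xf s, of g]
  let ?F = "\<lambda>t. exp (- s * of_real t) * flow_pull (- t) f g"
  let ?F' = "\<lambda>t. - s * (exp (- s * of_real t) * flow_pull (- t) f g)
    - exp (- s * of_real t) * flow_pull (- t) ?Xf g"
  have "(LINT t:{0..}|lborel. ?F' t) = - ?F 0"
  proof (rule integral_FTC_atLeast_0)
    fix t
    have "((\<lambda>t. f (g * one_param X_mat t)) has_vector_derivative ?Xf (g * one_param X_mat (-t))) (at (-t))"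
      using f by (intro has_vector_derivative_lie_deriv) auto
    then have "(((\<lambda>t. f (g * one_param X_mat t)) \<circ> uminus) has_vector_derivative (-1) *\<^sub>R
      ?Xf (g * one_param X_mat (-t))) (at t)"
      by (intro vector_diff_chain_at) (auto intro!: derivative_eq_intros)
    then have 1: "((\<lambda>t. flow_pull (- t) f g) has_vector_derivative - flow_pull (- t) ?Xf g) (at t)"
      by (simp add: flow_pull_def geodesic_flow_def o_def)
    have "((\<lambda>z. exp (- s * z)) has_field_derivative - s * exp (- s * of_real t)) (at (of_real t))"
      by (auto intro!: derivative_eq_intros)
    then have 2: "((\<lambda>t. exp (- s * of_real t)) has_vector_derivative - s * exp (- s * of_real t)) (at t)"
      by (rule has_vector_derivative_real_field)
    from has_vector_derivative_mult[OF 2 1]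
    show "(?F has_vector_derivative ?F' t) (at t)"
      by (simp add: algebra_simps)
  next
    show "continuous_on UNIV ?F'"
      by (intro continuous_intros continuous_flow_line f Xf)
    show "set_integrable lborel {0..} ?F'"
      by (intro set_integral_diff set_integrable_mult_right i1 i2)
    show "(?F \<longlongrightarrow> 0) at_top"
    proof (rule Lim_null_comparison)
      show "\<forall>\<^sub>F t in at_top. norm (?F t) \<le> exp (- Re s * t) * C"
        using C by (intro always_eventually allI) (simp add: norm_mult flow_pull_def)
      show "((\<lambda>t. exp (- Re s * t) * C) \<longlongrightarrow> 0) at_top" using s by real_asymp
    qed
  qed
  also have "(LINT t:{0..}|lborel. ?F' t) = s * resolvent s f g + resolvent s ?Xf g"
    unfolding set_integral_diff(2)[OF set_integrable_mult_right[OF i1, of "- s"] i2] resolvent_eq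
      set_integral_mult_right by simp
  finally show ?thesis by (simp add: algebra_simps)
qed

text \<open>By right invariance every difference quotient has integral 0, and dominated convergence
  passes this to the derivative.\<close>

lemma integral_derivative_zero:
  fixes P Q :: "psl2 \<Rightarrow> complex"
  assumes V: "V \<in> frame" and P: "P \<in> borel_measurable M" and Q: "Q \<in> borel_measurable M"
    and deriv: "\<And>g t. ((\<lambda>t. P (g * one_param V t)) has_vector_derivative Q (g * one_param V t)) (at t)"
    and bounded: "\<And>g. norm (P g) \<le> B" "\<And>g. norm (Q g) \<le> C"
    and supp: "r \<ge> 0" "\<And>g. P g \<noteq> 0 \<or> Q g \<noteq> 0 \<Longrightarrow> g \<in> size_supp \<Gamma> r"
  shows "(\<integral>g. Q g \<partial>M) = 0"
proof -
  have intP: "integrable M P" by (rule integrable_bounded_supp[OF P bounded(1)]) (use supp in auto)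
  \<comment> \<open>Step lengths in (0, 1], so that the supports of all quotients lie in the one
    saturation of radius 4 r.\<close>
  define h where "h n = 1 / real (Suc n)" for n
  have h: "h n > 0" "h n \<le> 1" for n by (auto simp: h_def)
  define Pn where "Pn n g = (1 / h n) *\<^sub>R (P (g * one_param V (h n)) - P g)" for n g
  have "(\<lambda>n. \<integral>g. Pn n g \<partial>M) \<longlonglongrightarrow> (\<integral>g. Q g \<partial>M)"
  proof (rule integral_dominated_convergence)
    have "(\<lambda>g. P (g * one_param V (h n))) \<in> borel_measurable M" for n
      by (rule measurable_compose[OF mult_measurable_M P])
    then show "Pn n \<in> borel_measurable M" for n
      unfolding Pn_def using P by measurable
    show "integrable M (\<lambda>g. C * indicator (size_supp \<Gamma> (r * 4)) g)"
      using emeasure_size_supp[of "r * 4"] size_supp_inv_sets[of "r * 4"]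
      by (intro integrable_mult_right integrable_real_indicator) auto
    show "AE g in M. (\<lambda>n. Pn n g) \<longlonglongrightarrow> Q g"
    proof (intro always_eventually allI)
      fix g
      have "((\<lambda>t. P (g * one_param V t)) has_vector_derivative Q g) (at 0)"
        using deriv[of g 0] V by simp
      then have "((\<lambda>t. (1 / t) *\<^sub>R (P (g * one_param V t) - P g)) \<longlongrightarrow> Q g) (at 0)"
        using V vector_derivative_quotient_limit[of "\<lambda>t. P (g * one_param V t)"] by simp
      moreover have "filterlim h (at 0) sequentially"
        unfolding filterlim_at
      proof
        show "h \<longlonglongrightarrow> 0" unfolding h_def by real_asymp
      qed (use h in \<open>auto simp: less_imp_neq[symmetric] intro!: always_eventually\<close>)
      ultimately show "(\<lambda>n. Pn n g) \<longlonglongrightarrow> Q g"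
        unfolding Pn_def by (rule filterlim_compose)
    qed
    fix n
    show "AE g in M. norm (Pn n g) \<le> C * indicator (size_supp \<Gamma> (r * 4)) g"
    proof (intro always_eventually allI)
      fix g
      show "norm (Pn n g) \<le> C * indicator (size_supp \<Gamma> (r * 4)) g"
      proof (cases "Pn n g = 0")
        case True
        then show ?thesis using order_trans[OF norm_ge_zero bounded(2)] by simp
      next
        case False
        have "g \<in> size_supp \<Gamma> (r * 4)"
        proof (cases "P g = 0")
          case True
          then have "P (g * one_param V (h n)) \<noteq> 0" using False by (auto simp: Pn_def)
          then have "g * one_param V (h n) \<in> size_supp \<Gamma> r" using supp by auto
          then show ?thesis
            by (rule size_supp_mult[where h' = "one_param V (- h n)"])
               (use psl2_size_one_param[OF V, of "- h n"] h[of n] one_param_minus[OF V] in auto)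
        next
          case False
          then show ?thesis using supp size_supp_mono[of r "r * 4" \<Gamma>] by auto
        qed
        moreover have "norm (P (g * one_param V (h n)) - P (g * one_param V 0)) \<le> C * \<bar>h n\<bar>"
          by (rule vector_mean_value) (use deriv bounded in auto)
        ultimately show ?thesis
          using h[of n] V by (simp add: Pn_def divide_le_eq mult.commute)
      qed
    qed
  qed (rule Q)
  moreover have "(\<integral>g. Pn n g \<partial>M) = 0" for n
    unfolding Pn_def using intP integral_M_mult[OF P, of "one_param V (h n)"] by simp
  ultimately show ?thesis by (simp add: LIMSEQ_const_iff)
qed

text \<open>The derivative of the product \<open>F \<psi>\<close> integrates to 0. In particular the
  sign in \<open>dist_deriv\<close> is the right one for distributions given by test
  functions.\<close>

lemma integration_by_parts:
  assumes F: "F \<in> test_fun \<Gamma>" and \<psi>: "\<psi> \<in> test_fun \<Gamma>" and V: "V \<in> frame"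
  shows "(\<integral>g. F g * lie_deriv V \<psi> g \<partial>M) =
    - (\<integral>g. lie_deriv V F g * \<psi> g \<partial>M)"
proof -
  let ?Q = "\<lambda>g. F g * lie_deriv V \<psi> g + lie_deriv V F g * \<psi> g"
  note t = F \<psi> test_fun_lie_deriv[OF F V] test_fun_lie_deriv[OF \<psi> V]
  note m = t[THEN test_fun_measurable]
  obtain r where r: "r \<ge> 0" "\<And>g. F g \<noteq> 0 \<or> \<psi> g \<noteq> 0 \<Longrightarrow>
    g \<in> size_supp \<Gamma> r" using test_fun_sup F \<psi> by blast
  obtain B1 where B1: "B1 \<ge> 0" "\<And>g. norm (F g) \<le> B1" using test_fun_bounded t by blast
  obtain B2 where B2: "B2 \<ge> 0" "\<And>g. norm (\<psi> g) \<le> B2" using test_fun_bounded t by blast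
  obtain B3 where B3: "B3 \<ge> 0" "\<And>g. norm (lie_deriv V F g) \<le> B3" using test_fun_bounded t by blast
  obtain B4 where B4: "B4 \<ge> 0" "\<And>g. norm (lie_deriv V \<psi> g) \<le> B4" using test_fun_bounded t by blast
  have "(\<integral>g. ?Q g \<partial>M) = 0"
  proof (rule integral_derivative_zero[OF V, where P = "\<lambda>g. F g * \<psi> g" and B = "B1 * B2" and C
    = "B1 * B4 + B3 * B2"])
    show "(\<lambda>g. F g * \<psi> g) \<in> borel_measurable M" "?Q \<in> borel_measurable M" using m by simp_all
    fix g t
    show "((\<lambda>t. F (g * one_param V t) * \<psi> (g * one_param V t)) has_vector_derivative ?Q (g *
      one_param V t)) (at t)"
      by (intro has_vector_derivative_mult has_vector_derivative_lie_deriv test_fun_smooth[OF F]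
        test_fun_smooth[OF \<psi>] V)
    show "norm (F g * \<psi> g) \<le> B1 * B2" using B1 B2 by (simp add: norm_mult mult_mono)
    have "norm (?Q g) \<le> norm (F g * lie_deriv V \<psi> g) + norm (lie_deriv V F g * \<psi> g)"
      by (rule norm_triangle_ineq)
    also have "\<dots> \<le> B1 * B4 + B3 * B2" using B1 B2 B3 B4 by (auto simp: norm_mult intro!: add_mono mult_mono)
    finally show "norm (?Q g) \<le> B1 * B4 + B3 * B2" .
    assume "F g * \<psi> g \<noteq> 0 \<or> ?Q g \<noteq> 0"
    then have "F g \<noteq> 0 \<or> \<psi> g \<noteq> 0" by auto
    then show "g \<in> size_supp \<Gamma> r" by (rule r)
  qed (rule r)
  then show ?thesis
    using t by (simp add: integrable_test_mult add_eq_0_iff)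
qed

text \<open>After integration by parts \<open>V\<close> acts on the pulled-back factor, and
  commuting it with the flow leaves the factor \<open>exp (weight V * t)\<close>; under the Laplace
  transform this factor shifts s by the weight.\<close>

lemma corr_lie_deriv:
  assumes f: "f \<in> test_fun \<Gamma>" and \<psi>: "\<psi> \<in> test_fun \<Gamma>" and V: "V \<in> frame"
  shows "corr f (lie_deriv V \<psi>) t = - of_real (exp (weight V * t)) * corr (lie_deriv V f) \<psi> t"
proof -
  have "lie_deriv V (flow_pull (-t) f) = (\<lambda>g. of_real (exp (weight V * t)) * flow_pull (-t) (lie_deriv V f) g)"
    using lie_deriv_flow_pull[OF test_fun_smooth[OF f] V, of 1 "-t"] by simp
  then show ?thesis
    unfolding corr_def using integration_by_parts[OF test_fun_flow_pull[OF f, of "-t"] \<psi> V]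
    by (simp add: mult.assoc)
qed

end

section \<open>Mautner's phenomenon\<close>

lemma lie_deriv_cnj:
  assumes "smooth f" "V \<in> frame"
  shows "lie_deriv V (\<lambda>g. cnj (f g)) = (\<lambda>g. cnj (lie_deriv V f g))"
  by (intro ext lie_derivI has_vector_derivative_cnj has_vector_derivative_lie_deriv_0 assms)

lemma smooth_cnj:
  assumes "smooth f" shows "smooth (\<lambda>g. cnj (f g))"
proof -
  have w: "lie_word Vs (\<lambda>g. cnj (f g)) = (\<lambda>g. cnj (lie_word Vs f g))" if "set Vs
    \<subseteq> frame" for Vs
    using that by (induction Vs) (auto simp: lie_deriv_cnj smooth_lie_word assms)
  show ?thesis
    unfolding smooth_def
  proof (intro allI impI conjI ballI)
    fix Vs assume Vs: "set Vs \<subseteq> frame"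
    note sm = smooth_lie_word[OF assms Vs]
    show "continuous_on UNIV (lie_word Vs (\<lambda>g. cnj (f g)))"
      unfolding w[OF Vs] by (intro continuous_intros smoothD(1) sm)
    fix V g assume V: "V \<in> frame"
    show "(\<lambda>t. lie_word Vs (\<lambda>g. cnj (f g)) (g * one_param V t)) differentiable at 0"
      unfolding w[OF Vs] 
      by (rule differentiableI_vector[OF has_vector_derivative_cnj[OF has_vector_derivative_lie_deriv_0[OF sm V]]])
  qed
qed

lemma test_fun_cnj: "f \<in> test_fun \<Gamma> \<Longrightarrow> (\<lambda>g. cnj (f g)) \<in> test_fun \<Gamma>"
  by (auto simp: test_fun_iff smooth_cnj)

text \<open>The discriminant criterion, from the value at the vertex t = - D / E; for E = 0 an
  affine function is bounded below only if its slope is 0.\<close>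

lemma quadratic_nonneg_bound:
  fixes D E \<delta> :: real
  assumes "\<And>t. t\<^sup>2 / 2 * E + t * D + \<delta> \<ge> 0" "E \<ge> 0" "\<delta> > 0"
  shows "D\<^sup>2 \<le> 2 * \<delta> * E"
proof (cases "E = 0")
  case True
  have "D = 0"
  proof (rule ccontr)
    assume "D \<noteq> 0"
    then show False using assms(1)[of "- 2 * \<delta> / D"] assms(3) True by simp
  qed
  then show ?thesis using True by simp
next
  case False
  then have "E > 0" using assms by simp
  then show ?thesis using assms(1)[of "- D / E"] by (simp add: power2_eq_square field_simps)
qed

context surface
begin

text \<open>The real part of the Hermitian product: the variational argument runs over the reals,
  and \<open>mautner\<close> recovers the complex statement.\<close>

definition ip :: "(psl2 \<Rightarrow> complex) \<Rightarrow> (psl2 \<Rightarrow> complex) \<Rightarrow> real" where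
  "ip f h = Re (\<integral>g. f g * cnj (h g) \<partial>M)"

lemma norm_ip_le:
  assumes "f \<in> test_fun \<Gamma>" "h \<in> test_fun \<Gamma>"
  shows "\<bar>ip f h\<bar> \<le> (energy f + energy h) / 2"
proof -
  have "\<bar>ip f h\<bar> \<le> norm (corr f (\<lambda>g. cnj (h g)) 0)"
    unfolding ip_def corr_def using abs_Re_le_cmod by simp
  also have "\<dots> \<le> (energy f + energy (\<lambda>g. cnj (h g))) / 2"
    by (intro norm_corr_le assms test_fun_cnj)
  finally show ?thesis by (simp add: energy_def)
qed

lemma energy_add:
  assumes f: "f \<in> test_fun \<Gamma>" and h: "h \<in> test_fun \<Gamma>"
  shows "energy (\<lambda>g. h g + of_real t * f g) = energy h + 2 * t * ip f h + t\<^sup>2 * energy f"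
proof -
  have p: "(norm (z + of_real t * w))\<^sup>2 = (norm z)\<^sup>2 + 2 * t * Re (w * cnj z)
    + t\<^sup>2 * (norm w)\<^sup>2" for z w
    unfolding cmod_power2 by (simp add: power2_eq_square algebra_simps)
  have i: "integrable M (\<lambda>g. f g * cnj (h g))" by (intro integrable_test_mult f test_fun_cnj h)
  have "energy (\<lambda>g. h g + of_real t * f g) = 
     (\<integral>g. (norm (h g))\<^sup>2 + 2 * t * Re (f g * cnj (h g)) + t\<^sup>2 * (norm (f g))\<^sup>2 \<partial>M)"
    unfolding energy_def p ..
  also have "\<dots> = energy h + 2 * t * (\<integral>g. Re (f g * cnj (h g)) \<partial>M) + t\<^sup>2 * energy f"
  proof -
    have "integrable M (\<lambda>g. (norm (h g))\<^sup>2)" "integrable M (\<lambda>g. 2 * t * Re (f g * cnj (h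
      g)))" "integrable M (\<lambda>g. t\<^sup>2 * (norm (f g))\<^sup>2)"
      by (intro integrable_energy h integrable_mult_right integrable_Re i f)+
    then show ?thesis
      unfolding energy_def by (simp only: Bochner_Integration.integral_add Bochner_Integration.integrable_add
        integral_mult_right_zero)
  qed
  also have "(\<integral>g. Re (f g * cnj (h g)) \<partial>M) = ip f h"
    unfolding ip_def by (rule integral_Re[OF i])
  finally show ?thesis .
qed

lemma ip_lie_deriv:
  assumes f: "f \<in> test_fun \<Gamma>" and h: "h \<in> test_fun \<Gamma>" and V: "V \<in> frame"
  shows "ip (lie_deriv V f) h = - ip f (lie_deriv V h)"
  using integration_by_parts[OF f test_fun_cnj[OF h] V]
  by (simp add: ip_def lie_deriv_cnj[OF test_fun_smooth[OF h] V])

lemma ip_scale: "ip (\<lambda>g. of_real c * f g) h = c * ip f h"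
  by (simp add: ip_def mult.assoc)

text \<open>The functional \<open>u\<close> is nearly represented by a test function \<open>h\<close>, a near-minimizer of
  \<open>energy h / 2 - Re (u h)\<close>. The flow scales the derivative along \<open>V\<close> by an arbitrarily small factor, and
  integration by parts moves this derivative from the rough function to the fixed \<open>h\<close>.\<close>

lemma mautner_Re:
  fixes u :: functional
  assumes lin: "\<And>f h a b. f \<in> test_fun \<Gamma> \<Longrightarrow>
    h \<in> test_fun \<Gamma> \<Longrightarrow> u (\<lambda>g. a * f g + b * h g) = a * u f + b * u h"
    and bound: "\<And>f. f \<in> test_fun \<Gamma> \<Longrightarrow> norm (u f) \<le> (energy f + K) / 2"
    and inv: "\<And>f T. f \<in> test_fun \<Gamma> \<Longrightarrow> u (flow_pull T f) = u f"
    and V: "V \<in> {Uplus, Uminus}" and \<psi>: "\<psi> \<in> test_fun \<Gamma>"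
  shows "Re (u (lie_deriv V \<psi>)) = 0"
proof (rule ccontr)
  assume "Re (u (lie_deriv V \<psi>)) \<noteq> 0"
  define r where "r = \<bar>Re (u (lie_deriv V \<psi>))\<bar>"
  have r: "r > 0" using \<open>Re (u (lie_deriv V \<psi>)) \<noteq> 0\<close> by (simp add: r_def)
  have Vf: "V \<in> frame" using V by auto
  have V\<psi>: "lie_deriv V \<psi> \<in> test_fun \<Gamma>" by (rule test_fun_lie_deriv[OF \<psi> Vf])
  define E where "E = energy (lie_deriv V \<psi>)"
  have E: "E \<ge> 0" by (simp add: E_def)
  \<comment> \<open>The factor 1/2 in the hypothesis \<open>bound\<close> matches the 1/2 here and
    keeps the functional bounded below, by \<open>- K / 2\<close>.\<close>
  define J where "J h = energy h / 2 - Re (u h)" for h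
  have J: "J h \<ge> - K / 2" if "h \<in> test_fun \<Gamma>" for h
    using bound[OF that] abs_Re_le_cmod[of "u h"] by (simp add: J_def field_simps)
  \<comment> \<open>Chosen so that 2 \<delta> E is less than (r / 2)^2; the 1 in the denominator
    takes care of E = 0.\<close>
  define \<delta> where "\<delta> = r\<^sup>2 / (16 * (E + 1))"
  have \<delta>: "\<delta> > 0" using r E by (simp add: \<delta>_def)
  have bdd: "bdd_below (J ` test_fun \<Gamma>)" by (rule bdd_belowI2[OF J])
  have ne: "J ` test_fun \<Gamma> \<noteq> {}" using \<psi> by auto
  obtain h where h: "h \<in> test_fun \<Gamma>" "J h < Inf (J ` test_fun \<Gamma>) + \<delta>"
    using cInf_lessD[OF ne, of "Inf (J ` test_fun \<Gamma>) + \<delta>"] \<delta> by auto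
  \<comment> \<open>Near-minimality in every direction: the increment of \<open>J\<close> along
    \<open>f\<close> is a quadratic in t bounded below by - \<delta>, so \<open>h\<close> represents
    the real part of \<open>u\<close> up to the square root of 2 \<delta> energy f.\<close>
  have key: "(ip f h - Re (u f))\<^sup>2 \<le> 2 * \<delta> * energy f" if f: "f \<in> test_fun \<Gamma>" for f
  proof (rule quadratic_nonneg_bound)
    fix t :: real
    have hf: "(\<lambda>g. 1 * h g + of_real t * f g) \<in> test_fun \<Gamma>" by (rule test_fun_lincomb[OF h(1) f])
    have "J h < J (\<lambda>g. 1 * h g + of_real t * f g) + \<delta>"
      using cInf_lower[OF imageI[OF hf] bdd] h(2) by linarith
    also have "u (\<lambda>g. 1 * h g + of_real t * f g) = 1 * u h + of_real t * u f" by (rule lin[OF h(1) f])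
    then have "J (\<lambda>g. 1 * h g + of_real t * f g) = J h + t\<^sup>2 / 2 * energy f + t * (ip f h - Re (u f))"
      unfolding J_def using energy_add[OF f h(1), of t] by (simp add: field_simps)
    finally show "0 \<le> t\<^sup>2 / 2 * energy f + t * (ip f h - Re (u f)) + \<delta>" by simp
  qed (use \<delta> in auto)
  define c where "c = (energy \<psi> + energy (lie_deriv V h)) / 2"
  have c: "c \<ge> 0" unfolding c_def by simp
  \<comment> \<open>Makes \<open>exp (weight V * T) * c\<close> equal to r c / (2 c + r), at most r
    / 2. The sign of T follows the weight, because the two horocyclic directions contract in
    opposite directions of time.\<close>
  define T where "T = - weight V * ln (2 * c / r + 1)"
  have w2: "weight V * weight V = 1" using V by auto
  have pos: "2 * c / r + 1 > 0" using c r by (simp add: add_nonneg_pos)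
  have "weight V * T = - ln (2 * c / r + 1)"
    using w2 by (simp add: T_def mult.assoc[symmetric])
  then have exp: "exp (weight V * T) = 1 / (2 * c / r + 1)"
    using pos by (simp add: exp_minus field_simps)
  have "lie_deriv V (flow_pull T \<psi>) = (\<lambda>g. of_real (exp (- weight V * T)) * flow_pull T (lie_deriv
    V \<psi>) g)"
    using lie_deriv_flow_pull[OF test_fun_smooth[OF \<psi>] Vf, of 1 T] by simp
  then have eq: "flow_pull T (lie_deriv V \<psi>) = (\<lambda>g. of_real (exp (weight V * T)) * lie_deriv V
    (flow_pull T \<psi>) g)"
    by (simp add: fun_eq_iff mult.assoc[symmetric] flip: of_real_mult)
  have "\<bar>ip (flow_pull T (lie_deriv V \<psi>)) h\<bar> = exp (weight V * T) * \<bar>ip (flow_pull T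
    \<psi>) (lie_deriv V h)\<bar>"
    unfolding eq ip_scale ip_lie_deriv[OF test_fun_flow_pull[OF \<psi>] h(1) Vf] by (simp add: abs_mult)
  also have "\<dots> \<le> exp (weight V * T) * c"
    unfolding c_def using norm_ip_le[OF test_fun_flow_pull[OF \<psi>, of T] test_fun_lie_deriv[OF h(1) Vf]]
    by (intro mult_left_mono) (simp_all add: energy_flow_pull[OF \<psi>])
  also have "\<dots> \<le> r / 2"
    unfolding exp using pos r c by (simp add: field_simps)
  finally have 1: "\<bar>ip (flow_pull T (lie_deriv V \<psi>)) h\<bar> \<le> r / 2" .
  \<comment> \<open>The error allowed by \<open>key\<close> is the same for all T, since the flow
    preserves the energy and \<open>u\<close>; therefore T could be chosen after
    \<open>h\<close>.\<close>
  have "(ip (flow_pull T (lie_deriv V \<psi>)) h - Re (u (lie_deriv V \<psi>)))\<^sup>2 \<le> 2 * \<delta> * E"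
    using key[OF test_fun_flow_pull[OF V\<psi>, of T]] inv[OF V\<psi>] energy_flow_pull[OF V\<psi>] by (simp add: E_def)
  also have "\<dots> < (r / 2)\<^sup>2"
  proof -
    have "2 * \<delta> * E = r\<^sup>2 * (E / (8 * (E + 1)))" 
    proof -
      have "8 * E + 8 \<noteq> 0" "16 * E + 16 \<noteq> 0" using E by auto
      then show ?thesis by (simp add: \<delta>_def field_simps)
    qed
    also have "\<dots> < r\<^sup>2 * (1 / 4)" using r E by (intro mult_strict_left_mono) (simp_all add: field_simps)
    finally show ?thesis by (simp add: power2_eq_square)
  qed
  finally have 2: "\<bar>ip (flow_pull T (lie_deriv V \<psi>)) h - Re (u (lie_deriv V \<psi>))\<bar> < r / 2"
    using r by (intro power2_less_imp_less[of "\<bar>_\<bar>"]) simp_all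
  from 1 2 show False unfolding r_def by linarith
qed

text \<open>The real version, applied also to i \<psi>, controls the imaginary part.\<close>

lemma mautner:
  fixes u :: functional
  assumes lin: "\<And>f h a b. f \<in> test_fun \<Gamma> \<Longrightarrow>
    h \<in> test_fun \<Gamma> \<Longrightarrow> u (\<lambda>g. a * f g + b * h g) = a * u f + b * u h"
    and bound: "\<And>f. f \<in> test_fun \<Gamma> \<Longrightarrow> norm (u f) \<le> (energy f + K) / 2"
    and inv: "\<And>f T. f \<in> test_fun \<Gamma> \<Longrightarrow> u (flow_pull T f) = u f"
    and V: "V \<in> {Uplus, Uminus}" and \<psi>: "\<psi> \<in> test_fun \<Gamma>"
  shows "u (lie_deriv V \<psi>) = 0"
proof -
  have Vf: "V \<in> frame" using V by auto
  have i\<psi>: "(\<lambda>g. \<i> * \<psi> g) \<in> test_fun \<Gamma>" by (rule test_fun_scale[OF \<psi>])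
  have "lie_deriv V (\<lambda>g. \<i> * \<psi> g) = (\<lambda>g. \<i> * lie_deriv V \<psi> g)"
    using lie_deriv_lincomb[of \<psi> \<psi> V \<i> 0] \<psi> Vf by auto
  then have "u (lie_deriv V (\<lambda>g. \<i> * \<psi> g)) = \<i> * u (lie_deriv V \<psi>)"
    using lin[OF test_fun_lie_deriv[OF \<psi> Vf] test_fun_lie_deriv[OF \<psi> Vf], of \<i> 0] by simp
  moreover have "Re (u (lie_deriv V \<psi>)) = 0" "Re (u (lie_deriv V (\<lambda>g. \<i> * \<psi> g))) = 0"
    using mautner_Re[OF lin bound inv V] \<psi> i\<psi> by blast+
  ultimately show ?thesis by (simp add: complex_eq_iff)
qed

end

section \<open>The resolvent in the half-plane of convergence\<close>

locale surface_resolvent = surface +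
  fixes R :: "complex \<Rightarrow> operator"
  assumes R: "resolvent_extension \<Gamma> R"
begin

lemma R_eq:
  assumes f: "f \<in> test_fun \<Gamma>" and \<psi>: "\<psi> \<in> test_fun \<Gamma>" and s: "0 < Re s"
  shows "R s f \<psi> = (\<integral>g. resolvent s f g * \<psi> g \<partial>M)"
proof -
  have "R s f = fun_dist \<Gamma> (resolvent s f)"
    using R f s by (auto simp: resolvent_extension_def)
  then have "R s f \<psi> = SM_integral \<Gamma> (\<lambda>g. resolvent s f g * \<psi> g)"
    using \<psi> by (simp add: fun_dist_def)
  also have "\<dots> = (\<integral>g. resolvent s f g * \<psi> g \<partial>M)"
    by (intro SM_integral_eq borel_measurable_times resolvent_measurable test_fun_measurable f \<psi>)
  finally show ?thesis .
qed

lemma R_corr: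
  assumes "f \<in> test_fun \<Gamma>" "\<psi> \<in> test_fun \<Gamma>" "0 < Re s"
  shows "R s f \<psi> = - (LINT t:{0..}|lborel. exp (- s * of_real t) * corr f \<psi> t)"
  using R_eq[OF assms] integral_resolvent[OF assms] by simp

lemma R_bound:
  assumes "f \<in> test_fun \<Gamma>" "\<psi> \<in> test_fun \<Gamma>" "0 < Re s"
  shows "norm (R s f \<psi>) \<le> (energy f + energy \<psi>) / 2 / Re s"
  unfolding R_corr[OF assms] norm_minus_cancel by (rule set_integrable_corr(2)[OF assms])

text \<open>All weights are at most 1, so Re s > 1 places both s and s - weight V where the Laplace
  transform converges.\<close>

lemma R_lie_deriv_half_plane:
  assumes f: "f \<in> test_fun \<Gamma>" and \<psi>: "\<psi> \<in> test_fun \<Gamma>" and V: "V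
    \<in> frame" and s: "1 < Re s"
  shows "R s f (lie_deriv V \<psi>) = - R (s - of_real (weight V)) (lie_deriv V f) \<psi>"
proof -
  have w: "weight V \<le> 1" using V by (auto simp: frame_def)
  have s': "0 < Re s" "0 < Re (s - of_real (weight V))" using s w by auto
  have "exp (- s * of_real t) * corr f (lie_deriv V \<psi>) t =
     - (exp (- (s - of_real (weight V)) * of_real t) * corr (lie_deriv V f) \<psi> t)" for t
  proof -
    have "exp (- s * of_real t) * of_real (exp (weight V * t)) = exp (- (s - of_real (weight V)) * of_real t)"
      unfolding exp_of_real[symmetric] exp_add[symmetric] by (simp add: algebra_simps)
    then show ?thesis
      unfolding corr_lie_deriv[OF f \<psi> V] by (simp add: mult.assoc[symmetric])
  qed
  then show ?thesis
    unfolding R_corr[OF f test_fun_lie_deriv[OF \<psi> V] s'(1)] R_corr[OF test_fun_lie_deriv[OF f V] \<psi> s'(2)]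
    by (simp only: set_lebesgue_integral_def scaleR_minus_right integral_minus)
qed

lemma R_X_half_plane:
  assumes f: "f \<in> test_fun \<Gamma>" and \<psi>: "\<psi> \<in> test_fun \<Gamma>" and s: "0 < Re s"
  shows "R s (lie_deriv X_mat f) \<psi> = - (\<integral>g. f g * \<psi> g \<partial>M) - s * R s f \<psi>"
proof -
  have Xf: "lie_deriv X_mat f \<in> test_fun \<Gamma>" by (rule test_fun_lie_deriv[OF f]) simp
  obtain C where C: "C \<ge> 0" "\<And>g. norm (f g) \<le> C" using test_fun_bounded f by blast
  \<comment> \<open>Boundedness makes the product with \<psi> integrable, so that the integral of
    the difference below can be split.\<close>
  have "norm (resolvent s f g) \<le> C / Re s" for g
  proof -
    have "norm (resolvent s f g) \<le> (\<integral>t. (indicator {0..} t * exp (- Re s * t)) * C \<partial>lborel)"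
      unfolding resolvent_eq norm_minus_cancel set_lebesgue_integral_def
    proof (rule order_trans[OF integral_norm_bound integral_mono[OF integrable_norm]])
      show "integrable lborel (\<lambda>t. indicator {0..} t *\<^sub>R (exp (- s * of_real t) * flow_pull (- t) f g))"
        using set_integrable_flow[OF f s] by (simp add: set_integrable_def)
      show "integrable lborel (\<lambda>t. (indicator {0..} t * exp (- Re s * t)) * C)"
        using integrable_exp_decay[OF s] by (intro integrable_mult_left) (simp add: has_bochner_integral_iff)
      show "norm (indicator {0..} t *\<^sub>R (exp (- s * of_real t) * flow_pull (- t) f g))
        \<le> (indicator {0..} t * exp (- Re s * t)) * C" for t :: real
        using C by (auto simp: norm_mult indicator_def flow_pull_def)
    qed
    also have "\<dots> = C / Re s"
      using has_bochner_integral_integral_eq[OF integrable_exp_decay[OF s]] by simp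
    finally show ?thesis .
  qed
  then have i: "integrable M (\<lambda>g. resolvent s f g * \<psi> g)"
    by (intro integrable_mult_test[OF resolvent_measurable[OF f] _ \<psi>])
  have "R s (lie_deriv X_mat f) \<psi> = (\<integral>g. - (f g * \<psi> g)
    - s * (resolvent s f g * \<psi> g) \<partial>M)"
    unfolding R_eq[OF Xf \<psi> s] resolvent_X[OF f s] by (simp add: algebra_simps)
  also have "\<dots> = - (\<integral>g. f g * \<psi> g \<partial>M) - s * R s f \<psi>"
    unfolding R_eq[OF f \<psi> s]
    by (subst Bochner_Integration.integral_diff) (use i integrable_test_mult[OF f \<psi>] in auto)
  finally show ?thesis .
qed

lemma R_pull_right:
  assumes f: "f \<in> test_fun \<Gamma>" and \<psi>: "\<psi> \<in> test_fun \<Gamma>" and s: "0 < Re s"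
  shows "R s f (flow_pull T \<psi>) = R s (flow_pull (- T) f) \<psi>"
  unfolding R_corr[OF f test_fun_flow_pull[OF \<psi>] s] R_corr[OF test_fun_flow_pull[OF f] \<psi> s]
    corr_pull_left[OF f] corr_pull_right[OF f \<psi>] by simp

text \<open>Translating time by \<tau> expresses the left term by the tail of the Laplace integral
  from \<tau> on, times exp (\<epsilon> \<tau>). The missing piece over [0, \<tau>) is bounded and
  so is \<epsilon> R, so \<epsilon> times the difference tends to 0: the germ of the flow invariance
  of the residue at 0.\<close>

lemma R_pull_limit:
  assumes f: "f \<in> test_fun \<Gamma>" and \<psi>: "\<psi> \<in> test_fun \<Gamma>" and \<tau>: "0 \<le> \<tau>"
  shows "((\<lambda>\<epsilon>. of_real \<epsilon> * (R (of_real \<epsilon>) (flow_pull (- \<tau>) f) \<psi>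
    - R (of_real \<epsilon>) f \<psi>)) \<longlongrightarrow> 0) (at_right (0::real))"
proof (rule Lim_null_comparison)
  define K where "K = (energy f + energy \<psi>) / 2"
  show "((\<lambda>\<epsilon>. (exp (\<epsilon> * \<tau>) - 1) * K
    + \<epsilon> * exp (\<epsilon> * \<tau>) * (K * \<tau>)) \<longlongrightarrow> 0) (at_right (0::real))"
    by (auto intro!: tendsto_eq_intros)
  show "\<forall>\<^sub>F \<epsilon> in at_right (0::real). norm (of_real \<epsilon> * (R (of_real \<epsilon>)
    (flow_pull (- \<tau>) f) \<psi> - R (of_real \<epsilon>) f \<psi>)) 
     \<le> (exp (\<epsilon> * \<tau>) - 1) * K + \<epsilon> * exp (\<epsilon> * \<tau>) * (K * \<tau>)"
    using eventually_at_right_less[of "0::real"]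
  proof eventually_elim
    case (elim \<epsilon>)
    let ?s = "of_real \<epsilon> :: complex"
    have s: "0 < Re ?s" using elim by simp
    define h where "h t = exp (- ?s * of_real t) * corr f \<psi> t" for t
    have hint: "set_integrable lborel {0..} h"
      unfolding h_def by (rule set_integrable_corr(1)[OF f \<psi> s])
    have hint1: "set_integrable lborel {\<tau>..} h" "set_integrable lborel {0..<\<tau>} h"
      using hint \<tau> by (auto intro: set_integrable_subset)
    have "{0..} = {0..<\<tau>} \<union> {\<tau>..}" using \<tau> by auto
    then have split: "(LINT t:{0..}|lborel. h t) = (LINT t:{0..<\<tau>}|lborel. h t) + (LINT t:{\<tau>..}|lborel. h t)"
      by (simp only:) (rule set_integral_Un[OF _ hint1(2,1)], auto)
    have Rf: "R ?s f \<psi> = - (LINT t:{0..}|lborel. h t)"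
      unfolding h_def by (rule R_corr[OF f \<psi> s])
    have "(LINT t:{\<tau>..}|lborel. h t) = (\<integral>t. indicator {\<tau>..} (\<tau>
      + 1 * t) *\<^sub>R h (\<tau> + 1 * t) \<partial>lborel)"
      unfolding set_lebesgue_integral_def
      using lborel_integral_real_affine[of 1 "\<lambda>t. indicator {\<tau>..} t *\<^sub>R h t" \<tau>] by simp
    also have "\<dots> = (LINT t:{0..}|lborel. exp (- ?s * of_real \<tau>) * (exp (- ?s * of_real t) * corr f
      \<psi> (t + \<tau>)))"
      unfolding set_lebesgue_integral_def h_def
    proof (intro Bochner_Integration.integral_cong refl)
      fix t :: real
      have "exp (- ?s * of_real (\<tau> + 1 * t)) = exp (- ?s * of_real \<tau>) * exp (- ?s * of_real t)"
        by (simp add: exp_add[symmetric] algebra_simps)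
      then show "indicator {\<tau>..} (\<tau> + 1 * t) *\<^sub>R (exp (- ?s * of_real (\<tau>
        + 1 * t)) * corr f \<psi> (\<tau> + 1 * t)) =
         indicator {0..} t *\<^sub>R (exp (- ?s * of_real \<tau>) * (exp (- ?s * of_real t) * corr f \<psi> (t
           + \<tau>)))"
        by (simp only: mult.assoc) (auto simp: indicator_def add.commute)
    qed
    also have "\<dots> = - exp (- ?s * of_real \<tau>) * R ?s (flow_pull (- \<tau>) f) \<psi>"
      unfolding R_corr[OF test_fun_flow_pull[OF f] \<psi> s] corr_pull_left[OF f] set_integral_mult_right by simp
    finally have "R ?s (flow_pull (- \<tau>) f) \<psi> = - exp (?s * of_real \<tau>) * (LINT t:{\<tau>..}|lborel. h t)"
      by (simp add: exp_minus field_simps)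
    then have "R ?s (flow_pull (- \<tau>) f) \<psi> - R ?s f \<psi> = 
        (exp (?s * of_real \<tau>) - 1) * R ?s f \<psi> + exp (?s * of_real \<tau>) * (LINT t:{0..<\<tau>}|lborel. h t)"
      unfolding Rf split by (simp add: algebra_simps)
    then have "?s * (R ?s (flow_pull (- \<tau>) f) \<psi> - R ?s f \<psi>) = 
        (exp (?s * of_real \<tau>) - 1) * (?s * R ?s f \<psi>)
          + ?s * exp (?s * of_real \<tau>) * (LINT t:{0..<\<tau>}|lborel. h t)"
      by (simp add: algebra_simps)
    also have "norm \<dots> \<le> norm ((exp (?s * of_real \<tau>) - 1) * (?s * R ?s f \<psi>))
      + norm (?s * exp (?s * of_real \<tau>) * (LINT t:{0..<\<tau>}|lborel. h t))"
      by (rule norm_triangle_ineq)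
    also have "\<dots> \<le> (exp (\<epsilon> * \<tau>) - 1) * K
      + \<epsilon> * exp (\<epsilon> * \<tau>) * (K * \<tau>)"
    proof (rule add_mono)
      have e: "norm (exp (?s * of_real \<tau>) - 1) = exp (\<epsilon> * \<tau>) - 1"
      proof -
        have "exp (?s * of_real \<tau>) - 1 = of_real (exp (\<epsilon> * \<tau>) - 1)"
          by (simp flip: of_real_mult exp_of_real)
        also have "norm (of_real (exp (\<epsilon> * \<tau>) - 1) :: complex) = exp (\<epsilon> * \<tau>) - 1"
          unfolding norm_of_real using elim \<tau> by simp
        finally show ?thesis .
      qed
      have "norm (?s * R ?s f \<psi>) \<le> K"
        using R_bound[OF f \<psi> s] elim by (simp add: norm_mult K_def field_simps)
      then show "norm ((exp (?s * of_real \<tau>) - 1) * (?s * R ?s f \<psi>)) \<le> (exp (\<epsilon> * \<tau>)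
        - 1) * K"
        unfolding norm_mult[of "exp _ - 1"] e using elim \<tau> by (intro mult_left_mono) auto
      have "norm (LINT t:{0..<\<tau>}|lborel. h t) \<le> (\<integral>t. K * indicator {0..<\<tau>} t \<partial>lborel)"
        unfolding set_lebesgue_integral_def
      proof (rule order_trans[OF integral_norm_bound integral_mono[OF integrable_norm]])
        show "integrable lborel (\<lambda>t. indicator {0..<\<tau>} t *\<^sub>R h t)" using hint1
          by (simp add: set_integrable_def)
        show "integrable lborel (\<lambda>t. K * indicator {0..<\<tau>} t)" using \<tau>
          by (intro integrable_mult_right integrable_real_indicator) auto
        fix t :: real
        have "norm (h t) \<le> K" if "t \<ge> 0"
        proof -
          have "norm (h t) = exp (- \<epsilon> * t) * norm (corr f \<psi> t)" by (simp add: h_def norm_mult)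
          also have "\<dots> \<le> 1 * K" unfolding K_def using that elim
            by (intro mult_mono norm_corr_le f \<psi>) auto
          finally show ?thesis by simp
        qed
        then show "norm (indicator {0..<\<tau>} t *\<^sub>R h t) \<le> K * indicator {0..<\<tau>} t"
          by (auto simp: indicator_def)
      qed
      also have "\<dots> = K * \<tau>" using \<tau> by simp
      finally show "norm (?s * exp (?s * of_real \<tau>) * (LINT t:{0..<\<tau>}|lborel. h t))
        \<le> \<epsilon> * exp (\<epsilon> * \<tau>) * (K * \<tau>)"
        unfolding norm_mult using elim by (intro mult_mono) auto
    qed
    finally show ?case .
  qed
qed

end

section \<open>The residues of the extended resolvent\<close>

lemma residue_power_term:
  "residue (\<lambda>s. (s - p) ^ j * (a / (s - p) ^ k)) p = (if k = Suc j then a else 0)"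
proof (cases "k \<le> j")
  case True
  have "residue (\<lambda>s. (s - p) ^ j * (a / (s - p) ^ k)) p = residue (\<lambda>s. a * (s - p) ^ (j - k)) p"
    by (rule residue_cong) (auto simp: eventually_at_filter power_diff True)
  also have "\<dots> = 0" by (rule residue_holo[of UNIV]) (auto intro!: holomorphic_intros)
  finally show ?thesis using True by simp
next
  case False
  then obtain n where n: "k = Suc n + j" by (metis add.commute add_Suc_right less_imp_Suc_add not_le)
  have "residue (\<lambda>s. (s - p) ^ j * (a / (s - p) ^ k)) p = residue (\<lambda>s. a / (s - p) ^ Suc n) p"
    by (rule residue_cong) (auto simp: eventually_at_filter n power_add)
  also have "\<dots> = (deriv ^^ n) (\<lambda>_. a) p / fact n"
    by (rule residue_holomorphic_over_power[of UNIV]) auto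
  also have "\<dots> = (if k = Suc j then a else 0)"
    by (cases n) (auto simp: n higher_deriv_const)
  finally show ?thesis .
qed

text \<open>\<open>N\<close> only bounds the order of the pole: coefficients may vanish, and N = 0
  covers points where the function extends holomorphically.\<close>

definition laurent_at :: "(complex \<Rightarrow> complex) \<Rightarrow> complex \<Rightarrow> nat \<Rightarrow>
  (nat \<Rightarrow> complex) \<Rightarrow> bool" where
  "laurent_at g p N a \<longleftrightarrow> (\<exists>r>0. \<exists>h. h holomorphic_on ball p r \<and>
     (\<forall>s\<in>ball p r - {p}. g s = h s + (\<Sum>k=1..N. a k / (s - p) ^ k)))"

lemma laurent_holomorphic:
  assumes "laurent_at g p N a"
  obtains r where "r > 0" "g holomorphic_on ball p r - {p}"
proof -
  obtain r h where r: "r > 0" and h: "h holomorphic_on ball p r"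
    and g: "\<And>s. s \<in> ball p r - {p} \<Longrightarrow> g s = h s + (\<Sum>k=1..N. a k / (s - p) ^ k)"
    using assms unfolding laurent_at_def by blast
  have "(\<lambda>s. h s + (\<Sum>k=1..N. a k / (s - p) ^ k)) holomorphic_on ball p r - {p}"
    by (intro holomorphic_intros holomorphic_on_subset[OF h]) auto
  then have "g holomorphic_on ball p r - {p}"
    by (rule holomorphic_transform) (use g in auto)
  with r show ?thesis by (rule that)
qed

text \<open>The factor (s - p)^j moves the coefficient of order j + 1 into the position of the
  residue, hence \<open>Suc j\<close>.\<close>

lemma residue_laurent:
  assumes "laurent_at g p N a"
  shows "residue (\<lambda>s. (s - p) ^ j * g s) p = (if j < N then a (Suc j) else 0)"
proof -
  obtain r h where r: "r > 0" and h: "h holomorphic_on ball p r"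
    and g: "\<And>s. s \<in> ball p r - {p} \<Longrightarrow> g s = h s + (\<Sum>k=1..N. a k / (s - p) ^ k)"
    using assms unfolding laurent_at_def by blast
  have hol: "(\<lambda>s. (s - p) ^ j * (h s + (\<Sum>k=1..n. a k / (s - p) ^ k))) holomorphic_on ball p r - {p}" for n
    by (intro holomorphic_intros holomorphic_on_subset[OF h]) auto
  have "residue (\<lambda>s. (s - p) ^ j * (h s + (\<Sum>k=1..n. a k / (s - p) ^ k))) p
    = (if j < n then a (Suc j) else 0)" for n
  proof (induction n)
    case 0
    have "residue (\<lambda>s. (s - p) ^ j * h s) p = 0"
      by (rule residue_holo[of "ball p r"]) (use r in \<open>auto intro!: holomorphic_intros h\<close>)
    then show ?case by simp
  next
    case (Suc n)
    have "residue (\<lambda>s. (s - p) ^ j * (h s + (\<Sum>k=1..Suc n. a k / (s - p) ^ k))) p = 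
        residue (\<lambda>s. (s - p) ^ j * (h s + (\<Sum>k=1..n. a k / (s - p) ^ k)) + (s
          - p) ^ j * (a (Suc n) / (s - p) ^ Suc n)) p"
      by (simp add: algebra_simps)
    also have "\<dots> = residue (\<lambda>s. (s - p) ^ j * (h s + (\<Sum>k=1..n. a k / (s - p) ^ k))) p
      + residue (\<lambda>s. (s - p) ^ j * (a (Suc n) / (s - p) ^ Suc n)) p"
      by (rule residue_add[OF open_ball _ hol]) (use r in \<open>auto intro!: holomorphic_intros\<close>)
    also have "\<dots> = (if j < n then a (Suc j) else 0) + (if Suc n = Suc j then a (Suc n) else 0)"
      by (simp only: Suc.IH residue_power_term)
    finally show ?case by auto
  qed
  moreover have "residue (\<lambda>s. (s - p) ^ j * g s) p = residue (\<lambda>s. (s - p) ^ j * (h s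
    + (\<Sum>k=1..N. a k / (s - p) ^ k))) p"
  proof (rule residue_cong)
    have "\<forall>\<^sub>F s in at p. s \<in> ball p r - {p}"
      using r by (intro eventually_at_in_open) auto
    then show "\<forall>\<^sub>F s in at p. (s - p) ^ j * g s = (s - p) ^ j * (h s + (\<Sum>k=1..N. a k / (s - p) ^ k))"
      by eventually_elim (simp add: g)
  qed simp
  ultimately show ?thesis by simp
qed

text \<open>Growth of order 1/e along a single real ray already excludes poles of order two and
  more; what remains of \<open>e * g (p + e)\<close> converges to the residue.\<close>

lemma laurent_limit:
  assumes L: "laurent_at g p N a"
    and bound: "\<And>e. e > 0 \<Longrightarrow> norm (of_real e * g (p + of_real e)) \<le> C"
  shows "((\<lambda>e. of_real e * g (p + of_real e)) \<longlongrightarrow> residue g p) (at_right 0)"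
proof -
  obtain r h where r: "r > 0" and h: "h holomorphic_on ball p r"
    and g: "\<And>s. s \<in> ball p r - {p} \<Longrightarrow> g s = h s + (\<Sum>k=1..N. a k / (s - p) ^ k)"
    using L unfolding laurent_at_def by blast
  have ev: "\<forall>\<^sub>F e in at_right (0::real). e \<in> {0<..<r}"
    using r by (rule eventually_at_right_real)
  have eq: "of_real e * g (p + of_real e) = of_real e * h (p + of_real e)
    + (\<Sum>k=1..N. of_real e * a k / of_real e ^ k)"
    if "e \<in> {0<..<r}" for e
    using g[of "p + of_real e"] that by (simp add: dist_norm algebra_simps sum_distrib_left)
  have "isCont h p"
    using holomorphic_on_imp_continuous_on[OF h] r by (simp add: continuous_on_eq_continuous_at)
  moreover have "((\<lambda>e. p + of_real e) \<longlongrightarrow> p) (at_right (0::real))"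
    by (auto intro!: tendsto_eq_intros)
  ultimately have hlim: "((\<lambda>e. h (p + of_real e)) \<longlongrightarrow> h p) (at_right (0::real))"
    by (rule isCont_tendsto_compose)
  have e0: "((\<lambda>e. complex_of_real e) \<longlongrightarrow> 0) (at_right 0)"
    by (auto intro!: tendsto_eq_intros)
  have zero: "a k = 0" if "k \<ge> 2" "k \<le> N" for k
  proof (rule ccontr)
    assume "a k \<noteq> 0"
    \<comment> \<open>The true order of the pole, if it exceeds 1. Then \<open>e^(m-1)\<close> times
      the bounded \<open>e * g\<close> tends to 0 and to \<open>a m\<close> at once.\<close>
    define m where "m = Max {k\<in>{2..N}. a k \<noteq> 0}"
    have ne: "{k\<in>{2..N}. a k \<noteq> 0} \<noteq> {}" using \<open>a k \<noteq> 0\<close> that by auto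
    have m: "m \<ge> 2" "m \<le> N" "a m \<noteq> 0" using Max_in[OF _ ne] by (auto simp: m_def)
    have above: "a k = 0" if "k > m" "k \<le> N" for k
    proof (rule ccontr)
      assume "a k \<noteq> 0"
      then have "k \<le> m" unfolding m_def using that m by (intro Max_ge) auto
      with that show False by simp
    qed
    have lhs: "((\<lambda>e. of_real e ^ (m - 1) * (of_real e * g (p
      + of_real e))) \<longlongrightarrow> 0) (at_right 0)"
    proof (rule Lim_null_comparison)
      show "((\<lambda>e. e ^ (m - 1) * C) \<longlongrightarrow> 0) (at_right (0::real))"
        using m by (auto intro!: tendsto_eq_intros)
      show "\<forall>\<^sub>F e in at_right 0. norm (of_real e ^ (m - 1) * (of_real e * g (p + of_real e)))
        \<le> e ^ (m - 1) * C"
        using ev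
      proof eventually_elim
        case (elim e)
        then show ?case using bound[of e] unfolding norm_mult[of "of_real e ^ (m-1)"] norm_power
          by (intro mult_mono) auto
      qed
    qed
    have "((\<lambda>e. of_real e ^ m * h (p + of_real e) + (\<Sum>k=1..m. a k * of_real e ^ (m
      - k))) \<longlongrightarrow> 
        0 ^ m * h p + (\<Sum>k=1..m. a k * 0 ^ (m - k))) (at_right (0::real))"
      by (intro tendsto_intros e0 hlim)
    also have "0 ^ m * h p + (\<Sum>k=1..m. a k * 0 ^ (m - k)) = a m"
    proof -
      have "(\<Sum>k=1..m. a k * 0 ^ (m - k)) = (\<Sum>k=1..m. if k = m then a k else 0)"
        by (intro sum.cong) auto
      then show ?thesis using m by simp
    qed
    finally have rhs: "((\<lambda>e. of_real e ^ m * h (p + of_real e) + (\<Sum>k=1..m. a k * of_real e ^ (m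
      - k))) \<longlongrightarrow> a m) (at_right (0::real))" .
    have "((\<lambda>e. of_real e ^ (m - 1) * (of_real e * g (p + of_real e))) \<longlongrightarrow> a m) (at_right 0)"
    proof (rule Lim_transform_eventually[OF rhs])
      show "\<forall>\<^sub>F e in at_right 0. of_real e ^ m * h (p + of_real e)
        + (\<Sum>k=1..m. a k * of_real e ^ (m - k)) = of_real e ^ (m - 1) * (of_real e * g (p + of_real e))"
        using ev
      proof eventually_elim
        case (elim e)
        have "(\<Sum>k=1..N. of_real e * a k / of_real e ^ k) = (\<Sum>k=1..m. of_real e * a k / of_real e ^ k)"
          using above m by (intro sum.mono_neutral_right) auto
        then have "of_real e ^ (m - 1) * (of_real e * g (p + of_real e)) = of_real e ^ (m
          - 1) * (of_real e * h (p + of_real e))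
           + (\<Sum>k=1..m. of_real e ^ (m - 1) * (of_real e * a k / of_real e ^ k))"
          unfolding eq[OF elim] by (simp add: distrib_left sum_distrib_left)
        also have "(\<Sum>k=1..m. of_real e ^ (m - 1) * (of_real e * a k / of_real e ^ k))
          = (\<Sum>k=1..m. a k * of_real e ^ (m - k))"
        proof (intro sum.cong refl)
          fix k assume k: "k \<in> {1..m}"
          have "complex_of_real e ^ m = of_real e ^ (m - k) * of_real e ^ k" using k by (simp flip: power_add)
          moreover have "complex_of_real e ^ m = of_real e ^ (m - 1) * of_real e" using m
            by (metis One_nat_def Suc_diff_le Suc_1 diff_Suc_Suc le_trans minus_nat.diff_0 nat_le_linear
              not_less_eq_eq power_Suc2)
          ultimately show "of_real e ^ (m - 1) * (of_real e * a k / of_real e ^ k) = a k * of_real e ^ (m - k)"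
            using elim by (simp add: field_simps)
        qed
        also have "complex_of_real e ^ (m - 1) * (of_real e * h (p + of_real e)) = of_real e ^ m * h (p + of_real e)"
          using m by (cases m) auto
        finally show ?case by simp
      qed
    qed
    with lhs have "a m = 0" by (intro tendsto_unique[OF _ _ lhs]) auto
    with m show False by simp
  qed
  have "((\<lambda>e. of_real e * h (p + of_real e) + residue g p) \<longlongrightarrow> 0 * h p
    + residue g p) (at_right 0)"
    by (intro tendsto_intros e0 hlim)
  then have "((\<lambda>e. of_real e * h (p + of_real e) + residue g p) \<longlongrightarrow> residue g p)
    (at_right 0)" by simp
  then show ?thesis
  proof (rule Lim_transform_eventually)
    have res: "residue g p = (if 0 < N then a 1 else 0)"
      using residue_laurent[OF L, of 0] by simp
    show "\<forall>\<^sub>F e in at_right 0. of_real e * h (p + of_real e) + residue g p = of_real e * g (p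
      + of_real e)"
      using ev
    proof eventually_elim
      case (elim e)
      have "(\<Sum>k=1..N. of_real e * a k / of_real e ^ k) = (\<Sum>k\<in>(if 0 < N then {1} else {}). of_real
        e * a k / of_real e ^ k)"
        using zero by (intro sum.mono_neutral_right) (auto simp: Suc_le_eq split: if_splits)
      also have "\<dots> = residue g p" using elim by (simp add: res)
      finally show ?case using eq[OF elim] by simp
    qed
  qed
qed

text \<open>A sparse set is closed and does not disconnect the plane, so the identity theorem
  applies on its complement.\<close>

lemma holomorphic_identity:
  assumes Q: "Q sparse_in (UNIV :: complex set)" and F: "F holomorphic_on - Q" "G holomorphic_on - Q"
    and eq: "\<And>s. 1 < Re s \<Longrightarrow> F s = G s" and s: "s \<notin> Q"
  shows "F s = G s"
proof (rule analytic_continuation_open[where s = "{s. 1 < Re s} - Q" and s' = "- Q" and f = F and g = G])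
  have cl: "closed Q" by (rule sparse_in_UNIV_imp_closed[OF Q])
  show "open ({s. 1 < Re s} - Q)"
    by (intro open_Diff cl open_halfspace_Re_gt)
  show "open (- Q)" using cl by (simp add: open_Compl)
  \<comment> \<open>A ball inside the half-plane is uncountable and \<open>Q\<close> is countable,
    so the open set of known agreement is not empty.\<close>
  have "countable Q" using sparse_imp_countable[OF open_UNIV Q] by simp
  moreover have "uncountable (ball (3::complex) 1)" by (simp add: uncountable_ball)
  ultimately have "\<not> ball (3::complex) 1 \<subseteq> Q" using countable_subset by blast
  then obtain z where z: "z \<in> ball (3::complex) 1" "z \<notin> Q" by blast
  have "\<bar>Re (3 - z)\<bar> < 1" using z abs_Re_le_cmod[of "3 - z"] by (simp add: dist_norm)
  then have "z \<in> {s. 1 < Re s} - Q" using z by auto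
  then show "{s. 1 < Re s} - Q \<noteq> {}" by blast
  show "connected (- Q)"
    using sparse_imp_connected[OF _ connected_UNIV open_UNIV Q] by (simp add: Compl_eq_Diff_UNIV)
qed (use F eq s in auto)

lemma distributions_lincomb:
  assumes "u \<in> distributions \<Gamma>" "f \<in> test_fun \<Gamma>" "h \<in> test_fun \<Gamma>"
  shows "u (\<lambda>g. a * f g + b * h g) = a * u f + b * u h"
  using assms by (simp add: distributions_def)

lemma zero_distribution: "(\<lambda>\<psi>. 0) \<in> distributions \<Gamma>"
  by (auto simp: distributions_def intro: exI[of _ 0])

context surface_resolvent
begin

section \<open>Laurent coefficients of the extended resolvent\<close>

definition pole_expansion :: "complex \<Rightarrow> bool" where
  "pole_expansion p \<longleftrightarrow> (\<exists>N A H r. 0 < r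
    \<and> (\<forall>k\<in>{1..N::nat}. cont_operator \<Gamma> (A k)) \<and>
        holomorphic_family \<Gamma> (ball p r) H \<and>
        (\<forall>s\<in>ball p r - {p}. \<forall>f\<in>test_fun \<Gamma>. \<forall>\<psi>\<in>test_fun \<Gamma>.
           R s f \<psi> = H s f \<psi> + (\<Sum>k=1..N. A k f \<psi> / (s - p) ^ k)))"

text \<open>One admissible exceptional set, fixed once. It may contain regular points, and the
  values of \<open>R\<close> on it need not be the continued ones; identities continued from the
  half-plane therefore avoid it, whereas residues see only punctured neighbourhoods.\<close>

definition poles :: "complex set" where
  "poles = (SOME P. P sparse_in UNIV \<and> holomorphic_family \<Gamma> (- P) R
    \<and> (\<forall>p\<in>P. pole_expansion p))"

lemma poles: "poles sparse_in UNIV" "holomorphic_family \<Gamma> (- poles) R" "p \<in> poles \<Longrightarrow>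
  pole_expansion p"
proof -
  have "\<exists>P. P sparse_in UNIV \<and> holomorphic_family \<Gamma> (- P) R
    \<and> (\<forall>p\<in>P. pole_expansion p)"
    using R unfolding resolvent_extension_def meromorphic_family_def pole_expansion_def by (elim conjE)
  note * = someI_ex[OF this, folded poles_def]
  show "poles sparse_in UNIV" "holomorphic_family \<Gamma> (- poles) R" "p \<in> poles \<Longrightarrow>
    pole_expansion p"
    using * by blast+
qed

lemma laurent_coefficients:
  obtains N A where "\<And>k. k \<in> {1..N::nat} \<Longrightarrow> cont_operator \<Gamma> (A k)"
    "\<And>f \<psi>. f \<in> test_fun \<Gamma> \<Longrightarrow> \<psi> \<in> test_fun \<Gamma> \<Longrightarrow>
      laurent_at (\<lambda>s. R s f \<psi>) p N (\<lambda>k. A k f \<psi>)"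
proof (cases "p \<in> poles")
  case True
  from poles(3)[OF this] obtain N A H r where *: "0 < r" "\<forall>k\<in>{1..N::nat}. cont_operator \<Gamma> (A k)"
     "holomorphic_family \<Gamma> (ball p r) H"
     "\<forall>s\<in>ball p r - {p}. \<forall>f\<in>test_fun \<Gamma>. \<forall>\<psi>\<in>test_fun \<Gamma>. R
       s f \<psi> = H s f \<psi> + (\<Sum>k=1..N. A k f \<psi> / (s - p) ^ k)"
    unfolding pole_expansion_def by (elim exE conjE) (rule that)
  show ?thesis
  proof (rule that[of N A])
    fix f \<psi> assume t: "f \<in> test_fun \<Gamma>" "\<psi> \<in> test_fun \<Gamma>"
    then have "(\<lambda>s. H s f \<psi>) holomorphic_on ball p r" using *(3) by (simp add: holomorphic_family_def)
    then show "laurent_at (\<lambda>s. R s f \<psi>) p N (\<lambda>k. A k f \<psi>)"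
      unfolding laurent_at_def using *(1) *(4) t by blast
  qed (use *(2) in blast)
next
  case False
  have "open (- poles)" using sparse_in_UNIV_imp_closed[OF poles(1)] by (simp add: open_Compl)
  then obtain r where r: "r > 0" "ball p r \<subseteq> - poles" using False openE by blast
  show ?thesis
  \<comment> \<open>Off \<open>poles\<close> there is no principal part; with N = 0 the sum is empty
    and the coefficients are never evaluated.\<close>
  proof (rule that[of 0 undefined])
    fix f \<psi> assume t: "f \<in> test_fun \<Gamma>" "\<psi> \<in> test_fun \<Gamma>"
    then have "(\<lambda>s. R s f \<psi>) holomorphic_on - poles" using poles(2) by (simp add: holomorphic_family_def)
    then have "(\<lambda>s. R s f \<psi>) holomorphic_on ball p r" using r by (meson holomorphic_on_subset)
    then show "laurent_at (\<lambda>s. R s f \<psi>) p 0 (\<lambda>k. undefined k f \<psi>)"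
      unfolding laurent_at_def using r by (intro exI[of _ r] conjI exI[of _ "\<lambda>s. R s f \<psi>"]) auto
  qed auto
qed

text \<open>The Laurent coefficient of order k + 1. By \<open>Res_X\<close> it is the residue
  applied to (- X - p)^k f, so the higher coefficients record the nilpotent part of \<open>X\<close>
  on the resonant states.\<close>

definition Res :: "nat \<Rightarrow> complex \<Rightarrow> operator" where
  "Res k p f \<psi> = residue (\<lambda>s. (s - p) ^ k * R s f \<psi>) p"

text \<open>The coefficients of the principal part are continuous operators by definition of a
  meromorphic family. From here the residue inherits linearity in both arguments and takes values in
  distributions.\<close>

lemma Res_operator:
  "\<exists>A. cont_operator \<Gamma> A \<and> (\<forall>f\<in>test_fun \<Gamma>. \<forall>\<psi>\<in>test_fun
    \<Gamma>. Res k p f \<psi> = A f \<psi>)"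
proof -
  obtain N A where *: "\<And>k. k \<in> {1..N::nat} \<Longrightarrow> cont_operator \<Gamma> (A k)"
    "\<And>f \<psi>. f \<in> test_fun \<Gamma> \<Longrightarrow> \<psi> \<in> test_fun \<Gamma> \<Longrightarrow>
      laurent_at (\<lambda>s. R s f \<psi>) p N (\<lambda>k. A k f \<psi>)"
    by (rule laurent_coefficients[of p]) blast
  have z: "cont_operator \<Gamma> (\<lambda>f \<psi>. 0)"
    unfolding cont_operator_def using zero_distribution by simp
  show ?thesis
  proof (intro exI[of _ "if k < N then A (Suc k) else (\<lambda>f \<psi>. 0)"] conjI ballI)
    show "cont_operator \<Gamma> (if k < N then A (Suc k) else (\<lambda>f \<psi>. 0))" using * z by auto
    fix f \<psi> assume "f \<in> test_fun \<Gamma>" "\<psi> \<in> test_fun \<Gamma>"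
    from residue_laurent[OF *(2)[OF this], of k]
    show "Res k p f \<psi> = (if k < N then A (Suc k) else (\<lambda>f \<psi>. 0)) f \<psi>" by (simp add: Res_def)
  qed
qed

text \<open>The bound on the pole order at p is fixed before the test functions, which yields a
  nilpotency index common to the whole range of the residue.\<close>

lemma Res_eventually_zero:
  "\<exists>N. \<forall>f\<in>test_fun \<Gamma>. \<forall>\<psi>\<in>test_fun \<Gamma>. Res N p f \<psi> = 0"
proof -
  obtain N A where *: "\<And>k. k \<in> {1..N::nat} \<Longrightarrow> cont_operator \<Gamma> (A k)"
    "\<And>f \<psi>. f \<in> test_fun \<Gamma> \<Longrightarrow> \<psi> \<in> test_fun \<Gamma> \<Longrightarrow>
      laurent_at (\<lambda>s. R s f \<psi>) p N (\<lambda>k. A k f \<psi>)"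
    by (rule laurent_coefficients[of p]) blast
  then show ?thesis by (intro exI[of _ N]) (auto simp: Res_def residue_laurent[OF *(2)])
qed

lemma R_punctured_holomorphic:
  assumes "f \<in> test_fun \<Gamma>" "\<psi> \<in> test_fun \<Gamma>"
  obtains r where "r > 0" "(\<lambda>s. R s f \<psi>) holomorphic_on ball p r - {p}"
proof -
  obtain N A where "\<And>f \<psi>. f \<in> test_fun \<Gamma> \<Longrightarrow>
    \<psi> \<in> test_fun \<Gamma> \<Longrightarrow> laurent_at (\<lambda>s. R s f \<psi>) p N (\<lambda>k. A k
      f \<psi>)"
    by (rule laurent_coefficients[of p]) blast
  with assms show ?thesis using laurent_holomorphic that by metis
qed

lemma Res_left_lincomb:
  assumes "f \<in> test_fun \<Gamma>" "h \<in> test_fun \<Gamma>" "\<psi> \<in> test_fun \<Gamma>"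
  shows "Res k p (\<lambda>g. a * f g + b * h g) \<psi> = a * Res k p f \<psi> + b * Res k p h \<psi>"
proof -
  obtain A where A: "cont_operator \<Gamma> A" "\<And>f \<psi>. f \<in> test_fun \<Gamma> \<Longrightarrow>
    \<psi> \<in> test_fun \<Gamma> \<Longrightarrow> Res k p f \<psi> = A f \<psi>"
    using Res_operator by blast
  have "(\<lambda>f. if f \<in> test_fun \<Gamma> then A f \<psi> else 0) \<in> distributions \<Gamma>"
    using A assms by (simp add: cont_operator_def)
  from distributions_lincomb[OF this assms(1,2), of a b] show ?thesis
    using assms A(2) test_fun_lincomb[OF assms(1,2)] by simp
qed

lemma Res_right_lincomb:
  assumes "f \<in> test_fun \<Gamma>" "\<phi> \<in> test_fun \<Gamma>" "\<psi> \<in> test_fun \<Gamma>"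
  shows "Res k p f (\<lambda>g. a * \<phi> g + b * \<psi> g) = a * Res k p f \<phi> + b * Res k p f \<psi>"
proof -
  obtain A where A: "cont_operator \<Gamma> A" "\<And>f \<psi>. f \<in> test_fun \<Gamma> \<Longrightarrow>
    \<psi> \<in> test_fun \<Gamma> \<Longrightarrow> Res k p f \<psi> = A f \<psi>"
    using Res_operator by blast
  have "A f \<in> distributions \<Gamma>"
    using A assms by (simp add: cont_operator_def)
  from distributions_lincomb[OF this assms(2,3), of a b] show ?thesis
    using assms A(2) test_fun_lincomb[OF assms(2,3)] by simp
qed

text \<open>Both sides are holomorphic off \<open>poles\<close> and its translate by the weight, so
  the relation spreads from Re s > 1 to the rest of the plane.\<close>

lemma R_lie_deriv:
  assumes f: "f \<in> test_fun \<Gamma>" and \<psi>: "\<psi> \<in> test_fun \<Gamma>" and V: "V \<in> frame"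
    and s: "s \<notin> poles" "s - of_real (weight V) \<notin> poles"
  shows "R s f (lie_deriv V \<psi>) = - R (s - of_real (weight V)) (lie_deriv V f) \<psi>"
proof (rule holomorphic_identity[where F = "\<lambda>s. R s f (lie_deriv V \<psi>)" and G = "\<lambda>s. - R (s
  - of_real (weight V)) (lie_deriv V f) \<psi>"])
  let ?w = "of_real (weight V) :: complex"
  let ?Q = "poles \<union> (+) ?w ` poles"
  show "?Q sparse_in UNIV"
    by (intro sparse_in_union' poles sparse_in_translate_UNIV)
  have hol: "(\<lambda>s. R s f \<psi>) holomorphic_on - poles" if "f \<in> test_fun \<Gamma>"
    "\<psi> \<in> test_fun \<Gamma>" for f \<psi>
    using poles(2) that by (simp add: holomorphic_family_def)
  show "(\<lambda>s. R s f (lie_deriv V \<psi>)) holomorphic_on - ?Q"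
    by (rule holomorphic_on_subset[OF hol[OF f test_fun_lie_deriv[OF \<psi> V]]]) auto
  have "((\<lambda>s. R s (lie_deriv V f) \<psi>) \<circ> (\<lambda>s. s - ?w)) holomorphic_on - ?Q"
  proof (rule holomorphic_on_compose_gen[OF _ hol[OF test_fun_lie_deriv[OF f V] \<psi>]])
    show "(\<lambda>s. s - ?w) ` (- ?Q) \<subseteq> - poles"
      by (auto simp: image_iff) (metis add.commute diff_add_cancel)
  qed (intro holomorphic_intros)
  then show "(\<lambda>s. - R (s - ?w) (lie_deriv V f) \<psi>) holomorphic_on - ?Q"
    by (intro holomorphic_intros) (simp add: o_def)
  show "s \<notin> ?Q" using s by auto
qed (rule R_lie_deriv_half_plane[OF f \<psi> V])

lemma R_X:
  assumes f: "f \<in> test_fun \<Gamma>" and \<psi>: "\<psi> \<in> test_fun \<Gamma>" and s: "s \<notin> poles"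
  shows "R s (lie_deriv X_mat f) \<psi> = - (\<integral>g. f g * \<psi> g \<partial>M) - s * R s f \<psi>"
proof (rule holomorphic_identity[OF poles(1) _ _ _ s])
  have hol: "(\<lambda>s. R s f \<psi>) holomorphic_on - poles" if "f \<in> test_fun \<Gamma>"
    "\<psi> \<in> test_fun \<Gamma>" for f \<psi>
    using poles(2) that by (simp add: holomorphic_family_def)
  show "(\<lambda>s. R s (lie_deriv X_mat f) \<psi>) holomorphic_on - poles"
    by (rule hol[OF test_fun_lie_deriv[OF f in_frame(1)] \<psi>])
  show "(\<lambda>s. - (\<integral>g. f g * \<psi> g \<partial>M) - s * R s f \<psi>) holomorphic_on - poles"
    by (intro holomorphic_intros hol f \<psi>)
qed (rule R_X_half_plane[OF f \<psi>], simp)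

text \<open>Translating the variable by the weight turns the behaviour of R (s - w) at p into that
  of \<open>R\<close> at p - w, and the power (s - p)^k is translated along.\<close>

lemma Res_lie_deriv:
  assumes f: "f \<in> test_fun \<Gamma>" and \<psi>: "\<psi> \<in> test_fun \<Gamma>" and V: "V \<in> frame"
  shows "Res k p f (lie_deriv V \<psi>) = - Res k (p - of_real (weight V)) (lie_deriv V f) \<psi>"
proof -
  let ?w = "of_real (weight V) :: complex"
  let ?Q = "poles \<union> (+) ?w ` poles"
  let ?f = "lie_deriv V f"
  note Vf = test_fun_lie_deriv[OF f V]
  have "?Q sparse_in UNIV"
    by (intro sparse_in_union' poles sparse_in_translate_UNIV)
  then have ev: "\<forall>\<^sub>F s in at p. s \<notin> ?Q" by (simp add: sparse_in_eventually_iff)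
  have "Res k p f (lie_deriv V \<psi>) = residue (\<lambda>s. - ((s - p) ^ k * R (s - ?w) ?f \<psi>)) p"
    unfolding Res_def
  proof (rule residue_cong)
    show "\<forall>\<^sub>F s in at p. (s - p) ^ k * R s f (lie_deriv V \<psi>) = - ((s - p) ^ k * R (s
      - ?w) ?f \<psi>)"
      using ev
    proof eventually_elim
      case (elim s)
      then have "s \<notin> poles" "s - ?w \<notin> poles" by (auto simp: image_iff)
      then show ?case using R_lie_deriv[OF f \<psi> V] by simp
    qed
  qed simp
  also have "\<dots> = residue (\<lambda>s. - ((s - (p - ?w)) ^ k * R s ?f \<psi>)) (p - ?w)"
    by (subst (1 2) residue_shift_0) (simp add: algebra_simps)
  also have "\<dots> = - Res k (p - ?w) ?f \<psi>"
  proof -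
    obtain r where "r > 0" "(\<lambda>s. R s ?f \<psi>) holomorphic_on ball (p - ?w) r - {p - ?w}"
      using R_punctured_holomorphic[OF Vf \<psi>] by blast
    then show ?thesis
      unfolding Res_def by (intro residue_neg[of "ball (p - ?w) r"]) (auto intro!: holomorphic_intros)
  qed
  finally show ?thesis .
qed

text \<open>Write s = (s - p) + p in \<open>R_X\<close>: the first summand raises the index, the
  second gives the multiple of p, and the pairing of f with \<psi> does not depend on s, so it has
  no residue.\<close>

lemma Res_X:
  assumes f: "f \<in> test_fun \<Gamma>" and \<psi>: "\<psi> \<in> test_fun \<Gamma>"
  shows "Res k p (lie_deriv X_mat f) \<psi> = - Res (Suc k) p f \<psi> - p * Res k p f \<psi>"
proof -
  let ?c = "\<integral>g. f g * \<psi> g \<partial>M"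
  have ev: "\<forall>\<^sub>F s in at p. s \<notin> poles" using poles(1) by (simp add: sparse_in_eventually_iff)
  obtain r where r: "r > 0" "(\<lambda>s. R s f \<psi>) holomorphic_on ball p r - {p}"
    using R_punctured_holomorphic[OF f \<psi>] by blast
  have centre: "p \<in> ball p r" using r by simp
  have "Res k p (lie_deriv X_mat f) \<psi> = residue (\<lambda>s. (- ?c * (s - p) ^ k - (s
    - p) ^ Suc k * R s f \<psi>) - p * ((s - p) ^ k * R s f \<psi>)) p"
    unfolding Res_def
  proof (rule residue_cong)
    show "\<forall>\<^sub>F s in at p. (s - p) ^ k * R s (lie_deriv X_mat f) \<psi> = (- ?c * (s - p) ^ k - (s
      - p) ^ Suc k * R s f \<psi>) - p * ((s - p) ^ k * R s f \<psi>)"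
      using ev
    proof eventually_elim
      case (elim s)
      have "y * (- c - s * x) = (- c * y - ((s - p) * y) * x) - p * (y * x)" for y c x :: complex
        by (simp add: algebra_simps)
      then show ?case unfolding R_X[OF f \<psi> elim] power_Suc .
    qed
  qed simp
  also have "\<dots> = residue (\<lambda>s. - ?c * (s - p) ^ k - (s - p) ^ Suc k * R s f \<psi>) p
    - residue (\<lambda>s. p * ((s - p) ^ k * R s f \<psi>)) p"
    by (rule residue_diff[OF open_ball centre]) (intro holomorphic_intros r)+
  also have "residue (\<lambda>s. - ?c * (s - p) ^ k - (s - p) ^ Suc k * R s f \<psi>) p = residue (\<lambda>s.
    - ?c * (s - p) ^ k) p - residue (\<lambda>s. (s - p) ^ Suc k * R s f \<psi>) p"
    by (rule residue_diff[OF open_ball centre]) (intro holomorphic_intros r)+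
  also have "residue (\<lambda>s. - ?c * (s - p) ^ k) p = 0"
    by (rule residue_holo[of UNIV]) (auto intro!: holomorphic_intros)
  also have "residue (\<lambda>s. p * ((s - p) ^ k * R s f \<psi>)) p = p * Res k p f \<psi>"
    unfolding Res_def by (rule residue_lmul[OF open_ball centre]) (intro holomorphic_intros r)
  finally show ?thesis by (simp add: Res_def)
qed

text \<open>For Re p \<ge> 0 one has Re (p + e) \<ge> e, so the half-plane bound on \<open>R\<close>
  keeps e R (p + e) bounded. Poles on the imaginary axis are therefore at most simple.\<close>

lemma Res_limit:
  assumes f: "f \<in> test_fun \<Gamma>" and \<psi>: "\<psi> \<in> test_fun \<Gamma>" and p: "0 \<le> Re p"
  shows "((\<lambda>e. of_real e * R (p + of_real e) f \<psi>) \<longlongrightarrow> Res 0 p f \<psi>) (at_right 0)"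
proof -
  obtain N A where *: "laurent_at (\<lambda>s. R s f \<psi>) p N (\<lambda>k. A k f \<psi>)"
    by (rule laurent_coefficients[of p]) (use f \<psi> in blast)
  let ?K = "(energy f + energy \<psi>) / 2"
  have "norm (of_real e * R (p + of_real e) f \<psi>) \<le> ?K" if e: "e > 0" for e :: real
  proof -
    have pos: "0 < Re p + e" using p e by linarith
    then have "norm (R (p + of_real e) f \<psi>) \<le> ?K / Re (p + of_real e)"
      by (intro R_bound[OF f \<psi>]) simp
    also have "\<dots> \<le> ?K / e" using p e pos by (intro divide_left_mono mult_pos_pos) auto
    finally show ?thesis using e by (simp add: norm_mult field_simps)
  qed
  from laurent_limit[OF * this] show ?thesis by (simp add: Res_def)
qed

text \<open>To the right of the axis the bound on \<open>R\<close> does not degenerate near p, so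
  the limit that computes the residue is 0.\<close>

lemma Res_right_half_plane:
  assumes f: "f \<in> test_fun \<Gamma>" and \<psi>: "\<psi> \<in> test_fun \<Gamma>" and p: "0 < Re p"
  shows "Res 0 p f \<psi> = 0"
proof (rule tendsto_unique[OF _ Res_limit[OF f \<psi>]])
  let ?K = "(energy f + energy \<psi>) / 2"
  show "((\<lambda>e. of_real e * R (p + of_real e) f \<psi>) \<longlongrightarrow> 0) (at_right 0)"
  proof (rule Lim_null_comparison)
    show "((\<lambda>e. e * (?K / Re p)) \<longlongrightarrow> 0) (at_right 0)"
      by (rule tendsto_mult_left_zero[OF tendsto_ident_at])
    show "\<forall>\<^sub>F e in at_right 0. norm (of_real e * R (p + of_real e) f \<psi>) \<le> e * (?K / Re p)"
      using eventually_at_right_less[of "0::real"]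
    proof eventually_elim
      case (elim e)
      have "norm (R (p + of_real e) f \<psi>) \<le> ?K / Re (p + of_real e)"
        by (rule R_bound[OF f \<psi>]) (use p elim in simp)
      also have "\<dots> \<le> ?K / Re p" using p elim by (intro divide_left_mono mult_pos_pos) auto
      finally have "norm (R (p + of_real e) f \<psi>) \<le> ?K / Re p" .
      from mult_left_mono[OF this, of e] show ?case using elim by (simp add: norm_mult)
    qed
  qed
qed (use p in auto)

lemma Res_0_bound:
  assumes f: "f \<in> test_fun \<Gamma>" and \<psi>: "\<psi> \<in> test_fun \<Gamma>"
  shows "norm (Res 0 0 f \<psi>) \<le> (energy f + energy \<psi>) / 2"
proof (rule tendsto_upperbound)
  show "((\<lambda>e. norm (of_real e * R (0 + of_real e) f \<psi>)) \<longlongrightarrow> norm (Res 0 0 f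
    \<psi>)) (at_right 0)"
    by (intro tendsto_norm Res_limit f \<psi>) simp
  show "\<forall>\<^sub>F e in at_right 0. norm (of_real e * R (0 + of_real e) f \<psi>) \<le> (energy f
    + energy \<psi>) / 2"
    using eventually_at_right_less[of "0::real"]
  proof eventually_elim
    case (elim e)
    then show ?case using R_bound[OF f \<psi>, of "of_real e"] by (simp add: norm_mult field_simps)
  qed
qed simp

text \<open>\<open>R_pull_limit\<close> settles backward times; a forward time follows by applying
  it to \<open>flow_pull T f\<close>.\<close>

lemma Res_0_pull_left:
  assumes f: "f \<in> test_fun \<Gamma>" and \<psi>: "\<psi> \<in> test_fun \<Gamma>"
  shows "Res 0 0 (flow_pull T f) \<psi> = Res 0 0 f \<psi>"
proof -
  have neg: "Res 0 0 (flow_pull (- \<tau>) f) \<psi> = Res 0 0 f \<psi>" if "\<tau> \<ge> 0"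
    "f \<in> test_fun \<Gamma>" for f \<tau>
  proof -
    have "((\<lambda>e. of_real e * R (0 + of_real e) (flow_pull (- \<tau>) f) \<psi> - of_real e * R (0
      + of_real e) f \<psi>) 
        \<longlongrightarrow> Res 0 0 (flow_pull (- \<tau>) f) \<psi> - Res 0 0 f \<psi>) (at_right 0)"
      using that \<psi> by (intro tendsto_diff Res_limit test_fun_flow_pull) auto
    moreover have "((\<lambda>e. of_real e * R (0 + of_real e) (flow_pull (- \<tau>) f) \<psi>
      - of_real e * R (0 + of_real e) f \<psi>) \<longlongrightarrow> 0) (at_right 0)"
      using R_pull_limit[OF that(2) \<psi> that(1)] by (simp add: right_diff_distrib)
    ultimately have "Res 0 0 (flow_pull (- \<tau>) f) \<psi> - Res 0 0 f \<psi> = 0"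
      by (rule tendsto_unique[rotated]) simp
    then show ?thesis by simp
  qed
  show ?thesis
  proof (cases "T \<le> 0")
    case True
    then show ?thesis using neg[of "- T" f] f by simp
  next
    case False
    then show ?thesis using neg[of T "flow_pull T f"] test_fun_flow_pull[OF f, of T] by (simp add: flow_pull_add)
  qed
qed

lemma Res_0_pull_right:
  assumes f: "f \<in> test_fun \<Gamma>" and \<psi>: "\<psi> \<in> test_fun \<Gamma>"
  shows "Res 0 0 f (flow_pull T \<psi>) = Res 0 0 f \<psi>"
proof -
  have "((\<lambda>e. of_real e * R (0 + of_real e) f (flow_pull T \<psi>)) \<longlongrightarrow> Res 0 0 f
    (flow_pull T \<psi>)) (at_right 0)"
    by (intro Res_limit f test_fun_flow_pull \<psi>) simp
  moreover have "((\<lambda>e. of_real e * R (0 + of_real e) f (flow_pull T \<psi>)) \<longlongrightarrow> Res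
    0 0 (flow_pull (- T) f) \<psi>) (at_right 0)"
  proof (rule Lim_transform_eventually[OF Res_limit[OF test_fun_flow_pull[OF f] \<psi>]])
    show "\<forall>\<^sub>F e in at_right 0. of_real e * R (0 + of_real e) (flow_pull (- T) f) \<psi>
      = of_real e * R (0 + of_real e) f (flow_pull T \<psi>)"
      using eventually_at_right_less[of "0::real"]
      by eventually_elim (simp add: R_pull_right[OF f \<psi>])
  qed simp
  ultimately have "Res 0 0 f (flow_pull T \<psi>) = Res 0 0 (flow_pull (- T) f) \<psi>"
    by (rule tendsto_unique[rotated]) simp
  then show ?thesis using Res_0_pull_left[OF f \<psi>] by simp
qed

text \<open>Bound and invariance hold in each argument in the form that \<open>mautner\<close> asks
  for. The first part will give \<open>U_- W (-1) = 0\<close>, the second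
  \<open>U_+ W 0 = 0\<close>.\<close>

lemma Res_0_horocyclic:
  assumes f: "f \<in> test_fun \<Gamma>" and \<psi>: "\<psi> \<in> test_fun \<Gamma>" and V: "V \<in> {Uplus, Uminus}"
  shows "Res 0 0 (lie_deriv V f) \<psi> = 0" "Res 0 0 f (lie_deriv V \<psi>) = 0"
proof -
  show "Res 0 0 (lie_deriv V f) \<psi> = 0"
    by (rule mautner[where u = "\<lambda>f. Res 0 0 f \<psi>" and K = "energy \<psi>", OF _ _ _ V f])
       (use Res_left_lincomb Res_0_pull_left Res_0_bound \<psi> in blast)+
  show "Res 0 0 f (lie_deriv V \<psi>) = 0"
  proof (rule mautner[where u = "\<lambda>\<psi>. Res 0 0 f \<psi>" and K = "energy f", OF _ _ _ V \<psi>])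
    show "norm (Res 0 0 f \<psi>) \<le> (energy \<psi> + energy f) / 2" if "\<psi> \<in> test_fun \<Gamma>" for \<psi>
      using Res_0_bound[OF f that] by (simp add: add.commute)
  qed (auto simp: Res_right_lincomb f Res_0_pull_right)
qed

end

section \<open>Lowest weight vectors\<close>

text \<open>\<open>X\<close> acts on \<open>W \<mu>\<close> as -\<mu> plus a nilpotent, so
  \<open>E\<close> raises the weight of \<open>X\<close> while lowering \<mu>. The last two
  assumptions are independent input: the Verma module of lowest weight 0 meets all others but
  violates \<open>E_W0\<close>, and uniqueness of the decomposition fails there; its dual violates
  \<open>F_W1\<close>, and existence fails.\<close>

locale lowest_weight = vector_space scale
  for scale :: "complex \<Rightarrow> 'v \<Rightarrow> 'v::ab_group_add" +
  fixes W :: "complex \<Rightarrow> 'v set" and X E F :: "'v \<Rightarrow> 'v"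
  assumes sub: "subspace (W \<mu>)"
    and lin: "Vector_Spaces.linear scale scale X" "Vector_Spaces.linear scale scale E"
      "Vector_Spaces.linear scale scale F"
    and XW: "u \<in> W \<mu> \<Longrightarrow> X u \<in> W \<mu>"
    and EW: "u \<in> W \<mu> \<Longrightarrow> E u \<in> W (\<mu> - 1)"
    and FW: "u \<in> W \<mu> \<Longrightarrow> F u \<in> W (\<mu> + 1)"
    and XE: "u \<in> W \<mu> \<Longrightarrow> X (E u) = E (X u) + E u"
    and XF: "u \<in> W \<mu> \<Longrightarrow> X (F u) = F (X u) - F u"
    and EF: "u \<in> W \<mu> \<Longrightarrow> E (F u) = F (E u) + scale 2 (X u)"
    and W_trivial: "0 < Re \<mu> \<Longrightarrow> u \<in> W \<mu> \<Longrightarrow> u = 0"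
    and nilpotent: "\<exists>n. \<forall>u\<in>W \<mu>. ((\<lambda>v. X v + scale \<mu> v) ^^ n) u = 0"
    and E_W0: "u \<in> W 0 \<Longrightarrow> E u = 0"
    and F_W1: "u \<in> W (-1) \<Longrightarrow> F u = 0"
begin

definition K :: "complex \<Rightarrow> 'v set" where "K \<mu> = {u \<in> W \<mu>. F u = 0}"

lemmas W_closed = subspace_add[OF sub] subspace_diff[OF sub] subspace_scale[OF sub] subspace_0[OF sub]
  subspace_neg[OF sub]

lemma lin_simps [simp]:
  "X (u + v) = X u + X v" "X (u - v) = X u - X v" "X (scale c u) = scale c (X u)" "X 0 = 0"
  "E (u + v) = E u + E v" "E (u - v) = E u - E v" "E (scale c u) = scale c (E u)" "E 0 = 0"
  "F (u + v) = F u + F v" "F (u - v) = F u - F v" "F (scale c u) = scale c (F u)" "F 0 = 0"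
  using lin by (simp_all add: Vector_Spaces.linear.axioms module_hom.add module_hom.diff module_hom.scale
    module_hom.zero
      module_hom_iff_linear[symmetric])

lemma pow_linear:
  assumes "L \<in> {E, F}"
  shows "(L ^^ n) (u + v) = (L ^^ n) u + (L ^^ n) v" "(L ^^ n) (u - v) = (L ^^ n) u - (L ^^ n) v"
    "(L ^^ n) (scale c u) = scale c ((L ^^ n) u)" "(L ^^ n) 0 = 0"
  using assms by (induction n) auto

lemma pow_sum:
  assumes "L \<in> {E, F}" shows "(L ^^ n) (sum f A) = (\<Sum>i\<in>A. (L ^^ n) (f i))"
  by (induction A rule: infinite_finite_induct) (auto simp: pow_linear[OF assms])

lemma E_pow_W: "u \<in> W \<mu> \<Longrightarrow> (E ^^ n) u \<in> W (\<mu> - of_nat n)"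
proof (induction n)
  case (Suc n)
  then show ?case using EW[of "(E ^^ n) u" "\<mu> - of_nat n"] by (simp add: algebra_simps)
qed simp

lemma F_pow_W: "u \<in> W \<mu> \<Longrightarrow> (F ^^ n) u \<in> W (\<mu> + of_nat n)"
proof (induction n)
  case (Suc n)
  then show ?case using FW[of "(F ^^ n) u" "\<mu> + of_nat n"] by (simp add: algebra_simps)
qed simp

lemma K_closed:
  "u \<in> K \<mu> \<Longrightarrow> v \<in> K \<mu> \<Longrightarrow>
    u + v \<in> K \<mu>" "u \<in> K \<mu> \<Longrightarrow> v \<in> K \<mu> \<Longrightarrow> u - v \<in> K \<mu>"
  "u \<in> K \<mu> \<Longrightarrow> scale c u \<in> K \<mu>" "0 \<in> K \<mu>"
    "u \<in> K \<mu> \<Longrightarrow> X u \<in> K \<mu>"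
proof -
  show "u \<in> K \<mu> \<Longrightarrow> X u \<in> K \<mu>"
    using XF[of u \<mu>] XW[of u \<mu>] by (auto simp: K_def)
qed (auto simp: K_def W_closed)

lemma X_E_pow: "u \<in> W \<mu> \<Longrightarrow> X ((E ^^ n) u) = (E ^^ n) (X u + scale (of_nat n) u)"
proof (induction n)
  case (Suc n)
  have "X ((E ^^ Suc n) u) = E (X ((E ^^ n) u)) + (E ^^ Suc n) u"
    using XE[OF E_pow_W[OF Suc.prems]] by simp
  also have "\<dots> = (E ^^ Suc n) (X u + scale (of_nat (Suc n)) u)"
    using Suc by (simp add: pow_linear scale_left_distrib algebra_simps)
  finally show ?case .
qed simp

definition step :: "nat \<Rightarrow> 'v \<Rightarrow> 'v" where
  "step l u = scale (- of_nat (Suc l)) (scale 2 (X u) + scale (of_nat l) u)"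

lemma step_K: "u \<in> K \<mu> \<Longrightarrow> step l u \<in> K \<mu>"
  unfolding step_def by (intro K_closed)

text \<open>Moving \<open>F\<close> to the right past l + 1 factors \<open>E\<close> costs - 2 (X +
  j) for j = 0, ..., l, and the sum of these is - (l + 1) (2 X + l), the operator
  \<open>step l\<close>.\<close>

lemma F_E_pow: "u \<in> K \<mu> \<Longrightarrow> F ((E ^^ Suc l) u) = (E ^^ l) (step l u)"
proof (induction l)
  case 0
  then show ?case using EF[of u \<mu>] by (simp add: K_def step_def eq_neg_iff_add_eq_0 add.commute)
next
  case (Suc l)
  then have u: "u \<in> W \<mu>" by (simp add: K_def)
  let ?v = "(E ^^ Suc l) u"
  have "F (E ?v) = E (F ?v) - scale 2 (X ?v)"
    using EF[OF E_pow_W[OF u], of "Suc l"] by (simp add: algebra_simps)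
  also have "\<dots> = (E ^^ Suc l) (step l u) - (E ^^ Suc l) (scale 2 (X u + scale (of_nat (Suc l)) u))"
    unfolding X_E_pow[OF u] Suc.IH[OF Suc.prems] by (simp add: pow_linear)
  also have "\<dots> = (E ^^ Suc l) (step l u - scale 2 (X u + scale (of_nat (Suc l)) u))"
    by (simp add: pow_linear)
  also have "step l u - scale 2 (X u + scale (of_nat (Suc l)) u) = step (Suc l) u"
  proof -
    have "step l u - scale 2 (X u + scale (of_nat (Suc l)) u) =
       scale (- of_nat (Suc l) * 2 - 2) (X u) + scale (- of_nat (Suc l) * of_nat l - 2 * of_nat (Suc l)) u"
      unfolding step_def by (simp add: scale_right_distrib scale_left_diff_distrib del: of_nat_Suc)
    also have "\<dots> = step (Suc l) u"
      unfolding step_def scale_right_distrib scale_scale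
      by (intro arg_cong2[where f="(+)"] arg_cong2[where f=scale]) (simp_all add: algebra_simps)
    finally show ?thesis .
  qed
  finally show ?case by simp
qed

text \<open>T = X + \<mu> is nilpotent, so 2 T + d is a nonzero scalar plus a nilpotent and hence
  invertible on \<open>K \<mu>\<close>.\<close>

lemma shift_bij:
  assumes d: "d \<noteq> 0"
  shows "u \<in> K \<mu> \<Longrightarrow> scale 2 (X u + scale \<mu> u) + scale d u = 0 \<Longrightarrow> u = 0"
    and "v \<in> K \<mu> \<Longrightarrow> \<exists>w\<in>K \<mu>. scale 2 (X w + scale \<mu> w) + scale d w = v"
proof -
  define T where "T v = X v + scale \<mu> v" for v
  obtain n where n: "\<And>u. u \<in> W \<mu> \<Longrightarrow> (T ^^ n) u = 0"
    using nilpotent[of \<mu>] unfolding T_def by auto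
  have TK: "T v \<in> K \<mu>" if "v \<in> K \<mu>" for v unfolding T_def using that by (intro K_closed)
  have T_scale: "T (scale c v) = scale c (T v)" for c v
    by (simp add: T_def scale_right_distrib mult.commute)
  have Tn_scale: "(T ^^ m) (scale c v) = scale c ((T ^^ m) v)" for m c v
    by (induction m) (auto simp: T_scale)
  show "u = 0" if u: "u \<in> K \<mu>" "scale 2 (X u + scale \<mu> u) + scale d u = 0"
  proof -
    \<comment> \<open>A kernel vector would be an eigenvector of the nilpotent \<open>T\<close> for
      the nonzero eigenvalue - d / 2.\<close>
    have "scale 2 (T u) = scale (- d) u" using u(2) by (simp add: T_def eq_neg_iff_add_eq_0)
    then have "scale (1/2) (scale 2 (T u)) = scale (1/2) (scale (- d) u)" by simp
    then have T: "T u = scale (- d / 2) u" by simp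
    have "(T ^^ m) u = scale ((- d / 2) ^ m) u" for m
      by (induction m) (auto simp: T_scale T)
    with n[of u] u(1) have "scale ((- d / 2) ^ n) u = 0" by (simp add: K_def)
    then show ?thesis using d by simp
  qed
  have "\<exists>w\<in>K \<mu>. scale 2 (T w) + scale d w = v" if "v \<in> K \<mu>" "(T ^^ m) v = 0" for m v
    using that
  proof (induction m arbitrary: v)
    case 0
    then show ?case by (intro bexI[of _ 0]) (auto simp: K_closed T_def)
  next
    case (Suc m)
    \<comment> \<open>The first guess v / d misses the target by (2 / d) T v. The correction solves
      the same equation for a vector that one power fewer of \<open>T\<close> kills.\<close>
    have "scale (- 2 / d) (T v) \<in> K \<mu>" using Suc.prems by (intro K_closed TK)
    moreover have "(T ^^ m) (scale (- 2 / d) (T v)) = 0"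
      unfolding Tn_scale using Suc.prems(2) by (simp add: funpow_swap1)
    ultimately obtain w where w: "w \<in> K \<mu>" "scale 2 (T w) + scale d w = scale (- 2 / d) (T v)"
      using Suc.IH by blast
    let ?w = "scale (1 / d) v + w"
    have wK: "?w \<in> K \<mu>" using w Suc.prems by (intro K_closed)
    have "T ?w = scale (1/d) (T v) + T w"
      by (simp add: T_def scale_right_distrib mult.commute add.assoc add.left_commute)
    then have "scale 2 (T ?w) + scale d ?w = scale (2 / d) (T v) + v + (scale 2 (T w) + scale d w)"
      using d by (simp add: scale_right_distrib add.assoc add.left_commute)
    also have "\<dots> = v + (scale (2 / d) (T v) + scale (- 2 / d) (T v))" unfolding w by (simp add: ac_simps)
    also have "\<dots> = v" unfolding scale_left_distrib[symmetric] by simp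
    finally show ?case using wK by blast
  qed
  then show "v \<in> K \<mu> \<Longrightarrow> \<exists>w\<in>K \<mu>. scale 2 (X w + scale \<mu> w) + scale d w = v"
    using n unfolding T_def K_def by blast
qed

text \<open>On \<open>K \<mu>\<close> one has 2 X + l = 2 (X + \<mu>) + (l - 2 \<mu>). The scalar
  could vanish only for 2 \<mu> = l, which Re \<mu> \<le> 0 and \<mu> \<noteq> 0 exclude.\<close>

lemma step_bij:
  assumes \<mu>: "\<mu> \<noteq> 0" "Re \<mu> \<le> 0"
  shows "u \<in> K \<mu> \<Longrightarrow> step l u = 0 \<Longrightarrow>
    u = 0" and "v \<in> K \<mu> \<Longrightarrow> \<exists>w\<in>K \<mu>. step l w = v"
proof -
  define d where "d = of_nat l - 2 * \<mu>"
  have d: "d \<noteq> 0"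
  proof
    assume "d = 0"
    then have "of_nat l = 2 * \<mu>" by (simp add: d_def)
    moreover from this have "real l = 2 * Re \<mu>" by (metis Re_complex_of_real complex_Re_of_nat mult_2
      plus_complex.sel(1))
    ultimately have "l = 0" using \<mu> by linarith
    with \<open>of_nat l = 2 * \<mu>\<close> show False using \<mu> by simp
  qed
  have step: "step l u = scale (- of_nat (Suc l)) (scale 2 (X u + scale \<mu> u) + scale d u)" for u
  proof -
    have "scale 2 (X u + scale \<mu> u) + scale d u = scale 2 (X u) + (scale (2 * \<mu>) u + scale d u)"
      by (simp add: scale_right_distrib add.assoc)
    also have "\<dots> = scale 2 (X u) + scale (of_nat l) u"
      unfolding scale_left_distrib[symmetric] by (simp add: d_def)
    finally show ?thesis by (simp add: step_def)
  qed
  have nz: "- of_nat (Suc l) \<noteq> (0::complex)" by (simp del: of_nat_Suc)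
  show "u \<in> K \<mu> \<Longrightarrow> step l u = 0 \<Longrightarrow> u = 0"
    using shift_bij(1)[OF d, of u \<mu>] nz unfolding step by (simp del: of_nat_Suc)
  assume "v \<in> K \<mu>"
  then have "scale (1 / (- of_nat (Suc l))) v \<in> K \<mu>" by (intro K_closed)
  from shift_bij(2)[OF d this] obtain w where w: "w \<in> K \<mu>"
    "scale 2 (X w + scale \<mu> w) + scale d w = scale (1 / (- of_nat (Suc l))) v"
    by blast
  then have "step l w = v" unfolding step w(2) scale_scale using nz by (simp del: of_nat_Suc)
  with w(1) show "\<exists>w\<in>K \<mu>. step l w = v" by blast
qed

text \<open>Iterated, this exhibits \<open>F^m E^m\<close> on \<open>K \<mu>\<close> as the product
  of \<open>step 0\<close>, ..., \<open>step (m - 1)\<close>.\<close>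

lemma F_pow_E_pow_Suc:
  assumes "u \<in> K \<mu>"
  shows "(F ^^ Suc m) ((E ^^ Suc m) u) = (F ^^ m) ((E ^^ m) (step m u))"
  using F_E_pow[OF assms, of m] by (simp add: funpow_swap1)

lemma F_pow_E_pow_K: "u \<in> K \<mu> \<Longrightarrow> (F ^^ m) ((E ^^ m) u) \<in> K \<mu>"
proof (induction m arbitrary: u)
  case (Suc m)
  then show ?case unfolding F_pow_E_pow_Suc[OF Suc.prems] using step_K by blast
qed simp

text \<open>\<open>F^l E^l\<close> maps \<open>K \<mu>\<close> to itself, and one more
  \<open>F\<close> kills the result. This is the triangularity behind the uniqueness of the
  decomposition.\<close>

lemma F_pow_E_pow_zero:
  assumes "u \<in> K \<mu>" "l < m" shows "(F ^^ m) ((E ^^ l) u) = 0"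
proof -
  obtain j where m: "m = j + Suc l" using assms(2) less_imp_Suc_add by (metis add.commute add_Suc_right)
  have "F ((F ^^ l) ((E ^^ l) u)) = 0" using F_pow_E_pow_K[OF assms(1)] by (simp add: K_def)
  then show ?thesis unfolding m funpow_add by (simp add: pow_linear)
qed

lemma K_trivial: "0 < Re \<mu> \<Longrightarrow> u \<in> K \<mu> \<Longrightarrow> u = 0"
  using W_trivial by (simp add: K_def)

lemma F_pow_E_pow_inj:
  assumes \<mu>: "\<mu> \<noteq> 0" shows "u \<in> K \<mu> \<Longrightarrow>
    (F ^^ m) ((E ^^ m) u) = 0 \<Longrightarrow> u = 0"
proof (cases "0 < Re \<mu>")
  case False
  assume "u \<in> K \<mu>" "(F ^^ m) ((E ^^ m) u) = 0"
  then show ?thesis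
  proof (induction m arbitrary: u)
    case (Suc m)
    then have "step m u = 0" using step_K[OF Suc.prems(1)] F_pow_E_pow_Suc[OF Suc.prems(1)] by metis
    then show ?case using step_bij(1)[of \<mu> u m] \<mu> False Suc.prems by simp
  qed simp
qed (use K_trivial in auto)

lemma F_pow_E_pow_surj:
  assumes \<mu>: "\<mu> \<noteq> 0" and v: "v \<in> K \<mu>" shows "\<exists>w\<in>K \<mu>. (F ^^ m) ((E ^^ m) w) = v"
proof (cases "0 < Re \<mu>")
  case True
  have "v = 0" by (rule K_trivial[OF True v])
  then show ?thesis by (intro bexI[of _ 0]) (auto simp: K_closed pow_linear)
next
  case False
  show ?thesis
    using v
  proof (induction m arbitrary: v)
    case (Suc m)
    obtain w where w: "w \<in> K \<mu>" "(F ^^ m) ((E ^^ m) w) = v" using Suc by blast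
    obtain x where "x \<in> K \<mu>" "step m x = w" using step_bij(2)[of \<mu> w m] \<mu> False w by auto
    then show ?case using F_pow_E_pow_Suc w by metis
  qed auto
qed

lemma E_pow_inj_on:
  assumes "\<mu> \<noteq> 0" shows "inj_on (E ^^ m) (K \<mu>)"
proof (rule inj_onI)
  fix u v assume uv: "u \<in> K \<mu>" "v \<in> K \<mu>" "(E ^^ m) u = (E ^^ m) v"
  then have "(F ^^ m) ((E ^^ m) (u - v)) = 0" by (simp add: pow_linear)
  then have "u - v = 0" using F_pow_E_pow_inj[OF assms] K_closed uv by blast
  then show "u = v" by simp
qed

section \<open>Existence and uniqueness of the decomposition into lowest weight strings\<close>

lemma E_pow_W0: "u \<in> W 0 \<Longrightarrow> 0 < m \<Longrightarrow> (E ^^ m) u = 0"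
  using E_W0[of u] pow_linear(4)[of E] by (cases m) (auto simp: funpow_swap1)

text \<open>Peeling from the top: if F^(m+1) u = 0, then \<open>F^m u\<close> is a lowest weight
  vector. Once it is written as \<open>F^m E^m w\<close>, the difference u - E^m w is killed by
  \<open>F^m\<close>.\<close>

lemma decomposition_exists:
  assumes "u \<in> W \<mu>" "(F ^^ m) u = 0"
  shows "\<exists>k. (\<forall>l. k l \<in> K (\<mu> + of_nat l)) \<and> u = (\<Sum>l<m. (E ^^ l) (k l))"
  using assms
proof (induction m arbitrary: u)
  case 0
  then show ?case by (intro exI[of _ "\<lambda>_. 0"]) (auto simp: K_closed)
next
  case (Suc m)
  let ?v = "(F ^^ m) u"
  have v: "?v \<in> K (\<mu> + of_nat m)"
    using Suc.prems F_pow_W by (auto simp: K_def)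
  have "\<exists>w\<in>K (\<mu> + of_nat m). (F ^^ m) ((E ^^ m) w) = ?v"
  proof (cases "\<mu> + of_nat m = 0")
    case False
    then show ?thesis using F_pow_E_pow_surj v by blast
  next
    case True
    show ?thesis
    proof (cases m)
      case 0
      then show ?thesis using v by auto
    next
      case (Suc j)
      have "(F ^^ j) u \<in> W (\<mu> + of_nat j)" using F_pow_W Suc.prems by blast
      moreover have "\<mu> + of_nat j = -1" using True Suc by (simp add: eq_neg_iff_add_eq_0 ac_simps)
      ultimately have "?v = 0" using F_W1 Suc by simp
      then show ?thesis by (intro bexI[of _ 0]) (auto simp: K_closed pow_linear)
    qed
  qed
  then obtain w where w: "w \<in> K (\<mu> + of_nat m)" "(F ^^ m) ((E ^^ m) w) = ?v" by blast
  have "(E ^^ m) w \<in> W \<mu>" using E_pow_W[of w "\<mu> + of_nat m" m] w by (simp add: K_def)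
  then have "u - (E ^^ m) w \<in> W \<mu>" using Suc.prems by (intro W_closed)
  moreover have "(F ^^ m) (u - (E ^^ m) w) = 0" by (simp add: pow_linear w)
  ultimately obtain k where k: "\<And>l. k l \<in> K (\<mu> + of_nat l)" "u - (E ^^ m) w = (\<Sum>l<m. (E ^^ l) (k l))"
    using Suc.IH by blast
  show ?case
  proof (intro exI[of _ "k(m := w)"] conjI allI)
    show "(k(m := w)) l \<in> K (\<mu> + of_nat l)" for l using k w by simp
    have "u = (\<Sum>l<m. (E ^^ l) (k l)) + (E ^^ m) w" using k(2) by (metis diff_add_cancel)
    also have "\<dots> = (\<Sum>l<Suc m. (E ^^ l) ((k(m := w)) l))" by simp
    finally show "u = (\<Sum>l<Suc m. (E ^^ l) ((k(m := w)) l))" .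
  qed
qed

text \<open>The claim concerns the terms \<open>E^l (k l)\<close> and not the vectors
  \<open>k l\<close>, because \<open>E^l\<close> need not be injective where \<mu> + l = 0. Applying
  \<open>F^n\<close> isolates the top term.\<close>

lemma decomposition_unique:
  assumes "\<And>l. l < n \<Longrightarrow> k l \<in> K (\<mu> + of_nat l)" "(\<Sum>l<n. (E ^^ l) (k l)) = 0" "l < n"
  shows "(E ^^ l) (k l) = 0"
  using assms
proof (induction n arbitrary: l)
  case (Suc n)
  have "(F ^^ n) (\<Sum>l<Suc n. (E ^^ l) (k l)) = (\<Sum>l<n. (F ^^ n) ((E ^^ l) (k l))) + (F ^^ n) ((E ^^ n) (k n))"
    by (simp add: pow_linear pow_sum)
  also have "(\<Sum>l<n. (F ^^ n) ((E ^^ l) (k l))) = 0"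
  proof (rule sum.neutral, rule ballI)
    fix l assume "l \<in> {..<n}"
    then show "(F ^^ n) ((E ^^ l) (k l)) = 0"
      using Suc.prems(1)[of l] by (intro F_pow_E_pow_zero) auto
  qed
  also have "(\<Sum>l<Suc n. (E ^^ l) (k l)) = 0" by (rule Suc.prems(2))
  finally have top: "(F ^^ n) ((E ^^ n) (k n)) = 0" by (simp add: pow_linear)
  have kn: "k n \<in> K (\<mu> + of_nat n)" using Suc.prems(1) by simp
  have last: "(E ^^ n) (k n) = 0"
  proof (cases "\<mu> + of_nat n = 0")
    case False
    then have "k n = 0" using F_pow_E_pow_inj kn top by blast
    then show ?thesis by (simp add: pow_linear)
  next
    \<comment> \<open>For n > 0 the space \<open>W 0\<close> is killed by \<open>E^n\<close>; for n
      = 0 the vanishing sum consists of \<open>k 0\<close> alone.\<close>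
    case True
    then show ?thesis using E_pow_W0[of "k n" n] kn Suc.prems(2) by (cases n) (auto simp: K_def)
  qed
  then have "(\<Sum>l<n. (E ^^ l) (k l)) = 0" using Suc.prems(2) by simp
  then show ?case using Suc.IH Suc.prems last by (cases "l = n") auto
qed simp

text \<open>\<open>F^n u\<close> lies in \<open>W (\<mu> + n)\<close>, which is zero to the right of
  the imaginary axis; this is the source of the upper limit of the direct sum.\<close>

lemma W_decomposition:
  assumes "u \<in> W \<mu>" "0 < Re \<mu> + real n"
  shows "\<exists>k. (\<forall>l. k l \<in> K (\<mu> + of_nat l)) \<and> u = (\<Sum>l<n. (E ^^ l) (k l))"
proof (rule decomposition_exists[OF assms(1)])
  show "(F ^^ n) u = 0" by (rule W_trivial[OF _ F_pow_W[OF assms(1)]]) (use assms in simp)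
qed

end

section \<open>The direct sum decomposition\<close>

lemma sum_fun_eval: "(\<Sum>i\<in>I. v i) \<psi> = (\<Sum>i\<in>I. v i \<psi> :: 'b::comm_monoid_add)"
  by (induction I rule: infinite_finite_induct) (auto simp: zero_fun_def plus_fun_def)

definition fscale :: "complex \<Rightarrow> functional \<Rightarrow> functional" where
  "fscale c u = (\<lambda>\<psi>. c * u \<psi>)"

interpretation fvs: vector_space fscale
  by unfold_locales (auto simp: fscale_def fun_eq_iff plus_fun_def algebra_simps)

lemma dist_deriv_linear: "Vector_Spaces.linear fscale fscale (dist_deriv \<Gamma> V)"
  by unfold_locales (auto simp: dist_deriv_def fscale_def plus_fun_def fun_eq_iff)

context surface_resolvent
begin

lemma residue_op_eq: "residue_op \<Gamma> R p f = (\<lambda>\<psi>. if \<psi>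
  \<in> test_fun \<Gamma> then Res 0 p f \<psi> else 0)"
  by (simp add: residue_op_def Res_def fun_eq_iff)

lemma ran_cases:
  assumes "u \<in> ran_residue \<Gamma> R p"
  obtains f where "f \<in> test_fun \<Gamma>" "u = residue_op \<Gamma> R p f"
  using assms by (auto simp: ran_residue_def)

lemma residue_op_in_ran: "f \<in> test_fun \<Gamma> \<Longrightarrow>
  residue_op \<Gamma> R p f \<in> ran_residue \<Gamma> R p"
  by (simp add: ran_residue_def)

lemma ran_distributions: "ran_residue \<Gamma> R p \<subseteq> distributions \<Gamma>"
proof
  fix u assume "u \<in> ran_residue \<Gamma> R p"
  then obtain f where f: "f \<in> test_fun \<Gamma>" "u = residue_op \<Gamma> R p f" by (rule ran_cases)
  obtain A where A: "cont_operator \<Gamma> A" "\<And>f \<psi>. f \<in> test_fun \<Gamma> \<Longrightarrow>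
    \<psi> \<in> test_fun \<Gamma> \<Longrightarrow> Res 0 p f \<psi> = A f \<psi>"
    using Res_operator by blast
  have Af: "A f \<in> distributions \<Gamma>" using A f by (simp add: cont_operator_def)
  then have "A f \<psi> = 0" if "\<psi> \<notin> test_fun \<Gamma>" for \<psi> using that
    by (simp add: distributions_def)
  then have "u = A f" using A f by (auto simp: residue_op_eq fun_eq_iff)
  with Af show "u \<in> distributions \<Gamma>" by simp
qed

lemma residue_op_lincomb:
  assumes "f \<in> test_fun \<Gamma>" "h \<in> test_fun \<Gamma>"
  shows "residue_op \<Gamma> R p (\<lambda>g. a * f g + b * h g) = fscale a (residue_op \<Gamma> R p f)
    + fscale b (residue_op \<Gamma> R p h)"
  using assms by (auto simp: residue_op_eq fun_eq_iff plus_fun_def fscale_def Res_left_lincomb)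

lemma ran_subspace: "fvs.subspace (ran_residue \<Gamma> R p)"
proof (rule fvs.subspaceI)
  have lc: "fscale a u + fscale b v \<in> ran_residue \<Gamma> R p" if "u \<in> ran_residue \<Gamma> R p"
    "v \<in> ran_residue \<Gamma> R p" for a b u v
    using that by (elim ran_cases) (auto simp: residue_op_lincomb[symmetric] intro!: residue_op_in_ran test_fun_lincomb)
  have ne: "residue_op \<Gamma> R p (\<lambda>_. 0) \<in> ran_residue \<Gamma> R p"
    by (intro residue_op_in_ran test_fun_zero)
  show "0 \<in> ran_residue \<Gamma> R p" using lc[OF ne ne, of 0 0] by simp
  show "u + v \<in> ran_residue \<Gamma> R p" if "u \<in> ran_residue \<Gamma> R p"
    "v \<in> ran_residue \<Gamma> R p" for u v
    using lc[OF that, of 1 1] by simp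
  show "fscale c u \<in> ran_residue \<Gamma> R p" if "u \<in> ran_residue \<Gamma> R p" for c u
    using lc[OF that that, of c 0] by simp
qed

text \<open>The sign in \<open>dist_deriv\<close> cancels the one in \<open>Res_lie_deriv\<close>,
  so a frame derivative of a resonant state is the residue of the differentiated input, at the
  shifted point.\<close>

lemma dist_deriv_residue_op:
  assumes "f \<in> test_fun \<Gamma>" "V \<in> frame"
  shows "dist_deriv \<Gamma> V (residue_op \<Gamma> R p f) = residue_op \<Gamma> R (p
    - of_real (weight V)) (lie_deriv V f)"
  using assms by (auto simp: dist_deriv_def residue_op_eq fun_eq_iff Res_lie_deriv test_fun_lie_deriv)

lemma dist_deriv_ran:
  assumes "u \<in> ran_residue \<Gamma> R p" "V \<in> frame"
  shows "dist_deriv \<Gamma> V u \<in> ran_residue \<Gamma> R (p - of_real (weight V))"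
  using assms(1) by (rule ran_cases) (auto simp: dist_deriv_residue_op assms(2) intro!: residue_op_in_ran
    test_fun_lie_deriv)

lemma dist_deriv_twice:
  assumes "\<psi> \<in> test_fun \<Gamma>" "V \<in> frame" "V' \<in> frame"
  shows "dist_deriv \<Gamma> V (dist_deriv \<Gamma> V' u) \<psi> = u (lie_deriv V' (lie_deriv V \<psi>))"
  using assms by (simp add: dist_deriv_def test_fun_lie_deriv)

lemma ran_linear:
  assumes "u \<in> ran_residue \<Gamma> R p" "f \<in> test_fun \<Gamma>" "h \<in> test_fun \<Gamma>"
  shows "u (\<lambda>g. f g + c * h g) = u f + c * u h"
  using distributions_lincomb[OF subsetD[OF ran_distributions assms(1)] assms(2,3), of 1 c] by simp

text \<open>Duality reverses the order of two derivatives and so the sign of their commutator, and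
  the sign carried by a single derivative restores it. Brackets on distributions are thus the same
  as on functions.\<close>

lemma dist_bracket_X:
  assumes u: "u \<in> ran_residue \<Gamma> R p" and V: "V \<in> frame"
  shows "dist_deriv \<Gamma> X_mat (dist_deriv \<Gamma> V u)
    = dist_deriv \<Gamma> V (dist_deriv \<Gamma> X_mat u) + fscale (of_real (weight V)) (dist_deriv \<Gamma> V u)"
proof
  fix \<psi>
  show "dist_deriv \<Gamma> X_mat (dist_deriv \<Gamma> V u) \<psi>
    = (dist_deriv \<Gamma> V (dist_deriv \<Gamma> X_mat u) + fscale (of_real (weight V)) (dist_deriv \<Gamma> V
      u)) \<psi>"
  proof (cases "\<psi> \<in> test_fun \<Gamma>")
    case False
    then show ?thesis by (simp add: dist_deriv_def fscale_def plus_fun_def)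
  next
    case True
    note t = test_fun_lie_deriv[OF True]
    have "lie_deriv X_mat (lie_deriv V \<psi>) = (\<lambda>g. lie_deriv V (lie_deriv X_mat \<psi>) g
      + of_real (weight V) * lie_deriv V \<psi> g)"
      using bracket_X[OF test_fun_smooth[OF True] V] by blast
    then have "u (lie_deriv X_mat (lie_deriv V \<psi>)) = u (lie_deriv V (lie_deriv X_mat \<psi>))
      + of_real (weight V) * u (lie_deriv V \<psi>)"
      using ran_linear[OF u test_fun_lie_deriv[OF t[OF in_frame(1)] V] t[OF V]] by simp
    then show ?thesis
      using True V by (simp add: dist_deriv_twice plus_fun_def fscale_def) (simp add: dist_deriv_def)
  qed
qed

lemma dist_bracket_U:
  assumes u: "u \<in> ran_residue \<Gamma> R p"
  shows "dist_deriv \<Gamma> Uplus (dist_deriv \<Gamma> Uminus u)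
    = dist_deriv \<Gamma> Uminus (dist_deriv \<Gamma> Uplus u) + fscale 2 (dist_deriv \<Gamma> X_mat u)"
proof
  fix \<psi>
  show "dist_deriv \<Gamma> Uplus (dist_deriv \<Gamma> Uminus u) \<psi>
    = (dist_deriv \<Gamma> Uminus (dist_deriv \<Gamma> Uplus u) + fscale 2 (dist_deriv \<Gamma> X_mat u)) \<psi>"
  proof (cases "\<psi> \<in> test_fun \<Gamma>")
    case False
    then show ?thesis by (simp add: dist_deriv_def fscale_def plus_fun_def)
  next
    case True
    note t = test_fun_lie_deriv[OF True]
    have "lie_deriv Uplus (lie_deriv Uminus \<psi>) = (\<lambda>g. lie_deriv Uminus (lie_deriv Uplus \<psi>) g
      + 2 * lie_deriv X_mat \<psi> g)"
      using bracket_Uplus_Uminus[OF test_fun_smooth[OF True]] by blast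
    then have "u (lie_deriv Uplus (lie_deriv Uminus \<psi>)) = u (lie_deriv Uminus (lie_deriv Uplus \<psi>))
      + 2 * u (lie_deriv X_mat \<psi>)"
      using ran_linear[OF u test_fun_lie_deriv[OF t[OF in_frame(2)] in_frame(3)] t[OF in_frame(1)]] by simp
    then show ?thesis
      using True by (simp add: dist_deriv_twice plus_fun_def fscale_def) (simp add: dist_deriv_def)
  qed
qed

text \<open>Each application of X + p moves one step up the Laurent coefficients, with a sign, and
  these vanish beyond the order of the pole.\<close>

lemma generalized_eigenvectors:
  "\<exists>n. \<forall>u\<in>ran_residue \<Gamma> R p. ((\<lambda>v. dist_deriv \<Gamma> X_mat v
    + fscale p v) ^^ n) u = 0"
proof -
  obtain N where N: "\<forall>f\<in>test_fun \<Gamma>. \<forall>\<psi>\<in>test_fun \<Gamma>. Res N p f \<psi> = 0"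
    using Res_eventually_zero by blast
  have pow: "((\<lambda>v. dist_deriv \<Gamma> X_mat v + fscale p v) ^^ n) (residue_op \<Gamma> R p f) = 
      (\<lambda>\<psi>. if \<psi> \<in> test_fun \<Gamma> then (- 1) ^ n * Res n p f \<psi> else 0)" if f: "f
        \<in> test_fun \<Gamma>" for n f
  proof (induction n)
    case 0
    then show ?case by (simp add: residue_op_eq fun_eq_iff)
  next
    case (Suc n)
    have "Res n p f (lie_deriv X_mat \<psi>) = Res (Suc n) p f \<psi> + p * Res n p f \<psi>" if "\<psi>
      \<in> test_fun \<Gamma>" for \<psi>
      using Res_lie_deriv[OF f that in_frame(1), of n p] Res_X[OF f that, of n p] by simp
    then have "dist_deriv \<Gamma> X_mat (\<lambda>\<psi>. if \<psi>
      \<in> test_fun \<Gamma> then (- 1) ^ n * Res n p f \<psi> else 0)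
        + fscale p (\<lambda>\<psi>. if \<psi> \<in> test_fun \<Gamma> then (- 1) ^ n * Res n p f \<psi> else 0)
        = (\<lambda>\<psi>. if \<psi> \<in> test_fun \<Gamma> then (- 1) ^ Suc n * Res (Suc n) p f \<psi> else 0)"
      by (auto simp: dist_deriv_def fscale_def plus_fun_def fun_eq_iff test_fun_lie_deriv algebra_simps)
    then show ?case
      by (simp only: funpow.simps o_apply Suc.IH)
  qed
  show ?thesis
  proof (intro exI[of _ N] ballI)
    fix u assume "u \<in> ran_residue \<Gamma> R p"
    then obtain f where f: "f \<in> test_fun \<Gamma>" "u = residue_op \<Gamma> R p f" by (rule ran_cases)
    show "((\<lambda>v. dist_deriv \<Gamma> X_mat v + fscale p v) ^^ N) u = 0"
      unfolding f(2) pow[OF f(1)] using N f by (auto simp: zero_fun_def)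
  qed
qed

sublocale lowest_weight fscale "ran_residue \<Gamma> R" "dist_deriv \<Gamma> X_mat" "dist_deriv \<Gamma> Uplus"
  "dist_deriv \<Gamma> Uminus"
proof (intro lowest_weight.intro lowest_weight_axioms.intro fvs.vector_space_axioms)
  fix p u assume u: "u \<in> ran_residue \<Gamma> R p"
  show "dist_deriv \<Gamma> X_mat u \<in> ran_residue \<Gamma> R p" using dist_deriv_ran[OF u in_frame(1)] by simp
  show "dist_deriv \<Gamma> Uplus u \<in> ran_residue \<Gamma> R (p - 1)" using dist_deriv_ran[OF u in_frame(2)] by simp
  show "dist_deriv \<Gamma> Uminus u \<in> ran_residue \<Gamma> R (p + 1)"
    using dist_deriv_ran[OF u in_frame(3)] by simp
  show "dist_deriv \<Gamma> X_mat (dist_deriv \<Gamma> Uplus u)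
    = dist_deriv \<Gamma> Uplus (dist_deriv \<Gamma> X_mat u) + dist_deriv \<Gamma> Uplus u"
    using dist_bracket_X[OF u in_frame(2)] by simp
  show "dist_deriv \<Gamma> X_mat (dist_deriv \<Gamma> Uminus u)
    = dist_deriv \<Gamma> Uminus (dist_deriv \<Gamma> X_mat u) - dist_deriv \<Gamma> Uminus u"
    using dist_bracket_X[OF u in_frame(3)] by simp
  show "dist_deriv \<Gamma> Uplus (dist_deriv \<Gamma> Uminus u)
    = dist_deriv \<Gamma> Uminus (dist_deriv \<Gamma> Uplus u) + fscale 2 (dist_deriv \<Gamma> X_mat u)"
    by (rule dist_bracket_U[OF u])
next
  fix p u assume p: "0 < Re p" and u: "u \<in> ran_residue \<Gamma> R p"
  show "u = 0" using u by (rule ran_cases) (auto simp: residue_op_eq Res_right_half_plane[OF _ _ p] zero_fun_def)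
next
  fix u assume "u \<in> ran_residue \<Gamma> R 0"
  then obtain f where f: "f \<in> test_fun \<Gamma>" "u = residue_op \<Gamma> R 0 f" by (rule ran_cases)
  then show "dist_deriv \<Gamma> Uplus u = 0"
    by (auto simp: dist_deriv_def residue_op_eq zero_fun_def fun_eq_iff Res_0_horocyclic)
next
  fix u assume "u \<in> ran_residue \<Gamma> R (- 1)"
  then obtain f where f: "f \<in> test_fun \<Gamma>" "u = residue_op \<Gamma> R (- 1) f" by (rule ran_cases)
  \<comment> \<open>The weight -1 moves the pole from -1 to 0, where the derivative falls on the
    input of the residue.\<close>
  then have "dist_deriv \<Gamma> Uminus u = residue_op \<Gamma> R 0 (lie_deriv Uminus f)"
    using dist_deriv_residue_op[OF f(1) in_frame(3), of "- 1"] by simp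
  then show "dist_deriv \<Gamma> Uminus u = 0"
    using f(1) by (auto simp: residue_op_eq zero_fun_def fun_eq_iff Res_0_horocyclic)
qed (rule ran_subspace dist_deriv_linear generalized_eigenvectors)+

lemma K_eq: "ran_residue \<Gamma> R p \<inter> ker_dist \<Gamma> Uminus = K p"
  using ran_distributions[of p] by (auto simp: K_def ker_dist_def zero_fun_def)

end

theorem proposition1p3:
  fixes \<Gamma> :: "psl2 set" and R :: "complex \<Rightarrow> operator" and s\<^sub>0 :: complex
  assumes "compact_surface \<Gamma> \<or> convex_cocompact_surface \<Gamma>"
    and "resolvent_extension \<Gamma> R"
  shows "is_direct_sum {l::nat. real l \<le> \<bar>Re s\<^sub>0\<bar>}
           (\<lambda>l. (dist_deriv \<Gamma> Uplus ^^ l) `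
                 (ran_residue \<Gamma> R (s\<^sub>0 + of_nat l) \<inter> ker_dist \<Gamma> Uminus))
           (ran_residue \<Gamma> R s\<^sub>0)
       \<and> (\<forall>l::nat. real l \<le> \<bar>Re s\<^sub>0\<bar> \<longrightarrow>
            dist_deriv \<Gamma> Uplus ^^ l
              \<in> ran_residue \<Gamma> R (s\<^sub>0 + of_nat l) \<inter> ker_dist \<Gamma> Uminus \<rightarrow> ran_residue \<Gamma> R s\<^sub>0
          \<and> (s\<^sub>0 + of_nat l \<noteq> 0 \<longrightarrow>
               inj_on (dist_deriv \<Gamma> Uplus ^^ l)
                 (ran_residue \<Gamma> R (s\<^sub>0 + of_nat l) \<inter> ker_dist \<Gamma> Uminus)))"
proof -
  have "surface_group \<Gamma>"
    using assms(1) by (auto simp: compact_surface_def convex_cocompact_surface_def)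
  then interpret surface_resolvent \<Gamma> R
    using assms(2) by unfold_locales
  let ?E = "dist_deriv \<Gamma> Uplus"
  let ?I = "{l::nat. real l \<le> \<bar>Re s\<^sub>0\<bar>}"
  define n where "n = Suc (nat \<lfloor>\<bar>Re s\<^sub>0\<bar>\<rfloor>)"
  have I: "?I = {..<n}"
    by (auto simp: n_def less_Suc_eq_le le_nat_iff le_floor_iff)
  have n: "0 < Re s\<^sub>0 + real n" unfolding n_def by linarith
  have into: "(?E ^^ l) u \<in> ran_residue \<Gamma> R s\<^sub>0" if "u \<in> K (s\<^sub>0 + of_nat l)" for l u
    using E_pow_W[of u "s\<^sub>0 + of_nat l" l] that by (simp add: K_def)
  have sum: "(\<lambda>\<psi>. \<Sum>i<n. v i \<psi>) = (\<Sum>i<n. v i)" for v :: "nat \<Rightarrow> functional"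
    by (simp add: fun_eq_iff sum_fun_eval)
  let ?P = "Pi\<^sub>E {..<n} (\<lambda>l. (?E ^^ l) ` K (s\<^sub>0 + of_nat l))"
  have "bij_betw (\<lambda>v. \<Sum>i<n. v i) (?P) (ran_residue \<Gamma> R s\<^sub>0)"
    unfolding bij_betw_def
  proof (intro conjI inj_onI)
    fix v w assume v: "v \<in> ?P"
      and w: "w \<in> ?P" and eq: "(\<Sum>i<n. v i) = (\<Sum>i<n. w i)"
    obtain a where a: "\<And>l. l < n \<Longrightarrow> a l \<in> K (s\<^sub>0 + of_nat l) \<and> v l = (?E ^^ l) (a l)"
      using v by (atomize_elim, intro choice) (auto simp: PiE_def Pi_def)
    obtain b where b: "\<And>l. l < n \<Longrightarrow> b l \<in> K (s\<^sub>0 + of_nat l) \<and> w l = (?E ^^ l) (b l)"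
      using w by (atomize_elim, intro choice) (auto simp: PiE_def Pi_def)
    have "(\<Sum>l<n. (?E ^^ l) (a l - b l)) = (\<Sum>l<n. v l - w l)"
      using a b by (intro sum.cong) (auto simp: pow_linear)
    also have "\<dots> = 0" using eq by (simp add: sum_subtractf)
    finally have "(\<Sum>l<n. (?E ^^ l) (a l - b l)) = 0" .
    moreover have "a l - b l \<in> K (s\<^sub>0 + of_nat l)" if "l < n" for l
      using a[OF that] b[OF that] by (intro K_closed) auto
    \<comment> \<open>The preimages \<open>a l\<close> and \<open>b l\<close> may differ when s_0 +
      l = 0; only their images under \<open>E^l\<close>, which are the components, have to
      agree.\<close>
    ultimately have "(?E ^^ l) (a l - b l) = 0" if "l < n" for l
      using decomposition_unique[where n = n and \<mu> = s\<^sub>0 and k = "\<lambda>l. a l - b l"] that by blast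
    then have "v l = w l" if "l < n" for l
      using a[OF that] b[OF that] that by (simp add: pow_linear)
    then show "v = w" using v w by (intro PiE_ext[of v "{..<n}" _ w]) auto
  next
    show "(\<lambda>v. \<Sum>i<n. v i) ` ?P = ran_residue \<Gamma> R s\<^sub>0"
    proof (intro equalityI subsetI)
      fix u assume "u \<in> (\<lambda>v. \<Sum>i<n. v i) ` ?P"
      then obtain v where v: "v \<in> ?P" "u = (\<Sum>i<n. v i)" by blast
      have "v i \<in> ran_residue \<Gamma> R s\<^sub>0" if "i < n" for i
        using v(1) that into by (auto simp: PiE_def Pi_def)
      then show "u \<in> ran_residue \<Gamma> R s\<^sub>0"
        unfolding v(2) by (intro fvs.subspace_sum ran_subspace) auto
    next
      fix u assume "u \<in> ran_residue \<Gamma> R s\<^sub>0"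
      from W_decomposition[OF this n] obtain k where k: "\<And>l. k l \<in> K (s\<^sub>0 + of_nat l)"
        "u = (\<Sum>l<n. (?E ^^ l) (k l))"
        by blast
      let ?v = "restrict (\<lambda>l. (?E ^^ l) (k l)) {..<n}"
      have "?v \<in> ?P" using k(1) by auto
      moreover have "u = (\<Sum>l<n. ?v l)" unfolding k(2) by (intro sum.cong) auto
      ultimately show "u \<in> (\<lambda>v. \<Sum>i<n. v i) ` ?P" by blast
    qed
  qed
  then have "is_direct_sum ?I (\<lambda>l. (?E ^^ l) ` K (s\<^sub>0 + of_nat l)) (ran_residue \<Gamma> R s\<^sub>0)"
    unfolding is_direct_sum_def I sum .
  then show ?thesis
    unfolding K_eq using into E_pow_inj_on by auto
qed

end
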